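(* Let $n\ge 2$ and let $s\in H^0(\mathbb{CP}^1,\mathcal O(n))$ be a nonzero section whose zeroes are all contained in an open hemisphere of $\mathbb{CP}^1$ with respect to the Fubini–Study metric. Let $P$ be the (geodesic) convex hull of the zeroes of $s$, and let $P_\infty$ be the opposite of $P$. Let $C_s$ be the set of critical points of $s$, and put $C_{s,P}=C_s\cap P$ and $C_{s,P_\infty}=C_s\cap P_\infty$. Then: (1) $C_s=C_{s,P}\cup C_{s,P_\infty}$, i.e. every critical point of $s$ lies in $P\cup P_\infty$; (2) $C_{s,P_\infty}$ is nonempty; (3) if $P$ is not a single point, then $C_{s,P_\infty}$ is contained in the interior of $P_\infty$; (4) $C_{s,P_\infty}$ contains at least one critical point which, if it is non-degenerate, has index $2$; (5) if all the critical points of the function $|s|^2$ are non-degenerate, then $C_{s,P}$ is also nonempty and is contained in the interior of $P$.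
   Context: The line bundle $\mathcal O(n)$ on $\mathbb{CP}^1$ carries the Fubini–Study Hermitian metric, for which a section $s$, viewed as a homogeneous polynomial of degree $n$ in $Z_0,Z_1$, has pointwise norm $|s|^2=|s(Z)|^2/(|Z_0|^2+|Z_1|^2)^n$. Let $\nabla$ be its Chern connection. A critical point of $s$ is a point where $\nabla s=0$; in a local frame $e$ with $|e|^2=e^{-\phi}$ and $s=fe$ this means $\partial f-f\,\partial\phi=0$. Away from the zeroes of $s$, these are exactly the critical points of $\log|s|^2$ (equivalently of $|s|^2$). A critical point of a real function is non-degenerate if its real Hessian there is nonsingular; the index of $s$ at a critical point (away from the zeroes) is the number of negative eigenvalues of the real Hessian of $\log|s|^2$ there. With the Fubini–Study metric $\mathbb{CP}^1$ is a round sphere normalized so that antipodal points are at distance $\pi/2$. The opposite of a point $x$ is its antipodal point, i.e. the unique point at distance $\pi/2$ from $x$; the opposite $S_\infty$ of a subset $S\subset\mathbb{CP}^1$ is the set of opposites of the points of $S$. When the zeroes all lie on one minimal geodesic, $P$ means the corresponding closed minimal geodesic segment spanned by them, and when they all coincide, $P$ means that single point. When $P$ is a geodesic segment, the interior of $P$ (or of $P_\infty$) means the segment without its two endpoints; when $P$ is a convex polygon, it means the topological interior. *)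

theory Defs
  imports "HOL-Analysis.Analysis"
begin

section \<open>The projective line\<close>

definition proj_rel :: "complex \<times> complex \<Rightarrow> complex \<times> complex \<Rightarrow> bool" where
  "proj_rel Z W \<longleftrightarrow>
     Z \<noteq> 0 \<and> W \<noteq> 0 \<and> (\<exists>c. c \<noteq> 0 \<and> fst W = c * fst Z \<and> snd W = c * snd Z)"

lemma proj_rel_refl: "Z \<noteq> 0 \<Longrightarrow> proj_rel Z Z"
  unfolding proj_rel_def by (auto intro: exI[of _ 1])

lemma proj_rel_sym: "proj_rel Z W \<Longrightarrow> proj_rel W Z"
proof -
  assume "proj_rel Z W"
  then obtain c where c: "Z \<noteq> 0" "W \<noteq> 0" "c \<noteq> 0" "fst W = c * fst Z" "snd W = c * snd Z"
    unfolding proj_rel_def by blast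
  show "proj_rel W Z"
    unfolding proj_rel_def using c by (auto intro!: exI[of _ "inverse c"])
qed

lemma proj_rel_trans: "proj_rel Z W \<Longrightarrow> proj_rel W V \<Longrightarrow> proj_rel Z V"
proof -
  assume "proj_rel Z W" "proj_rel W V"
  then obtain c d where c: "Z \<noteq> 0" "V \<noteq> 0" "c \<noteq> 0" "fst W = c * fst Z" "snd W = c * snd Z"
    "d \<noteq> 0" "fst V = d * fst W" "snd V = d * snd W"
    unfolding proj_rel_def by blast
  show "proj_rel Z V"
    unfolding proj_rel_def using c by (auto intro!: exI[of _ "d * c"])
qed

quotient_type cp1 = "complex \<times> complex" / partial: proj_rel
  morphisms rep_cp1 proj
proof (rule part_equivpI)
  show "\<exists>Z. proj_rel Z Z"
    by (rule exI[of _ "(1, 0)"], rule proj_rel_refl) (simp add: zero_prod_def)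
  show "symp proj_rel"
    by (rule sympI) (rule proj_rel_sym)
  show "transp proj_rel"
    by (rule transpI) (rule proj_rel_trans)
qed

text \<open>\<^term>\<open>proj Z\<close> is the point \<open>[Z\<^sub>0 : Z\<^sub>1]\<close>; it is only meaningful for nonzero \<^term>\<open>Z\<close>.\<close>

section \<open>The Fubini--Study distance\<close>

definition hprod :: "complex \<times> complex \<Rightarrow> complex \<times> complex \<Rightarrow> complex" where
  "hprod Z W = fst Z * cnj (fst W) + snd Z * cnj (snd W)"

definition hdet :: "complex \<times> complex \<Rightarrow> complex \<times> complex \<Rightarrow> complex" where
  "hdet Z W = fst Z * snd W - snd Z * fst W"

lemma norm_pair_sq: "(norm Z)\<^sup>2 = (cmod (fst Z))\<^sup>2 + (cmod (snd Z))\<^sup>2"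
  for Z :: "complex \<times> complex"
  by (cases Z) (simp add: norm_Pair)

lemma hprod_self: "hprod Z Z = of_real ((norm Z)\<^sup>2)"
  unfolding norm_pair_sq hprod_def by (simp add: complex_norm_square del: of_real_power)

lemma lagrange_hprod:
  "(cmod (hprod Z W))\<^sup>2 + (cmod (hdet Z W))\<^sup>2 = (norm Z)\<^sup>2 * (norm W)\<^sup>2"
proof -
  have "complex_of_real ((cmod (hprod Z W))\<^sup>2 + (cmod (hdet Z W))\<^sup>2) =
        complex_of_real ((norm Z)\<^sup>2 * (norm W)\<^sup>2)"
    unfolding norm_pair_sq hprod_def hdet_def of_real_add of_real_mult complex_norm_square
    by (simp add: algebra_simps)
  then show ?thesis
    by (simp only: of_real_eq_iff)
qed

lemma hprod_split:
  "hprod U W * of_real ((norm V)\<^sup>2) = hprod U V * hprod V W + hdet U V * cnj (hdet W V)"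
  unfolding hprod_self[symmetric] by (simp add: hprod_def hdet_def algebra_simps)

lemma hprod_commute: "hprod W Z = cnj (hprod Z W)"
  by (simp add: hprod_def mult.commute)

definition fs_angle :: "complex \<times> complex \<Rightarrow> complex \<times> complex \<Rightarrow> real" where
  "fs_angle Z W = arccos (cmod (hprod Z W) / (norm Z * norm W))"

lemma hprod_ratio:
  assumes "Z \<noteq> 0" "W \<noteq> 0"
  defines "c \<equiv> cmod (hprod Z W) / (norm Z * norm W)"
    and "d \<equiv> cmod (hdet Z W) / (norm Z * norm W)"
  shows "0 \<le> c" "c \<le> 1" "0 \<le> d" "c\<^sup>2 + d\<^sup>2 = 1"
proof -
  show "0 \<le> c" "0 \<le> d" unfolding c_def d_def by auto
  have "c\<^sup>2 + d\<^sup>2 = ((cmod (hprod Z W))\<^sup>2 + (cmod (hdet Z W))\<^sup>2) / ((norm Z)\<^sup>2 * (norm W)\<^sup>2)"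
    unfolding c_def d_def by (simp add: power_divide power_mult_distrib add_divide_distrib)
  also have "\<dots> = 1" unfolding lagrange_hprod using assms(1,2) by simp
  finally show sq: "c\<^sup>2 + d\<^sup>2 = 1" .
  have "c\<^sup>2 \<le> 1" using sq zero_le_power2[of d] by linarith
  then show "c \<le> 1" using \<open>0 \<le> c\<close> by (simp add: power_le_one_iff)
qed

lemma cos_sin_fs_angle:
  assumes "Z \<noteq> 0" "W \<noteq> 0"
  shows "cos (fs_angle Z W) = cmod (hprod Z W) / (norm Z * norm W)"
    and "sin (fs_angle Z W) = cmod (hdet Z W) / (norm Z * norm W)"
    and "0 \<le> fs_angle Z W" "fs_angle Z W \<le> pi / 2"
proof -
  note h = hprod_ratio[OF assms]
  show c: "cos (fs_angle Z W) = cmod (hprod Z W) / (norm Z * norm W)"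
    unfolding fs_angle_def by (rule cos_arccos) (use h in linarith)+
  have "sin (fs_angle Z W) = sqrt (1 - (cmod (hprod Z W) / (norm Z * norm W))\<^sup>2)"
    unfolding fs_angle_def by (rule sin_arccos) (use h in linarith)+
  also have "1 - (cmod (hprod Z W) / (norm Z * norm W))\<^sup>2 = (cmod (hdet Z W) / (norm Z * norm W))\<^sup>2"
    using h(4) by linarith
  also have "sqrt \<dots> = cmod (hdet Z W) / (norm Z * norm W)"
    using h(3) by simp
  finally show "sin (fs_angle Z W) = cmod (hdet Z W) / (norm Z * norm W)" .
  show "0 \<le> fs_angle Z W"
    unfolding fs_angle_def by (rule arccos_lbound) (use h in linarith)+
  show "fs_angle Z W \<le> pi / 2"
    unfolding fs_angle_def by (rule arccos_le_pi2) (use h in linarith)+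
qed

lemma fs_angle_triangle:
  assumes "U \<noteq> 0" "V \<noteq> 0" "W \<noteq> 0"
  shows "fs_angle U W \<le> fs_angle U V + fs_angle V W"
proof -
  note a = cos_sin_fs_angle[OF assms(1,2)] and b = cos_sin_fs_angle[OF assms(2,3)]
    and c = cos_sin_fs_angle[OF assms(1,3)]
  have pos: "norm U > 0" "norm V > 0" "norm W > 0" using assms by auto
  have det: "cmod (hdet W V) = cmod (hdet V W)"
    unfolding hdet_def by (simp add: mult.commute norm_minus_commute)
  have "hprod U V * hprod V W = hprod U W * of_real ((norm V)\<^sup>2) - hdet U V * cnj (hdet W V)"
    using hprod_split[of U W V] by simp
  then have "cmod (hprod U V) * cmod (hprod V W) =
      cmod (hprod U W * of_real ((norm V)\<^sup>2) - hdet U V * cnj (hdet W V))"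
    by (metis norm_mult)
  also have "\<dots> \<le> cmod (hprod U W) * (norm V)\<^sup>2 + cmod (hdet U V) * cmod (hdet V W)"
    by (rule order_trans[OF norm_triangle_ineq4]) (simp add: norm_mult norm_power det)
  finally have main: "cmod (hprod U V) * cmod (hprod V W) - cmod (hdet U V) * cmod (hdet V W)
      \<le> cmod (hprod U W) * (norm V)\<^sup>2" by simp
  have "cos (fs_angle U V + fs_angle V W) =
     (cmod (hprod U V) * cmod (hprod V W) - cmod (hdet U V) * cmod (hdet V W))
        / (norm U * (norm V)\<^sup>2 * norm W)"
    unfolding cos_add a(1,2) b(1,2) using pos
    by (simp add: power2_eq_square diff_divide_distrib mult_ac)
  also have "\<dots> \<le> cmod (hprod U W) * (norm V)\<^sup>2 / (norm U * (norm V)\<^sup>2 * norm W)"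
    by (rule divide_right_mono[OF main]) (use pos in \<open>simp add: less_imp_le\<close>)
  also have "\<dots> = cos (fs_angle U W)"
    unfolding c(1) using pos by simp
  finally have "cos (fs_angle U V + fs_angle V W) \<le> cos (fs_angle U W)" .
  moreover have "0 \<le> fs_angle U V + fs_angle V W" "fs_angle U V + fs_angle V W \<le> pi"
    using a(3,4) b(3,4) by auto
  moreover have "0 \<le> fs_angle U W" "fs_angle U W \<le> pi"
    using c(3,4) pi_gt_zero by linarith+
  ultimately show ?thesis by (meson cos_mono_le_eq)
qed

lemma fs_angle_commute: "fs_angle Z W = fs_angle W Z"
  unfolding fs_angle_def hprod_commute[of Z W] by (simp add: mult.commute)

lemma fs_angle_zero_iff:
  assumes "Z \<noteq> 0" "W \<noteq> 0"
  shows "fs_angle Z W = 0 \<longleftrightarrow> proj_rel Z W"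
proof -
  note a = cos_sin_fs_angle[OF assms]
  have "fs_angle Z W = 0 \<longleftrightarrow> hdet Z W = 0"
  proof
    assume "fs_angle Z W = 0"
    then show "hdet Z W = 0" using a(2) assms by simp
  next
    assume "hdet Z W = 0"
    then have "sin (fs_angle Z W) = 0" using a(2) by simp
    moreover have "fs_angle Z W < pi" using a(4) pi_gt_zero by linarith
    ultimately show "fs_angle Z W = 0"
      using a(3) sin_gt_zero[of "fs_angle Z W"] by (cases "fs_angle Z W = 0") auto
  qed
  also have "\<dots> \<longleftrightarrow> proj_rel Z W"
  proof
    assume d: "hdet Z W = 0"
    show "proj_rel Z W"
    proof (cases "fst Z = 0")
      case True
      then have "snd Z \<noteq> 0" using assms(1) by (simp add: prod_eq_iff)
      moreover from this True have "fst W = 0" using d by (simp add: hdet_def)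
      moreover from this have "snd W \<noteq> 0" using assms(2) by (simp add: prod_eq_iff)
      ultimately show ?thesis unfolding proj_rel_def using True assms
        by (auto intro!: exI[of _ "snd W / snd Z"])
    next
      case False
      have eq: "fst Z * snd W = snd Z * fst W" using d by (simp add: hdet_def)
      then have "fst W \<noteq> 0" using assms(2) False by (auto simp: prod_eq_iff)
      with eq show ?thesis unfolding proj_rel_def using False assms
        by (auto intro!: exI[of _ "fst W / fst Z"] simp: field_simps)
    qed
  next
    assume "proj_rel Z W"
    then show "hdet Z W = 0" unfolding proj_rel_def hdet_def by (auto simp: algebra_simps)
  qed
  finally show ?thesis .
qed

lemma fs_angle_cong:
  assumes "proj_rel Z Z'" "proj_rel W W'"
  shows "fs_angle Z W = fs_angle Z' W'"
proof -
  have nz: "Z \<noteq> 0" "Z' \<noteq> 0" "W \<noteq> 0" "W' \<noteq> 0" using assms unfolding proj_rel_def by auto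
  have 0: "fs_angle Z Z' = 0" "fs_angle Z' Z = 0" "fs_angle W W' = 0" "fs_angle W' W = 0"
    using assms nz fs_angle_zero_iff proj_rel_sym by blast+
  show ?thesis
  proof (rule antisym)
    show "fs_angle Z W \<le> fs_angle Z' W'"
      using fs_angle_triangle[of Z Z' W] fs_angle_triangle[of Z' W' W] nz 0 by linarith
    show "fs_angle Z' W' \<le> fs_angle Z W"
      using fs_angle_triangle[of Z' Z W'] fs_angle_triangle[of Z W W'] nz 0 by linarith
  qed
qed

lemma cp1_cases: obtains Z where "Z \<noteq> 0" "x = proj Z"
proof -
  have "proj_rel (rep_cp1 x) (rep_cp1 x)" using Quotient_rep_reflp[OF Quotient_cp1] .
  moreover have "proj (rep_cp1 x) = x" using Quotient_abs_rep[OF Quotient_cp1] .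
  ultimately show ?thesis using that[of "rep_cp1 x"] unfolding proj_rel_def by auto
qed

lemma proj_eq_iff:
  assumes "Z \<noteq> 0" "W \<noteq> 0"
  shows "proj Z = proj W \<longleftrightarrow> proj_rel Z W"
  using Quotient_rel[OF Quotient_cp1, of Z W] proj_rel_refl[OF assms(1)] proj_rel_refl[OF assms(2)]
  by simp

instantiation cp1 :: metric_space
begin

lift_definition dist_cp1 :: "cp1 \<Rightarrow> cp1 \<Rightarrow> real" is fs_angle
  by (rule fs_angle_cong)

definition uniformity_cp1 :: "(cp1 \<times> cp1) filter" where
  "uniformity_cp1 = (INF e\<in>{0 <..}. principal {(x, y). dist x y < e})"

definition open_cp1 :: "cp1 set \<Rightarrow> bool" where
  "open_cp1 U = (\<forall>x\<in>U. \<forall>\<^sub>F (x', y) in uniformity. x' = x \<longrightarrow> y \<in> U)"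

lemma dist_proj_aux:
  assumes "Z \<noteq> 0" "W \<noteq> 0"
  shows "dist (proj Z) (proj W) = fs_angle Z W"
  by (rule dist_cp1.abs_eq) (use assms proj_rel_refl in \<open>auto simp: eq_onp_def\<close>)

instance
proof
  fix x y z :: cp1
  obtain U where U: "U \<noteq> 0" "x = proj U" by (rule cp1_cases)
  obtain V where V: "V \<noteq> 0" "y = proj V" by (rule cp1_cases)
  obtain W where W: "W \<noteq> 0" "z = proj W" by (rule cp1_cases)
  show "dist x y = 0 \<longleftrightarrow> x = y"
    using U V by (simp add: dist_proj_aux fs_angle_zero_iff proj_eq_iff)
  show "dist x y \<le> dist x z + dist y z"
    using U V W fs_angle_triangle[of U W V] by (simp add: dist_proj_aux fs_angle_commute[of V W])
qed (simp_all add: uniformity_cp1_def open_cp1_def)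

end

lemma dist_proj:
  assumes "Z \<noteq> 0" "W \<noteq> 0"
  shows "dist (proj Z) (proj W) = arccos (cmod (hprod Z W) / (norm Z * norm W))"
  using dist_proj_aux[OF assms] by (simp add: fs_angle_def)

definition opposite :: "cp1 \<Rightarrow> cp1" where
  "opposite x = (THE y. dist x y = pi / 2)"

lemma dist_proj_eq_pi2:
  assumes "Z \<noteq> 0" "W \<noteq> 0"
  shows "dist (proj Z) (proj W) = pi / 2 \<longleftrightarrow> hprod Z W = 0"
proof
  assume "dist (proj Z) (proj W) = pi / 2"
  then have "fs_angle Z W = pi / 2" unfolding dist_proj_aux[OF assms] .
  then have "cos (fs_angle Z W) = 0" by (simp only: cos_pi_half)
  then show "hprod Z W = 0" using cos_sin_fs_angle(1)[OF assms] assms by simp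
qed (use assms in \<open>simp add: dist_proj\<close>)

lemma opposite_proj:
  assumes "Z \<noteq> 0"
  shows "opposite (proj Z) = proj (- cnj (snd Z), cnj (fst Z))"
    and "\<exists>!y. dist (proj Z) y = pi / 2"
proof -
  let ?W = "(- cnj (snd Z), cnj (fst Z))"
  have nz: "?W \<noteq> 0" using assms by (auto simp: prod_eq_iff)
  have 1: "dist (proj Z) (proj ?W) = pi / 2"
    unfolding dist_proj_eq_pi2[OF assms nz] by (simp add: hprod_def)
  have 2: "y = proj ?W" if y: "dist (proj Z) y = pi / 2" for y
  proof -
    obtain V where V: "V \<noteq> 0" "y = proj V" by (rule cp1_cases)
    have "hprod Z V = 0" using y unfolding V(2) dist_proj_eq_pi2[OF assms V(1)] .
    then have "cnj (hprod Z V) = 0" by simp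
    then have "hdet V ?W = 0" by (simp add: hprod_def hdet_def algebra_simps)
    then have "sin (fs_angle V ?W) = 0" using cos_sin_fs_angle(2)[OF V(1) nz] by simp
    moreover have "0 \<le> fs_angle V ?W" "fs_angle V ?W < pi"
      using cos_sin_fs_angle(3,4)[OF V(1) nz] pi_gt_zero by linarith+
    ultimately have "fs_angle V ?W = 0"
      using sin_gt_zero[of "fs_angle V ?W"] by fastforce
    then have "dist y (proj ?W) = 0" using V nz by (simp add: dist_proj_aux)
    then show ?thesis by simp
  qed
  from 1 2 show "\<exists>!y. dist (proj Z) y = pi / 2" by blast
  from 1 2 show "opposite (proj Z) = proj ?W" unfolding opposite_def by (rule the_equality)
qed

text \<open>Antipodal points are at distance \<open>\<pi>/2\<close>, so an open hemisphere is an open ball of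
  radius \<open>\<pi>/4\<close>.\<close>

definition open_hemisphere :: "cp1 \<Rightarrow> cp1 set" where
  "open_hemisphere c = ball c (pi / 4)"

section \<open>Geodesic convexity\<close>

text \<open>Minimal geodesics, parametrised by arc length.\<close>

definition minimal_geodesic :: "(real \<Rightarrow> cp1) \<Rightarrow> real \<Rightarrow> bool" where
  "minimal_geodesic \<gamma> l \<longleftrightarrow> 0 \<le> l \<and> (\<forall>a\<in>{0..l}. \<forall>b\<in>{0..l}. dist (\<gamma> a) (\<gamma> b) = \<bar>a - b\<bar>)"

definition geodesically_convex :: "cp1 set \<Rightarrow> bool" where
  "geodesically_convex K \<longleftrightarrow>
     (\<forall>\<gamma> l. minimal_geodesic \<gamma> l \<and> \<gamma> 0 \<in> K \<and> \<gamma> l \<in> K \<longrightarrow> \<gamma> ` {0..l} \<subseteq> K)"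

definition geodesic_segment :: "cp1 \<Rightarrow> cp1 \<Rightarrow> cp1 set \<Rightarrow> bool" where
  "geodesic_segment x y K \<longleftrightarrow>
     x \<noteq> y \<and> (\<exists>\<gamma> l. minimal_geodesic \<gamma> l \<and> \<gamma> 0 = x \<and> \<gamma> l = y \<and> K = \<gamma> ` {0..l})"

text \<open>The interior of a convex set: a geodesic segment loses its two endpoints; otherwise the
  topological interior is meant.\<close>

definition convex_interior :: "cp1 set \<Rightarrow> cp1 set" where
  "convex_interior K =
     (if \<exists>x y. geodesic_segment x y K then K - {x. \<exists>y. geodesic_segment x y K} else interior K)"

section \<open>Sections of the line bundle and their Chern connection\<close>

text \<open>Sections of \<open>O(n)\<close>, as homogeneous polynomials of degree \<open>n\<close> in \<open>Z\<^sub>0, Z\<^sub>1\<close>.\<close>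

definition hol_sections :: "nat \<Rightarrow> (complex \<times> complex \<Rightarrow> complex) set" where
  "hol_sections n = {s. \<exists>a :: nat \<Rightarrow> complex.
     s = (\<lambda>Z. \<Sum>k\<le>n. a k * fst Z ^ k * snd Z ^ (n - k))}"

definition zeroes :: "(complex \<times> complex \<Rightarrow> complex) \<Rightarrow> cp1 set" where
  "zeroes s = {proj Z |Z. Z \<noteq> 0 \<and> s Z = 0}"

text \<open>The squared pointwise norm, at \<open>[Z]\<close>, of a vector in the fibre of \<open>O(n)\<close>, the vector being
  given by its value \<open>w\<close> on the representative \<open>Z\<close>.\<close>

definition fibre_normsq :: "nat \<Rightarrow> complex \<Rightarrow> complex \<times> complex \<Rightarrow> real" where
  "fibre_normsq n w Z = (cmod w)\<^sup>2 / ((cmod (fst Z))\<^sup>2 + (cmod (snd Z))\<^sup>2) ^ n"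

text \<open>For \<open>s\<close> homogeneous of degree \<open>n\<close> this does not depend on the representative.\<close>

definition section_normsq :: "nat \<Rightarrow> (complex \<times> complex \<Rightarrow> complex) \<Rightarrow> cp1 \<Rightarrow> real" where
  "section_normsq n s x = fibre_normsq n (s (rep_cp1 x)) (rep_cp1 x)"

lemma section_normsq_proj:
  assumes "s \<in> hol_sections n" "Z \<noteq> 0"
  shows "section_normsq n s (proj Z) = fibre_normsq n (s Z) Z"
proof -
  obtain a where a: "s = (\<lambda>Z. \<Sum>k\<le>n. a k * fst Z ^ k * snd Z ^ (n - k))"
    using assms(1) unfolding hol_sections_def by blast
  have "proj_rel Z (rep_cp1 (proj Z))"
    using Quotient_rep_abs[OF Quotient_cp1 proj_rel_refl[OF assms(2)]] by (rule proj_rel_sym)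
  then obtain c where c: "c \<noteq> 0" "fst (rep_cp1 (proj Z)) = c * fst Z" "snd (rep_cp1 (proj Z)) = c * snd Z"
    unfolding proj_rel_def by blast
  have "a k * (c * fst Z) ^ k * (c * snd Z) ^ (n - k) = c ^ n * (a k * fst Z ^ k * snd Z ^ (n - k))"
    if "k \<le> n" for k
  proof -
    have "c ^ n = c ^ k * c ^ (n - k)" using that by (simp flip: power_add)
    then show ?thesis by (simp add: power_mult_distrib)
  qed
  then have s: "s (rep_cp1 (proj Z)) = c ^ n * s Z"
    unfolding a c sum_distrib_left by (intro sum.cong) auto
  have "(cmod (c * fst Z))\<^sup>2 + (cmod (c * snd Z))\<^sup>2 = (cmod c)\<^sup>2 * ((cmod (fst Z))\<^sup>2 + (cmod (snd Z))\<^sup>2)"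
    by (simp add: norm_mult power_mult_distrib algebra_simps)
  then show ?thesis
    unfolding section_normsq_def fibre_normsq_def s c using c(1)
    by (simp add: norm_mult norm_power power_mult_distrib flip: power_mult)
       (simp add: mult.commute)
qed

text \<open>The two affine charts, given as lifts \<open>\<sigma>\<close> to homogeneous coordinates: the chart itself is
  \<open>z \<mapsto> proj (\<sigma> z)\<close>.\<close>

definition affine_lifts :: "(complex \<Rightarrow> complex \<times> complex) set" where
  "affine_lifts = {\<lambda>z. (1, z), \<lambda>z. (z, 1)}"

text \<open>The Wirtinger derivative \<open>\<partial>/\<partial>z\<close>.\<close>

definition wirtinger :: "(complex \<Rightarrow> complex) \<Rightarrow> complex \<Rightarrow> complex" where
  "wirtinger f z =
     (frechet_derivative f (at z) 1 - \<i> * frechet_derivative f (at z) \<i>) / 2"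

text \<open>Over the chart with lift \<open>\<sigma>\<close>, take the local frame \<open>e\<close> of \<open>O(n)\<close> whose value on \<open>\<sigma> z\<close> is
  \<open>1\<close> (that is, \<open>e = Z\<^sub>0\<^sup>n\<close> resp. \<open>e = Z\<^sub>1\<^sup>n\<close>).  Then \<open>s = f e\<close> with \<open>f = s \<circ> \<sigma>\<close>, and \<open>\<phi>\<close> is given by
  \<open>|e|\<^sup>2 = exp (- \<phi>)\<close>.\<close>

definition frame_potential :: "nat \<Rightarrow> (complex \<Rightarrow> complex \<times> complex) \<Rightarrow> complex \<Rightarrow> real" where
  "frame_potential n \<sigma> z = - ln (fibre_normsq n 1 (\<sigma> z))"

text \<open>The coefficient \<open>\<partial>f - f \<partial>\<phi>\<close> of \<open>\<nabla>s\<close> with respect to \<open>dz \<otimes> e\<close>.\<close>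

definition chern_derivative ::
  "nat \<Rightarrow> (complex \<times> complex \<Rightarrow> complex) \<Rightarrow> (complex \<Rightarrow> complex \<times> complex) \<Rightarrow> complex \<Rightarrow> complex" where
  "chern_derivative n s \<sigma> z =
     wirtinger (\<lambda>w. s (\<sigma> w)) z
       - s (\<sigma> z) * wirtinger (\<lambda>w. complex_of_real (frame_potential n \<sigma> w)) z"

definition critical_points :: "nat \<Rightarrow> (complex \<times> complex \<Rightarrow> complex) \<Rightarrow> cp1 set" where
  "critical_points n s =
     {x. \<forall>\<sigma>\<in>affine_lifts. \<forall>z. proj (\<sigma> z) = x \<longrightarrow> chern_derivative n s \<sigma> z = 0}"

section \<open>Critical points of real functions on the projective line\<close>

definition real_critical_point :: "(cp1 \<Rightarrow> real) \<Rightarrow> cp1 \<Rightarrow> bool" where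
  "real_critical_point g x \<longleftrightarrow>
     (\<forall>\<sigma>\<in>affine_lifts. \<forall>z. proj (\<sigma> z) = x \<longrightarrow>
        ((\<lambda>w. g (proj (\<sigma> w))) has_derivative (\<lambda>_. 0)) (at z))"

definition coord_dir :: "2 \<Rightarrow> complex" where
  "coord_dir i = (if i = 1 then 1 else \<i>)"

text \<open>The real Hessian matrix in the coordinates \<open>Re z, Im z\<close>.\<close>

definition hessian :: "(complex \<Rightarrow> real) \<Rightarrow> complex \<Rightarrow> real^2^2" where
  "hessian u z = (\<chi> i j.
     frechet_derivative (\<lambda>w. frechet_derivative u (at w) (coord_dir j)) (at z) (coord_dir i))"

text \<open>The number of negative eigenvalues of a symmetric matrix, counted with multiplicity.\<close>

definition num_neg_eigenvalues :: "real^2^2 \<Rightarrow> nat" where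
  "num_neg_eigenvalues A =
     (\<Sum>\<mu> | \<mu> < 0 \<and> (\<exists>v. v \<noteq> 0 \<and> A *v v = \<mu> *\<^sub>R v). dim {v. A *v v = \<mu> *\<^sub>R v})"

text \<open>At a critical point, neither the invertibility of the Hessian nor its number of negative
  eigenvalues depends on the chart; the next two notions are only used there.\<close>

definition nondegenerate_at :: "(cp1 \<Rightarrow> real) \<Rightarrow> cp1 \<Rightarrow> bool" where
  "nondegenerate_at g x \<longleftrightarrow>
     (\<forall>\<sigma>\<in>affine_lifts. \<forall>z. proj (\<sigma> z) = x \<longrightarrow> invertible (hessian (\<lambda>w. g (proj (\<sigma> w))) z))"

definition has_hessian_index :: "(cp1 \<Rightarrow> real) \<Rightarrow> cp1 \<Rightarrow> nat \<Rightarrow> bool" where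
  "has_hessian_index g x k \<longleftrightarrow>
     (\<forall>\<sigma>\<in>affine_lifts. \<forall>z. proj (\<sigma> z) = x \<longrightarrow>
        num_neg_eigenvalues (hessian (\<lambda>w. g (proj (\<sigma> w))) z) = k)"

definition log_normsq :: "nat \<Rightarrow> (complex \<times> complex \<Rightarrow> complex) \<Rightarrow> cp1 \<Rightarrow> real" where
  "log_normsq n s x = ln (section_normsq n s x)"

text \<open>The index of a section is only defined away from its zeroes.\<close>

definition has_index :: "nat \<Rightarrow> (complex \<times> complex \<Rightarrow> complex) \<Rightarrow> cp1 \<Rightarrow> nat \<Rightarrow> bool" where
  "has_index n s x k \<longleftrightarrow> x \<notin> zeroes s \<and> has_hessian_index (log_normsq n s) x k"

end

theory Submission
  imports Defs "HOL-Computational_Algebra.Fundamental_Theorem_Algebra"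
begin

text \<open>
The Hopf map identifies the projective line with the unit sphere of \<open>\<complex> \<times> \<real>\<close>. In this model the
cosine of twice the Fubini--Study distance is the inner product, opposite points are negatives of each
other, and geodesics are great circle arcs. A section is a product of \<open>n\<close> linear forms; if
\<open>v\<^sub>1, \<dots>, v\<^sub>n\<close> are the unit vectors of its zeroes, then \<open>|s|\<^sup>2\<close> is a positive constant times
\<open>\<Prod>i. (1 - x \<bullet> v\<^sub>i)\<close>. Its logarithmic gradient at \<open>x\<close> is minus the tangential part of
\<open>w(x) = \<Sum>i. v\<^sub>i / (1 - x \<bullet> v\<^sub>i)\<close>, so that away from the zeroes \<open>x\<close> is critical exactly when
\<open>w(x) = \<mu> x\<close> for some real \<open>\<mu>\<close> (\<open>critical_iff_balance\<close>).

\<^bold>\<open>Location.\<close> All coefficients of \<open>w(x)\<close> are positive, the hull \<open>P\<close> is the trace on the sphere of the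
convex cone generated by the \<open>v\<^sub>i\<close> (\<open>geodesically_convex_hull_eq_cone\<close>), and \<open>w(x) \<noteq> 0\<close> because the
zeroes lie in an open hemisphere. Hence \<open>x\<close> lies in \<open>P\<close> if \<open>\<mu> > 0\<close> and in \<open>P\<^sub>\<infinity>\<close> if \<open>\<mu> < 0\<close>. A vector
which is a combination of the \<open>v\<^sub>i\<close> with strictly positive coefficients is in the relative interior of
the cone, which gives the statements about interiors (\<open>convex_interior_hull\<close>).

\<^bold>\<open>The maximum.\<close> Reflecting a point of the hemisphere in the plane that bounds the hemisphere increases
every factor \<open>1 - x \<bullet> v\<^sub>i\<close>. So the global maximum of \<open>|s|\<^sup>2\<close> is not in the hemisphere, and being critical
it is in \<open>P\<^sub>\<infinity>\<close>. The Hessian at a maximum is negative semidefinite; if it is invertible, both its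
eigenvalues are negative.

\<^bold>\<open>Critical points in \<open>P\<close>.\<close> At a multiple zero \<open>|s|\<^sup>2\<close> is a product of two functions with a double zero,
so its Hessian vanishes; if all critical points of \<open>|s|\<^sup>2\<close> are non-degenerate, the zeroes are therefore
simple, and at a simple zero \<open>\<nabla>s \<noteq> 0\<close>. It remains to find a point with \<open>w(x) = \<mu> x\<close> and \<open>\<mu> > 0\<close>
that is not a zero. Consider the map \<open>F(x) = w(x) / |w(x)|\<close> of the sphere to itself, which extends
continuously to the zeroes and fixes them. As \<open>x \<mapsto> \<Sum>i. ln (1 - x \<bullet> v\<^sub>i)\<close> is concave on the ball, and
\<open>F(x)\<close> minimizes on the sphere the linear upper bound of this function at \<open>x\<close>, the map \<open>F\<close> strictly
decreases \<open>|s|\<^sup>2\<close> at all points that it does not fix. If the zeroes were the only fixed points, then the orbit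
of every point would tend to a zero, and the basins of attraction would cut the connected sphere into
at least two disjoint nonempty open pieces (\<open>exists_balanced_point\<close>).
\<close>

section \<open>The round sphere model of the projective line\<close>

text \<open>The Hopf fibration, extended to all nonzero vectors by homogeneity. Its value is the Bloch vector of
  the line through \<open>Z\<close>, a unit vector.\<close>

definition hopf :: "complex \<times> complex \<Rightarrow> complex \<times> real" where
  "hopf Z = (1 / (norm Z)\<^sup>2) *\<^sub>R
     (2 * fst Z * cnj (snd Z), (cmod (fst Z))\<^sup>2 - (cmod (snd Z))\<^sup>2)"

definition bloch :: "cp1 \<Rightarrow> complex \<times> real" where
  "bloch x = hopf (rep_cp1 x)"

lemma inner_hopf:
  assumes "Z \<noteq> 0" "W \<noteq> 0"
  shows "hopf Z \<bullet> hopf W = 1 - 2 * (cmod (hdet Z W))\<^sup>2 / ((norm Z)\<^sup>2 * (norm W)\<^sup>2)"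
proof -
  have pos: "(norm Z)\<^sup>2 \<noteq> 0" "(norm W)\<^sup>2 \<noteq> 0" using assms by auto
  have "hopf Z \<bullet> hopf W * ((norm Z)\<^sup>2 * (norm W)\<^sup>2) =
     (2 * fst Z * cnj (snd Z)) \<bullet> (2 * fst W * cnj (snd W)) +
     ((cmod (fst Z))\<^sup>2 - (cmod (snd Z))\<^sup>2) * ((cmod (fst W))\<^sup>2 - (cmod (snd W))\<^sup>2)"
    unfolding hopf_def inner_scaleR_left inner_scaleR_right inner_Pair inner_real_def
    using pos by simp
  also have "\<dots> = (norm Z)\<^sup>2 * (norm W)\<^sup>2 - 2 * (cmod (hdet Z W))\<^sup>2"
    unfolding norm_pair_sq hdet_def cmod_power2 inner_complex_def
    by simp (simp add: power2_eq_square algebra_simps)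
  finally show ?thesis using pos by (simp add: field_simps)
qed

lemma hopf_cong:
  assumes "proj_rel Z W"
  shows "hopf Z = hopf W"
proof -
  obtain c where c: "Z \<noteq> 0" "c \<noteq> 0" "fst W = c * fst Z" "snd W = c * snd Z"
    using assms unfolding proj_rel_def by blast
  have n: "(norm W)\<^sup>2 = (cmod c)\<^sup>2 * (norm Z)\<^sup>2"
    unfolding norm_pair_sq c by (simp add: norm_mult power_mult_distrib algebra_simps)
  have "2 * fst W * cnj (snd W) = of_real ((cmod c)\<^sup>2) * (2 * fst Z * cnj (snd Z))"
    unfolding c complex_norm_square by simp
  moreover have "(cmod (fst W))\<^sup>2 - (cmod (snd W))\<^sup>2
      = (cmod c)\<^sup>2 * ((cmod (fst Z))\<^sup>2 - (cmod (snd Z))\<^sup>2)"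
    unfolding c by (simp add: norm_mult power_mult_distrib algebra_simps)
  ultimately have "(2 * fst W * cnj (snd W), (cmod (fst W))\<^sup>2 - (cmod (snd W))\<^sup>2) =
      (cmod c)\<^sup>2 *\<^sub>R (2 * fst Z * cnj (snd Z), (cmod (fst Z))\<^sup>2 - (cmod (snd Z))\<^sup>2)"
    by (simp add: scaleR_conv_of_real)
  then show ?thesis unfolding hopf_def n using c by simp
qed

lemma bloch_proj:
  assumes "Z \<noteq> 0"
  shows "bloch (proj Z) = hopf Z"
  unfolding bloch_def
  by (rule hopf_cong[OF Quotient_rep_abs[OF Quotient_cp1 proj_rel_refl[OF assms]]])

text \<open>The Hopf map doubles angles: the Fubini--Study sphere has radius \<open>1/2\<close>, the model has radius \<open>1\<close>.\<close>

lemma inner_bloch: "bloch x \<bullet> bloch y = cos (2 * dist x y)"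
proof -
  obtain Z where Z: "Z \<noteq> 0" "x = proj Z" by (rule cp1_cases)
  obtain W where W: "W \<noteq> 0" "y = proj W" by (rule cp1_cases)
  have "cos (2 * dist x y) = 1 - 2 * (sin (fs_angle Z W))\<^sup>2"
    unfolding cos_double_sin using Z W by (simp add: dist_proj_aux)
  also have "\<dots> = bloch x \<bullet> bloch y"
    unfolding cos_sin_fs_angle(2)[OF Z(1) W(1)]
    using inner_hopf[OF Z(1) W(1)] Z W by (simp add: bloch_proj power_divide power_mult_distrib)
  finally show ?thesis by simp
qed

lemma norm_bloch [simp]: "norm (bloch x) = 1"
  using inner_bloch[of x x] by (simp add: norm_eq_1)

lemma bloch_unit: "bloch x \<bullet> bloch x = 1"
  using inner_bloch[of x x] by simp

lemma dist_cp1_le: "dist x y \<le> pi / 2" for x y :: cp1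
proof -
  obtain Z where Z: "Z \<noteq> 0" "x = proj Z" by (rule cp1_cases)
  obtain W where W: "W \<noteq> 0" "y = proj W" by (rule cp1_cases)
  show ?thesis using cos_sin_fs_angle(4)[OF Z(1) W(1)] Z W by (simp add: dist_proj_aux)
qed

lemma dist_eq_arccos: "2 * dist x y = arccos (bloch x \<bullet> bloch y)"
  unfolding inner_bloch by (rule arccos_cos[symmetric]) (use dist_cp1_le[of x y] in auto)

lemma bloch_eq_iff: "bloch x = bloch y \<longleftrightarrow> x = y"
proof
  assume "bloch x = bloch y"
  then have "2 * dist x y = arccos 1" unfolding dist_eq_arccos by (simp add: bloch_unit)
  then show "x = y" by simp
qed simp

lemma bloch_surj:
  assumes "norm v = 1"
  obtains x where "bloch x = v"
proof -
  obtain \<zeta> t where v: "v = (\<zeta>, t)" by (cases v)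
  have 1: "(cmod \<zeta>)\<^sup>2 + t\<^sup>2 = 1"
    using assms unfolding v norm_Pair by simp
  show ?thesis
  proof (cases "t = -1")
    case True
    then have "\<zeta> = 0" using 1 by simp
    moreover have "bloch (proj (0, 1)) = (0, -1)"
      by (subst bloch_proj) (auto simp: hopf_def norm_Pair zero_prod_def)
    ultimately show ?thesis using that v True by blast
  next
    case False
    have "t\<^sup>2 \<le> 1" using 1 zero_le_power2[of "cmod \<zeta>"] by linarith
    then have t: "1 + t > 0" using False by (simp add: abs_square_le_1 abs_le_iff)
    \<comment> \<open>The homogeneous coordinates come from stereographic projection from \<open>(0, -1)\<close>.\<close>
    let ?Z = "(complex_of_real (1 + t), cnj \<zeta>)"
    have t0: "complex_of_real (1 + t) \<noteq> 0" using t by (simp only: of_real_eq_0_iff)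
    then have nz: "?Z \<noteq> 0" unfolding zero_prod_def prod.inject by blast
    have c1: "(cmod (complex_of_real (1 + t)))\<^sup>2 = (1 + t)\<^sup>2" using t by (simp add: norm_of_real del: of_real_add)
    have n: "(norm ?Z)\<^sup>2 = 2 * (1 + t)"
      unfolding norm_pair_sq fst_conv snd_conv c1 using 1 by (simp add: power2_eq_square algebra_simps)
    have "((1 + t)\<^sup>2 - (cmod \<zeta>)\<^sup>2) = t * (2 * (1 + t))"
      using 1 by (simp add: power2_eq_square algebra_simps)
    moreover have "2 * complex_of_real (1 + t) * \<zeta> = (2 * (1 + t)) *\<^sub>R \<zeta>"
      by (simp add: scaleR_conv_of_real)
    ultimately have "hopf ?Z = v"
      unfolding hopf_def n v fst_conv snd_conv complex_cnj_cnj c1 using t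
      by (simp del: of_real_add)
    then show ?thesis using that bloch_proj[OF nz] by metis
  qed
qed

lemma unit_inner_minus_one:
  fixes u v :: "'a::real_inner"
  assumes "norm u = 1" "norm v = 1" "u \<bullet> v = -1"
  shows "v = - u"
proof -
  have "(u + v) \<bullet> (u + v) = 0"
    using assms by (simp add: inner_add_left inner_add_right inner_commute norm_eq_1)
  then show ?thesis by (simp add: eq_neg_iff_add_eq_0 add.commute)
qed

lemma unit_inner_one:
  fixes u v :: "'a::real_inner"
  assumes "norm u = 1" "norm v = 1" "u \<bullet> v = 1"
  shows "v = u"
  using unit_inner_minus_one[of "-u" v] assms by simp

lemma bloch_opposite: "bloch (opposite x) = - bloch x"
proof -
  obtain Z where Z: "Z \<noteq> 0" "x = proj Z" by (rule cp1_cases)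
  have "dist x (opposite x) = pi / 2"
    using theI'[OF opposite_proj(2)[OF Z(1)]] Z unfolding opposite_def by simp
  then have "2 * dist x (opposite x) = pi" by simp
  then have "bloch x \<bullet> bloch (opposite x) = -1"
    unfolding inner_bloch by (simp only: cos_pi)
  then show ?thesis by (rule unit_inner_minus_one[OF norm_bloch norm_bloch])
qed

lemma opposite_opposite [simp]: "opposite (opposite x) = x"
  by (simp add: bloch_opposite flip: bloch_eq_iff)

lemma dist_opposite [simp]: "dist (opposite x) (opposite y) = dist x y"
  using dist_eq_arccos[of x y] dist_eq_arccos[of "opposite x" "opposite y"]
  by (simp add: bloch_opposite)

lemma continuous_on_bloch: "continuous_on S bloch"
proof (rule continuous_on_subset[of UNIV], unfold continuous_on_iff, safe)
  fix x :: cp1 and e :: real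
  assume e: "e > 0"
  have "dist (bloch x') (bloch x) \<le> 2 * dist x' x" for x'
  proof (rule power2_le_imp_le)
    have "(dist (bloch x') (bloch x))\<^sup>2 = 2 - 2 * cos (2 * dist x' x)"
      unfolding dist_norm power2_norm_eq_inner
      by (simp add: inner_diff_left inner_diff_right inner_bloch dist_commute)
    also have "\<dots> = (2 * sin (dist x' x))\<^sup>2"
      unfolding cos_double_sin by simp
    also have "\<dots> \<le> (2 * dist x' x)\<^sup>2"
      using abs_sin_x_le_abs_x[of "dist x' x"] by (simp only: abs_le_square_iff[symmetric] abs_mult)
    finally show "(dist (bloch x') (bloch x))\<^sup>2 \<le> (2 * dist x' x)\<^sup>2" .
  qed simp
  then have "\<forall>x'. dist x' x < e / 2 \<longrightarrow> dist (bloch x') (bloch x) < e"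
    by (smt (verit) field_sum_of_halves)
  then show "\<exists>d>0. \<forall>x'\<in>UNIV. dist x' x < d \<longrightarrow> dist (bloch x') (bloch x) < e"
    using e half_gt_zero by blast
qed auto

section \<open>Geodesic hulls are traces of convex cones\<close>

lemma open_hemisphere_iff: "x \<in> open_hemisphere c \<longleftrightarrow> bloch x \<bullet> bloch c > 0"
proof -
  have "0 \<le> 2 * dist c x" "2 * dist c x \<le> pi" using dist_cp1_le[of c x] by auto
  then have "cos (2 * dist c x) > cos (pi / 2) \<longleftrightarrow> 2 * dist c x < pi / 2"
    by (intro cos_mono_less_eq) auto
  then show ?thesis
    unfolding open_hemisphere_def inner_bloch mem_ball cos_pi_half dist_commute[of x c] by auto
qed

lemma sin_double_dist_pos: "0 < t \<Longrightarrow> t < pi / 2 \<Longrightarrow> sin (2 * t) > 0"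
  by (rule sin_gt_zero) auto

text \<open>In a unit-speed minimal geodesic each point realizes equality in the triangle inequality with the
  two endpoints. On the sphere this forces it onto the great circle arc between them: the squared
  norm of the difference of the two sides is a trigonometric expression that vanishes identically.\<close>

lemma bloch_minimal_geodesic:
  assumes "minimal_geodesic \<gamma> l" "t \<in> {0..l}"
  shows "sin (2 * l) *\<^sub>R bloch (\<gamma> t) =
         sin (2 * (l - t)) *\<^sub>R bloch (\<gamma> 0) + sin (2 * t) *\<^sub>R bloch (\<gamma> l)"
proof -
  have d: "dist (\<gamma> 0) (\<gamma> t) = t" "dist (\<gamma> t) (\<gamma> l) = l - t" "dist (\<gamma> 0) (\<gamma> l) = l"
    using assms unfolding minimal_geodesic_def by (auto simp: abs_if)
  define p q where "p = 2 * (l - t)" and "q = 2 * t"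
  have l: "2 * l = p + q" by (simp add: p_def q_def)
  have i: "bloch (\<gamma> 0) \<bullet> bloch (\<gamma> t) = cos q" "bloch (\<gamma> t) \<bullet> bloch (\<gamma> l) = cos p"
     "bloch (\<gamma> 0) \<bullet> bloch (\<gamma> l) = cos (p + q)"
    unfolding inner_bloch d p_def q_def by simp_all
  let ?D = "sin (p + q) *\<^sub>R bloch (\<gamma> t) - (sin p *\<^sub>R bloch (\<gamma> 0) + sin q *\<^sub>R bloch (\<gamma> l))"
  have "?D \<bullet> ?D = (sin (p + q))\<^sup>2 + (sin p)\<^sup>2 + (sin q)\<^sup>2 - 2 * sin (p + q) * sin p * cos q
     - 2 * sin (p + q) * sin q * cos p + 2 * sin p * sin q * cos (p + q)"
    by (simp add: inner_diff_left inner_diff_right inner_add_left inner_add_right bloch_unit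
        inner_commute[of "bloch (\<gamma> l)"] inner_commute[of "bloch (\<gamma> t)" "bloch (\<gamma> 0)"] i
        power2_eq_square algebra_simps)
  also have "\<dots> = 0"
    unfolding sin_add cos_add
    using sin_cos_squared_add[of p] sin_cos_squared_add[of q] by algebra
  finally show ?thesis unfolding l p_def[symmetric] q_def[symmetric] by simp
qed

text \<open>Two distinct points that are not antipodal are joined by the arc
  \<open>t \<mapsto> cos (2t) X + sin (2t) E\<close>, where \<open>E\<close> is the unit vector obtained from \<open>Y\<close> by
  Gram--Schmidt. The last property, needed to show that convex sets are traces of cones, says that the
  arc contains every unit vector in the cone spanned by its endpoints.\<close>

lemma obtain_minimal_geodesic:
  assumes "x \<noteq> y" "dist x y < pi / 2"
  obtains \<gamma> where "minimal_geodesic \<gamma> (dist x y)" "\<gamma> 0 = x" "\<gamma> (dist x y) = y"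
    "{m. \<exists>p\<ge>0. \<exists>q\<ge>0. bloch m = p *\<^sub>R bloch x + q *\<^sub>R bloch y} \<subseteq> \<gamma> ` {0..dist x y}"
proof -
  define l where "l = dist x y"
  define E where "E = (1 / sin (2 * l)) *\<^sub>R (bloch y - cos (2 * l) *\<^sub>R bloch x)"
  have l: "0 < l" "l < pi / 2" using assms by (auto simp: l_def)
  then have s: "sin (2 * l) > 0" by (rule sin_double_dist_pos)
  have xy: "bloch x \<bullet> bloch y = cos (2 * l)" "bloch y \<bullet> bloch x = cos (2 * l)"
    unfolding inner_bloch l_def by (simp_all add: dist_commute)
  have XE: "bloch x \<bullet> E = 0" "E \<bullet> bloch x = 0"
    unfolding E_def by (simp_all add: inner_diff_right inner_diff_left xy bloch_unit)
  have "(bloch y - cos (2 * l) *\<^sub>R bloch x) \<bullet> (bloch y - cos (2 * l) *\<^sub>R bloch x) = (sin (2 * l))\<^sup>2"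
    unfolding sin_squared_eq
    by (simp add: inner_diff_right inner_diff_left xy bloch_unit power2_eq_square)
  then have EE: "E \<bullet> E = 1" unfolding E_def using s by (simp add: power2_eq_square)
  have Y: "bloch y = cos (2 * l) *\<^sub>R bloch x + sin (2 * l) *\<^sub>R E" using s unfolding E_def by simp
  have inn: "(a *\<^sub>R bloch x + b *\<^sub>R E) \<bullet> (c *\<^sub>R bloch x + d *\<^sub>R E) = a * c + b * d" for a b c d
    by (simp add: inner_add_left inner_add_right XE EE bloch_unit)
  define \<gamma> where "\<gamma> t = (SOME z. bloch z = cos (2 * t) *\<^sub>R bloch x + sin (2 * t) *\<^sub>R E)" for t
  have G: "bloch (\<gamma> t) = cos (2 * t) *\<^sub>R bloch x + sin (2 * t) *\<^sub>R E" for t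
  proof -
    have "norm (cos (2 * t) *\<^sub>R bloch x + sin (2 * t) *\<^sub>R E) = 1"
      unfolding norm_eq_1 inn using sin_cos_squared_add3 by blast
    then obtain z where "bloch z = cos (2 * t) *\<^sub>R bloch x + sin (2 * t) *\<^sub>R E"
      by (rule bloch_surj)
    then show ?thesis unfolding \<gamma>_def by (rule someI)
  qed
  have "dist (\<gamma> a) (\<gamma> b) = \<bar>a - b\<bar>" if "a \<in> {0..l}" "b \<in> {0..l}" for a b
  proof -
    have "bloch (\<gamma> a) \<bullet> bloch (\<gamma> b) = cos (2 * a - 2 * b)"
      unfolding G inn cos_diff by simp
    also have "\<dots> = cos (2 * \<bar>a - b\<bar>)"
    proof -
      have "\<bar>2 * a - 2 * b\<bar> = 2 * \<bar>a - b\<bar>" by (simp add: abs_if)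
      then show ?thesis using cos_abs_real[of "2 * a - 2 * b"] by metis
    qed
    finally have "2 * dist (\<gamma> a) (\<gamma> b) = arccos (cos (2 * \<bar>a - b\<bar>))"
      unfolding dist_eq_arccos by simp
    also have "\<dots> = 2 * \<bar>a - b\<bar>"
      using that l by (intro arccos_cos) (auto simp: abs_if)
    finally show ?thesis by simp
  qed
  then have "minimal_geodesic \<gamma> (dist x y)"
    unfolding minimal_geodesic_def l_def[symmetric] using l by simp
  moreover have "\<gamma> 0 = x" "\<gamma> (dist x y) = y"
    unfolding l_def[symmetric] by (simp_all add: G flip: bloch_eq_iff) (simp add: Y)
  moreover have "m \<in> \<gamma> ` {0..dist x y}"
    if pq: "0 \<le> p" "0 \<le> q" and m: "bloch m = p *\<^sub>R bloch x + q *\<^sub>R bloch y" for m p q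
  proof -
    define A B where "A = p + q * cos (2 * l)" and "B = q * sin (2 * l)"
    have m': "bloch m = A *\<^sub>R bloch x + B *\<^sub>R E"
      unfolding m Y A_def B_def by (simp add: algebra_simps)
    have AB: "A\<^sup>2 + B\<^sup>2 = 1"
      using bloch_unit[of m] unfolding m' inn by (simp add: power2_eq_square)
    have B: "B \<ge> 0" using pq s unfolding B_def by simp
    have A: "-1 \<le> A" "A \<le> 1"
      using AB zero_le_power2[of B] abs_square_le_1[of A] by linarith+
    define \<theta> where "\<theta> = arccos A"
    have th: "0 \<le> \<theta>" "\<theta> \<le> pi" "cos \<theta> = A"
      unfolding \<theta>_def using A by (auto intro: arccos_lbound arccos_ubound)
    have "sin \<theta> = sqrt (1 - A\<^sup>2)" unfolding \<theta>_def using A by (rule sin_arccos)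
    also have "1 - A\<^sup>2 = B\<^sup>2" using AB by simp
    finally have sB: "sin \<theta> = B" using B by simp
    \<comment> \<open>The sign of this sine excludes \<open>\<theta> > 2 l\<close>, so that \<open>m\<close> is not beyond the endpoint \<open>y\<close>.\<close>
    have "sin (\<theta> - 2 * l) = - (p * sin (2 * l))"
      unfolding sin_diff th sB A_def B_def by (simp add: algebra_simps)
    also have "\<dots> \<le> 0" using pq s by simp
    finally have "\<not> (\<theta> - 2 * l > 0)"
      using sin_gt_zero[of "\<theta> - 2 * l"] th l by auto
    then have "\<theta> / 2 \<in> {0..l}" using th by simp
    moreover have "\<gamma> (\<theta> / 2) = m"
      unfolding bloch_eq_iff[symmetric] G m' using th sB by simp
    ultimately show ?thesis unfolding l_def[symmetric] by blast
  qed
  ultimately show ?thesis using that by blast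
qed

lemma convex_cone_hull_halfspace:
  fixes c :: "'a::euclidean_space"
  assumes "\<And>v. v \<in> V \<Longrightarrow> v \<bullet> c > 0" "y \<in> convex_cone hull V" "y \<noteq> 0"
  shows "y \<bullet> c > 0"
proof -
  have "convex_cone {y. y = 0 \<or> y \<bullet> c > 0}"
    unfolding convex_cone_iff mem_Collect_eq
  proof (intro conjI ballI allI impI)
    fix x y assume "x \<in> {y. y = 0 \<or> y \<bullet> c > 0}" "y \<in> {y. y = 0 \<or> y \<bullet> c > 0}"
    then show "x + y = 0 \<or> 0 < (x + y) \<bullet> c" by (auto simp: inner_add_left)
  next
    fix x and k :: real assume "x \<in> {y. y = 0 \<or> y \<bullet> c > 0}" "0 \<le> k"
    then show "k *\<^sub>R x = 0 \<or> 0 < (k *\<^sub>R x) \<bullet> c" by (cases "k = 0") auto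
  qed simp
  then have "convex_cone hull V \<subseteq> {y. y = 0 \<or> y \<bullet> c > 0}"
    using assms(1) by (intro hull_minimal) auto
  then show ?thesis using assms by auto
qed

lemma bloch_nonzero [simp]: "bloch x \<noteq> 0"
proof
  assume "bloch x = 0"
  then show False using norm_bloch[of x] by simp
qed

lemma dist_lt_in_hemisphere:
  assumes "bloch x \<bullet> w > 0" "bloch y \<bullet> w > 0"
  shows "dist x y < pi / 2"
proof (rule ccontr)
  assume "\<not> dist x y < pi / 2"
  then have "2 * dist x y = pi" using dist_cp1_le[of x y] by simp
  then have "bloch x \<bullet> bloch y = -1" unfolding inner_bloch by (simp only: cos_pi)
  then have "bloch y = - bloch x" by (rule unit_inner_minus_one[OF norm_bloch norm_bloch])
  then show False using assms by simp
qed

text \<open>Both inclusions rest on the correspondence between arcs and two-dimensional cones. The trace of a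
  convex cone is geodesically convex, because points of a geodesic are nonnegative combinations of
  its endpoints. Conversely, the rays through the points of a geodesically convex set that lie in the
  open half-space of \<open>w\<close> form a convex cone; the half-space excludes antipodal pairs, whose sum could be
  \<open>0\<close> and which are not joined by a unique arc.\<close>

lemma geodesically_convex_hull_eq_cone:
  assumes "\<And>z. z \<in> Z \<Longrightarrow> bloch z \<bullet> w > 0"
  shows "geodesically_convex hull Z = {x. bloch x \<in> convex_cone hull (bloch ` Z)}" (is "_ = ?R")
proof
  let ?K = "convex_cone hull (bloch ` Z)"
  have K: "convex_cone ?K" by (rule convex_cone_convex_cone_hull)
  have pos: "bloch x \<bullet> w > 0" if "bloch x \<in> ?K" for x
    by (rule convex_cone_hull_halfspace[OF _ that bloch_nonzero]) (use assms in blast)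
  have "geodesically_convex ?R"
    unfolding geodesically_convex_def
  proof (intro allI impI subsetI)
    fix \<gamma> l m
    assume h: "minimal_geodesic \<gamma> l \<and> \<gamma> 0 \<in> ?R \<and> \<gamma> l \<in> ?R" "m \<in> \<gamma> ` {0..l}"
    then obtain t where t: "t \<in> {0..l}" "m = \<gamma> t" by blast
    have l: "dist (\<gamma> 0) (\<gamma> l) = l" "0 \<le> l" using h unfolding minimal_geodesic_def by auto
    have l2: "l < pi / 2"
      using dist_lt_in_hemisphere[of "\<gamma> 0" w "\<gamma> l"] pos h l by auto
    show "m \<in> ?R"
    proof (cases "l = 0")
      case True
      then show ?thesis using t h by auto
    next
      case False
      then have s: "sin (2 * l) > 0" using l l2 by (intro sin_double_dist_pos) auto
      have "0 \<le> sin (2 * (l - t))" "0 \<le> sin (2 * t)"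
        using t l l2 by (auto intro!: sin_ge_zero)
      then have k: "sin (2 * l) *\<^sub>R bloch (\<gamma> t) \<in> ?K"
        using h bloch_minimal_geodesic[of \<gamma> l t] t
        by (auto intro!: convex_cone_add[OF K] convex_cone_scaleR[OF K])
      have "(1 / sin (2 * l)) *\<^sub>R sin (2 * l) *\<^sub>R bloch (\<gamma> t) \<in> ?K"
        by (rule convex_cone_scaleR[OF K _ k]) (use s in simp)
      then show ?thesis using s t by simp
    qed
  qed
  then show "geodesically_convex hull Z \<subseteq> ?R"
    by (intro hull_minimal) (auto intro: hull_inc)
  show "?R \<subseteq> geodesically_convex hull Z"
    unfolding hull_def[of geodesically_convex]
  proof safe
    fix x T
    assume x: "bloch x \<in> ?K" and T: "geodesically_convex T" "Z \<subseteq> T"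
    let ?M = "{y. y = 0 \<or> (\<exists>r z. r > 0 \<and> z \<in> T \<and> bloch z \<bullet> w > 0 \<and> y = r *\<^sub>R bloch z)}"
    have add: "y + y' \<in> ?M" if y: "y \<in> ?M" and y': "y' \<in> ?M" for y y'
    proof (cases "y = 0 \<or> y' = 0")
      case True
      then have "y + y' = y \<or> y + y' = y'" by auto
      then show ?thesis using y y' by (elim disjE) (simp_all only:)
    next
      case False
      then obtain r z r' z' where z: "r > 0" "z \<in> T" "bloch z \<bullet> w > 0" "y = r *\<^sub>R bloch z"
        "r' > 0" "z' \<in> T" "bloch z' \<bullet> w > 0" "y' = r' *\<^sub>R bloch z'"
        using y y' by auto
      show ?thesis
      proof (cases "z = z'")
        case True
        then have "y + y' = (r + r') *\<^sub>R bloch z" using z by (simp add: scaleR_add_left)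
        then show ?thesis using z by (auto intro!: exI[of _ "r + r'"] exI[of _ z])
      next
        case False
        have d: "dist z z' < pi / 2" using z by (intro dist_lt_in_hemisphere[of z w z'])
        obtain \<gamma> where g: "minimal_geodesic \<gamma> (dist z z')" "\<gamma> 0 = z" "\<gamma> (dist z z') = z'"
          "{m. \<exists>p\<ge>0. \<exists>q\<ge>0. bloch m = p *\<^sub>R bloch z + q *\<^sub>R bloch z'} \<subseteq> \<gamma> ` {0..dist z z'}"
          by (rule obtain_minimal_geodesic[OF False d])
        have yw: "(y + y') \<bullet> w > 0" using z by (simp add: inner_add_left add_pos_pos)
        then have n: "norm (y + y') > 0" by auto
        have "norm ((1 / norm (y + y')) *\<^sub>R (y + y')) = 1" using n by simp
        then obtain m where m: "bloch m = (1 / norm (y + y')) *\<^sub>R (y + y')" by (rule bloch_surj)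
        have "bloch m = (r / norm (y + y')) *\<^sub>R bloch z + (r' / norm (y + y')) *\<^sub>R bloch z'"
          unfolding m using z by (simp add: scaleR_add_right)
        moreover have "0 \<le> r / norm (y + y')" "0 \<le> r' / norm (y + y')" using z n by simp_all
        ultimately have "m \<in> \<gamma> ` {0..dist z z'}" using g(4) by blast
        moreover have "\<gamma> ` {0..dist z z'} \<subseteq> T"
          using T(1)[unfolded geodesically_convex_def, rule_format, of \<gamma> "dist z z'"] g(1-3) z by simp
        ultimately have "m \<in> T" by (rule subsetD[rotated])
        moreover have "bloch m \<bullet> w > 0" unfolding m using n yw by simp
        moreover have "y + y' = norm (y + y') *\<^sub>R bloch m" unfolding m using n by simp
        ultimately show ?thesis using n
          unfolding mem_Collect_eq by (intro disjI2 exI[of _ "norm (y + y')"] exI[of _ m] conjI)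
      qed
    qed
    have M: "convex_cone ?M"
      unfolding convex_cone_iff
    proof (intro conjI ballI allI impI)
      fix y and k :: real assume "y \<in> ?M" "k \<ge> 0"
      show "k *\<^sub>R y \<in> ?M"
      proof (cases "k = 0 \<or> y = 0")
        case False
        then obtain r z where "r > 0" "z \<in> T" "bloch z \<bullet> w > 0" "y = r *\<^sub>R bloch z"
          using \<open>y \<in> ?M\<close> by auto
        then have "k * r > 0 \<and> z \<in> T \<and> bloch z \<bullet> w > 0 \<and> k *\<^sub>R y = (k * r) *\<^sub>R bloch z"
          using False \<open>k \<ge> 0\<close> by simp
        then show ?thesis by blast
      qed auto
    next
      fix y y' assume "y \<in> ?M" "y' \<in> ?M"
      then show "y + y' \<in> ?M" by (rule add)
    qed simp
    have ZM: "bloch ` Z \<subseteq> ?M"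
    proof
      fix y assume "y \<in> bloch ` Z"
      then obtain z where "z \<in> T" "bloch z \<bullet> w > 0" "y = 1 *\<^sub>R bloch z" using T assms by auto
      then show "y \<in> ?M" using zero_less_one by blast
    qed
    have "?K \<subseteq> ?M" by (rule hull_minimal[where S = convex_cone, OF ZM M])
    then obtain r z where z: "r > 0" "z \<in> T" "bloch x = r *\<^sub>R bloch z" using x by auto
    then have "r = 1" using norm_bloch[of x] by simp
    then show "x \<in> T" using z by (simp add: bloch_eq_iff)
  qed
qed

section \<open>Interiors of geodesic hulls\<close>

lemma opposite_image_iff: "x \<in> opposite ` K \<longleftrightarrow> opposite x \<in> K"
  by (metis image_iff opposite_opposite)

lemma opposite_eq_iff: "opposite x = opposite y \<longleftrightarrow> x = y"
  by (metis opposite_opposite)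

lemma minimal_geodesic_opposite:
  "minimal_geodesic \<gamma> l \<Longrightarrow> minimal_geodesic (opposite \<circ> \<gamma>) l"
  unfolding minimal_geodesic_def by simp

lemma geodesic_segment_opposite_imp:
  "geodesic_segment x y K \<Longrightarrow> geodesic_segment (opposite x) (opposite y) (opposite ` K)"
proof -
  assume "geodesic_segment x y K"
  then obtain \<gamma> l where "x \<noteq> y" "minimal_geodesic \<gamma> l" "\<gamma> 0 = x" "\<gamma> l = y" "K = \<gamma> ` {0..l}"
    unfolding geodesic_segment_def by blast
  then show ?thesis
    unfolding geodesic_segment_def
    by (intro conjI exI[of _ "opposite \<circ> \<gamma>"] exI[of _ l] minimal_geodesic_opposite)
       (auto simp: image_comp opposite_eq_iff)
qed

lemma geodesic_segment_opposite:
  "geodesic_segment x y (opposite ` K) \<longleftrightarrow> geodesic_segment (opposite x) (opposite y) K"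
  using geodesic_segment_opposite_imp[of x y "opposite ` K"]
    geodesic_segment_opposite_imp[of "opposite x" "opposite y" K]
  by (auto simp: image_image)

lemma continuous_on_opposite: "continuous_on S opposite"
  unfolding continuous_on_iff by auto

lemma interior_opposite_subset: "opposite ` interior K \<subseteq> interior (opposite ` K)"
proof (rule interior_maximal)
  show "opposite ` interior K \<subseteq> opposite ` K" using interior_subset by blast
  have "opposite ` interior K = opposite -` interior K"
    by (auto simp: opposite_image_iff)
  then show "open (opposite ` interior K)"
    using continuous_on_opposite[of UNIV] by (simp add: continuous_on_open_vimage)
qed

text \<open>Both clauses of the definition of \<^const>\<open>convex_interior\<close> are invariant under isometries, and
  \<^const>\<open>opposite\<close> is an isometric involution.\<close>

lemma convex_interior_opposite:
  assumes "x \<in> convex_interior K"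
  shows "opposite x \<in> convex_interior (opposite ` K)"
proof (cases "\<exists>x y. geodesic_segment x y K")
  case True
  then have "\<exists>x y. geodesic_segment x y (opposite ` K)"
    using geodesic_segment_opposite_imp by blast
  moreover have "x \<in> K" "\<not> geodesic_segment x y K" for y
    using assms True unfolding convex_interior_def by auto
  then have "\<not> geodesic_segment (opposite x) y (opposite ` K)" for y
    unfolding geodesic_segment_opposite opposite_opposite by blast
  ultimately show ?thesis
    using \<open>x \<in> K\<close> unfolding convex_interior_def by simp
next
  case False
  then have no: "\<not> (\<exists>x y. geodesic_segment x y (opposite ` K))"
    unfolding geodesic_segment_opposite by blast
  have "x \<in> interior K" using assms unfolding convex_interior_def if_not_P[OF False] .
  then show ?thesis
    unfolding convex_interior_def if_not_P[OF no] using interior_opposite_subset[of K] by blast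
qed

lemma common_kernel_line:
  fixes c h :: "complex \<times> real"
  assumes "independent {c, h}" "c \<noteq> h"
  obtains e where "\<And>y. y \<bullet> c = 0 \<Longrightarrow> y \<bullet> h = 0 \<Longrightarrow> \<exists>r. y = r *\<^sub>R e"
proof -
  let ?U = "{y. \<forall>x \<in> span {c, h}. orthogonal x y}"
  have "dim (span {c, h}) = 2" using assms by (simp add: dim_span dim_eq_card_independent)
  moreover have "dim {y \<in> UNIV. \<forall>x \<in> span {c, h}. orthogonal x y} + dim (span {c, h}) = dim (UNIV :: (complex \<times> real) set)"
    by (rule dim_subspace_orthogonal_to_vectors) auto
  moreover have "dim (UNIV :: (complex \<times> real) set) = 3" by (simp add: dim_UNIV)
  ultimately have d: "dim ?U = 1" by simp
  obtain B where B: "B \<subseteq> ?U" "independent B" "?U \<subseteq> span B" "card B = dim ?U"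
    by (rule basis_exists)
  then obtain e where e: "B = {e}" using d by (metis card_1_singletonE)
  show ?thesis
  proof (rule that[of e])
    fix y assume "y \<bullet> c = 0" "y \<bullet> h = 0"
    then have "orthogonal y x" if "x \<in> span {c, h}" for x
      by (intro orthogonal_to_span[OF that]) (auto simp: orthogonal_def)
    then have "y \<in> ?U" by (simp add: orthogonal_commute)
    then have "y \<in> span {e}" using B(3) unfolding e by blast
    then show "\<exists>r. y = r *\<^sub>R e" by (auto simp: span_singleton)
  qed
qed

text \<open>The second hypothesis says that each supporting hyperplane of the cone at \<open>x\<close> contains \<open>V\<close>; this is
  what strictly positive coefficients provide. At a relative boundary point of a cone there would be a
  supporting hyperplane that passes through \<open>0\<close> and avoids the relative interior, but it would contain
  the whole cone.\<close>

lemma relative_interior_convex_cone_hull: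
  fixes V :: "'a::euclidean_space set"
  assumes "x \<in> convex_cone hull V"
    and "\<And>h v. \<lbrakk>\<And>v. v \<in> V \<Longrightarrow> h \<bullet> v \<ge> 0; h \<bullet> x = 0; v \<in> V\<rbrakk> \<Longrightarrow> h \<bullet> v = 0"
  shows "x \<in> rel_interior (convex_cone hull V)"
proof (rule ccontr)
  let ?K = "convex_cone hull V"
  have K: "convex_cone ?K" by (rule convex_cone_convex_cone_hull)
  assume n: "x \<notin> rel_interior ?K"
  obtain a where "a \<noteq> 0" and a: "\<And>y. y \<in> ?K \<Longrightarrow> a \<bullet> x \<le> a \<bullet> y" "\<And>y. y \<in> rel_interior ?K \<Longrightarrow> a \<bullet> x < a \<bullet> y"
    by (rule supporting_hyperplane_rel_boundary[OF convex_convex_cone_hull assms(1) n]) (rule that)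
  have "a \<bullet> x \<le> 0" using a(1)[of 0] convex_cone_contains_0[OF K] by simp
  moreover have "a \<bullet> x \<le> a \<bullet> (2 *\<^sub>R x)" by (intro a(1) convex_cone_scaleR[OF K]) (use assms in auto)
  ultimately have ax: "a \<bullet> x = 0" by simp
  have "a \<bullet> v \<ge> 0" if "v \<in> V" for v using a(1)[of v] that ax by (simp add: hull_inc)
  then have av: "a \<bullet> v = 0" if "v \<in> V" for v using assms(2)[of a v] ax that by blast
  have "?K \<subseteq> {y. a \<bullet> y = 0}"
    by (rule hull_minimal) (use av in \<open>auto simp: convex_cone_iff inner_add_right\<close>)
  moreover obtain y where "y \<in> rel_interior ?K"
    using rel_interior_eq_empty[OF convex_convex_cone_hull[of V]] convex_cone_nonempty[OF K] by blast
  ultimately have "y \<in> rel_interior ?K" "a \<bullet> y = 0" using rel_interior_subset[of ?K] by blast+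
  then show False using a(2)[of y] ax by simp
qed

lemma geodesically_convex_hull: "geodesically_convex (geodesically_convex hull Z)"
proof (rule hull_in)
  fix T assume T: "Ball T geodesically_convex"
  have "\<gamma> ` {0..l} \<subseteq> K" if "minimal_geodesic \<gamma> l \<and> \<gamma> 0 \<in> \<Inter> T \<and> \<gamma> l \<in> \<Inter> T" "K \<in> T" for \<gamma> l K
    using T[rule_format, OF that(2), unfolded geodesically_convex_def, rule_format, of \<gamma> l] that by simp
  then show "geodesically_convex (\<Inter> T)"
    unfolding geodesically_convex_def by (intro allI impI Inter_greatest)
qed

text \<open>If the vectors of \<open>Z\<close> lie in a plane \<open>h\<^sup>\<bottom>\<close>, then their central projections to the affine plane
  \<open>y \<bullet> w = 1\<close> are collinear. The convex hull of the projections is a segment, possibly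
  degenerate, and the arc between the directions of its endpoints is the geodesic hull.\<close>

lemma geodesic_segment_or_spanning:
  assumes "finite Z" "Z \<noteq> {}" and w: "\<And>z. z \<in> Z \<Longrightarrow> bloch z \<bullet> w > 0"
  defines "P \<equiv> geodesically_convex hull Z"
  assumes "\<nexists>p. P = {p}" and ns: "\<nexists>x y. geodesic_segment x y P"
  shows "span (bloch ` Z) = UNIV"
proof (rule ccontr)
  let ?V = "bloch ` Z"
  have P: "P = {x. bloch x \<in> convex_cone hull ?V}"
    unfolding P_def by (rule geodesically_convex_hull_eq_cone[OF w])
  have posK: "y \<bullet> w > 0" if "y \<in> convex_cone hull ?V" "y \<noteq> 0" for y
    using convex_cone_hull_halfspace[of ?V w y] w that by blast
  assume "span ?V \<noteq> UNIV"
  then obtain h where h: "h \<noteq> 0" "\<And>y. y \<in> span ?V \<Longrightarrow> h \<bullet> y = 0"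
    using span_not_UNIV_orthogonal[of ?V] by blast
  obtain z0 where z0: "z0 \<in> Z" using assms by blast
  have w0: "w \<noteq> 0" using w[OF z0] by auto
  have hne: "h \<noteq> w" using w[OF z0] h(2)[of "bloch z0"] z0 by (auto simp: span_base inner_commute)
  have "h \<notin> span {w}"
  proof
    assume "h \<in> span {w}"
    then obtain k where "h = k *\<^sub>R w" by (auto simp: span_singleton)
    then show False using h w[OF z0] h(2)[of "bloch z0"] z0 by (auto simp: span_base inner_commute)
  qed
  then have "independent {h, w}" using w0 hne by (subst independent_insert) auto
  then have "independent {w, h}" by (simp add: insert_commute)
  then obtain e where e: "\<And>y. y \<bullet> w = 0 \<Longrightarrow> y \<bullet> h = 0 \<Longrightarrow> \<exists>r. y = r *\<^sub>R e"
    using common_kernel_line[of w h] hne by blast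
  let ?g = "\<lambda>z. (1 / (bloch z \<bullet> w)) *\<^sub>R bloch z"
  let ?H = "convex hull (?g ` Z)"
  have "collinear (?g ` Z)"
    unfolding collinear_def
  proof (rule exI[of _ e], intro ballI)
    fix x y assume "x \<in> ?g ` Z" "y \<in> ?g ` Z"
    then obtain u v where "u \<in> Z" "v \<in> Z" "x = ?g u" "y = ?g v" by blast
    then show "\<exists>r. x - y = r *\<^sub>R e"
      using w[of u] w[of v] h(2)[of "bloch u"] h(2)[of "bloch v"]
      by (intro e) (auto simp: inner_diff_left inner_diff_right span_base inner_commute[of _ h])
  qed
  then have "collinear ?H" by (simp add: collinear_aff_dim aff_dim_convex_hull)
  moreover have "?H \<noteq> {}" "compact ?H" "convex ?H"
    using assms by (auto intro: finite_imp_compact_convex_hull)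
  ultimately obtain a b where ab: "?H = closed_segment a b"
    using compact_convex_collinear_segment by metis
  have gw: "?g z \<bullet> w = 1" if "z \<in> Z" for z using w[OF that] by simp
  have "?H \<subseteq> {y. w \<bullet> y = 1}"
    by (rule hull_minimal[where S = convex, OF _ convex_hyperplane])
       (use gw in \<open>auto simp: inner_commute[of w]\<close>)
  moreover have abH: "a \<in> ?H" "b \<in> ?H" unfolding ab by auto
  ultimately have abw: "a \<bullet> w = 1" "b \<bullet> w = 1" by (auto simp: inner_commute)
  then have n: "norm a > 0" "norm b > 0" by auto
  have K: "convex_cone (convex_cone hull ?V)" by (rule convex_cone_convex_cone_hull)
  have "?H \<subseteq> convex_cone hull ?V"
  proof (rule hull_minimal)
    show "?g ` Z \<subseteq> convex_cone hull ?V"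
    proof
      fix v assume "v \<in> ?g ` Z"
      then obtain z where z: "z \<in> Z" "v = ?g z" by blast
      then have "bloch z \<in> convex_cone hull ?V" by (blast intro: hull_inc)
      then show "v \<in> convex_cone hull ?V"
        unfolding z using w[OF z(1)] by (intro convex_cone_scaleR[OF K]) auto
    qed
  qed (rule convex_convex_cone_hull)
  then have abK: "a \<in> convex_cone hull ?V" "b \<in> convex_cone hull ?V" using abH by auto
  have "norm ((1 / norm a) *\<^sub>R a) = 1" "norm ((1 / norm b) *\<^sub>R b) = 1" using n by auto
  then obtain x y where x: "bloch x = (1 / norm a) *\<^sub>R a" and y: "bloch y = (1 / norm b) *\<^sub>R b"
    by (metis bloch_surj)
  have xyP: "x \<in> P" "y \<in> P"
    unfolding P mem_Collect_eq x y using abK by (simp_all add: convex_cone_scaleR[OF K])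
  let ?C = "{v. \<exists>p q. p \<ge> 0 \<and> q \<ge> 0 \<and> v = p *\<^sub>R bloch x + q *\<^sub>R bloch y}"
  have "convex_cone hull ?V \<subseteq> ?C"
  proof (rule hull_minimal)
    show "?V \<subseteq> ?C"
    proof
      fix v assume "v \<in> ?V"
      then obtain z where z: "z \<in> Z" "v = bloch z" by blast
      have "?g z \<in> closed_segment a b" using z unfolding ab[symmetric] by (auto intro: hull_inc)
      then obtain u where u: "0 \<le> u" "u \<le> 1" "?g z = (1 - u) *\<^sub>R a + u *\<^sub>R b"
        by (auto simp: in_segment)
      have "v = (bloch z \<bullet> w) *\<^sub>R ?g z" using w[OF z(1)] z by simp
      also have "\<dots> = ((bloch z \<bullet> w) * (1 - u) * norm a) *\<^sub>R bloch x
          + ((bloch z \<bullet> w) * u * norm b) *\<^sub>R bloch y"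
        unfolding u(3) x y using n by (simp add: scaleR_add_right)
      finally have "v = ((bloch z \<bullet> w) * (1 - u) * norm a) *\<^sub>R bloch x
          + ((bloch z \<bullet> w) * u * norm b) *\<^sub>R bloch y" .
      moreover have "0 \<le> (bloch z \<bullet> w) * (1 - u) * norm a" "0 \<le> (bloch z \<bullet> w) * u * norm b"
        using u w[OF z(1)] by simp_all
      ultimately show "v \<in> ?C" by blast
    qed
    show "convex_cone ?C"
      unfolding convex_cone_iff
    proof (intro conjI ballI allI impI)
      fix u v assume "u \<in> ?C" "v \<in> ?C"
      then obtain p q p' q' where *: "p \<ge> 0" "q \<ge> 0" "u = p *\<^sub>R bloch x + q *\<^sub>R bloch y"
        "p' \<ge> 0" "q' \<ge> 0" "v = p' *\<^sub>R bloch x + q' *\<^sub>R bloch y" by auto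
      then have "u + v = (p + p') *\<^sub>R bloch x + (q + q') *\<^sub>R bloch y" by (simp add: scaleR_add_left)
      then show "u + v \<in> ?C" using * by (metis (mono_tags, lifting) add_nonneg_nonneg mem_Collect_eq)
    next
      fix u and k :: real assume "u \<in> ?C" "k \<ge> 0"
      then obtain p q where *: "p \<ge> 0" "q \<ge> 0" "u = p *\<^sub>R bloch x + q *\<^sub>R bloch y" by auto
      then have "k *\<^sub>R u = (k * p) *\<^sub>R bloch x + (k * q) *\<^sub>R bloch y" by (simp add: scaleR_add_right)
      then show "k *\<^sub>R u \<in> ?C"
        using * \<open>k \<ge> 0\<close> by (metis (mono_tags, lifting) mult_nonneg_nonneg mem_Collect_eq)
    next
      show "0 \<in> ?C" by (auto intro!: exI[of _ 0])
    qed
  qed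
  then have PC: "\<exists>p\<ge>0. \<exists>q\<ge>0. bloch m = p *\<^sub>R bloch x + q *\<^sub>R bloch y" if "m \<in> P" for m
    using that unfolding P by blast
  show False
  proof (cases "x = y")
    case True
    have "m = x" if m: "m \<in> P" for m
    proof -
      obtain p q where pq: "p \<ge> 0" "q \<ge> 0" "bloch m = p *\<^sub>R bloch x + q *\<^sub>R bloch y" using PC[OF m] by blast
      then have m': "bloch m = (p + q) *\<^sub>R bloch x" unfolding True by (simp add: scaleR_add_left)
      then have "p + q = 1" using norm_bloch[of m] pq by simp
      then show ?thesis using m' by (simp add: bloch_eq_iff)
    qed
    then have "P = {x}" using xyP by auto
    then show False using assms by blast
  next
    case False
    have "bloch x \<bullet> w > 0" "bloch y \<bullet> w > 0" unfolding x y using n abw by auto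
    then have d: "dist x y < pi / 2" by (rule dist_lt_in_hemisphere)
    obtain \<gamma> where g: "minimal_geodesic \<gamma> (dist x y)" "\<gamma> 0 = x" "\<gamma> (dist x y) = y"
       "{m. \<exists>p\<ge>0. \<exists>q\<ge>0. bloch m = p *\<^sub>R bloch x + q *\<^sub>R bloch y} \<subseteq> \<gamma> ` {0..dist x y}"
      by (rule obtain_minimal_geodesic[OF False d])
    have "P \<subseteq> \<gamma> ` {0..dist x y}" using g(4) PC by blast
    moreover have "\<gamma> ` {0..dist x y} \<subseteq> P"
      using geodesically_convex_hull[of Z, folded P_def, unfolded geodesically_convex_def, rule_format,
          of \<gamma> "dist x y"] g(1-3) xyP by simp
    ultimately have "geodesic_segment x y P" unfolding geodesic_segment_def using False g by blast
    then show False using ns by blast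
  qed
qed

text \<open>The hypothesis \<open>ri\<close> is the relative interior condition in dual form. If the hull is a segment that had
  \<open>x\<close> as an endpoint, then \<open>ri\<close> applied to the component of the other endpoint orthogonal to \<open>x\<close> would
  force this component to vanish on the hull. If the hull is not a segment, the vectors span the space, and
  relative interior and interior of the cone agree.\<close>

lemma convex_interior_hull:
  assumes "finite Z" "Z \<noteq> {}" and w: "\<And>z. z \<in> Z \<Longrightarrow> bloch z \<bullet> w > 0"
  defines "P \<equiv> geodesically_convex hull Z"
  assumes np: "\<nexists>p. P = {p}" and xP: "x \<in> P"
    and ri: "\<And>h z. \<lbrakk>\<And>z. z \<in> Z \<Longrightarrow> h \<bullet> bloch z \<ge> 0; h \<bullet> bloch x = 0; z \<in> Z\<rbrakk> \<Longrightarrow> h \<bullet> bloch z = 0"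
  shows "x \<in> convex_interior P"
proof (cases "\<exists>x y. geodesic_segment x y P")
  case True
  have P: "P = {x. bloch x \<in> convex_cone hull (bloch ` Z)}"
    unfolding P_def by (rule geodesically_convex_hull_eq_cone[OF w])
  have posP: "bloch y \<bullet> w > 0" if "y \<in> P" for y
    by (rule convex_cone_hull_halfspace[of "bloch ` Z" w "bloch y"]) (use w that P in auto)
  have "\<not> geodesic_segment x y P" for y
  proof
    assume "geodesic_segment x y P"
    then obtain \<gamma> l where g: "x \<noteq> y" "minimal_geodesic \<gamma> l" "\<gamma> 0 = x" "\<gamma> l = y" "P = \<gamma> ` {0..l}"
      unfolding geodesic_segment_def by blast
    then have l: "0 \<le> l" "dist x y = l" unfolding minimal_geodesic_def by auto
    have yP: "y \<in> P" unfolding g(5) g(4)[symmetric] using l by simp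
    have l2: "l < pi / 2" using dist_lt_in_hemisphere[of x w y] posP xP yP l by simp
    have "l \<noteq> 0" using g(1,3,4) by metis
    then have l0: "l > 0" using l by simp
    have s: "sin (2 * l) > 0" by (rule sin_double_dist_pos[OF l0 l2])
    \<comment> \<open>On the arc from \<open>x\<close> to \<open>y\<close> this functional is nonnegative and vanishes only at \<open>x\<close>.\<close>
    let ?h = "bloch y - (bloch x \<bullet> bloch y) *\<^sub>R bloch x"
    have hx: "?h \<bullet> bloch x = 0"
      by (simp add: inner_diff_left bloch_unit inner_commute[of "bloch y"])
    have "?h \<bullet> bloch y = 1 - (cos (2 * l))\<^sup>2"
      by (simp add: inner_diff_left bloch_unit inner_bloch l power2_eq_square)
    then have hy: "?h \<bullet> bloch y > 0" using s by (simp flip: sin_squared_eq)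
    have "?h \<bullet> bloch z \<ge> 0" if "z \<in> Z" for z
    proof -
      have "z \<in> P" using that unfolding P_def by (rule hull_inc)
      then obtain t where t: "t \<in> {0..l}" "z = \<gamma> t" using g by blast
      have "sin (2 * l) * (?h \<bullet> bloch z) = ?h \<bullet> (sin (2 * l) *\<^sub>R bloch (\<gamma> t))" using t by simp
      also have "\<dots> = sin (2 * t) * (?h \<bullet> bloch y)"
        unfolding bloch_minimal_geodesic[OF g(2) t(1)] g inner_add_right inner_scaleR_right hx by simp
      also have "\<dots> \<ge> 0" using hy t l l2 by (intro mult_nonneg_nonneg sin_ge_zero) auto
      finally show ?thesis using s by (simp add: zero_le_mult_iff)
    qed
    then have "?h \<bullet> bloch z = 0" if "z \<in> Z" for z using ri[of ?h z] hx that by blast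
    then have "convex_cone hull (bloch ` Z) \<subseteq> {v. ?h \<bullet> v = 0}"
      by (intro hull_minimal) (auto simp: convex_cone_iff inner_add_right)
    then have "?h \<bullet> bloch y = 0" using yP P by blast
    then show False using hy by simp
  qed
  then show ?thesis using xP True unfolding convex_interior_def by auto
next
  case False
  let ?V = "bloch ` Z" and ?K = "convex_cone hull (bloch ` Z)"
  have P: "P = {x. bloch x \<in> ?K}"
    unfolding P_def by (rule geodesically_convex_hull_eq_cone[OF w])
  have "span ?V = UNIV"
    using geodesic_segment_or_spanning[OF assms(1,2) w] np False unfolding P_def by blast
  moreover have "?V \<subseteq> affine hull ?K" using hull_subset[of ?V] hull_subset[of ?K] by blast
  moreover have "0 \<in> affine hull ?K" using convex_cone_hull_contains_0 hull_inc by metis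
  ultimately have "affine hull ?K = UNIV"
    using affine_hull_span_0[of ?K] span_minimal[of ?V "span ?K"] by auto
  then have "rel_interior ?K = interior ?K" by (rule rel_interior_interior)
  moreover have "bloch x \<in> rel_interior ?K"
  proof (rule relative_interior_convex_cone_hull)
    fix h v assume "\<And>v. v \<in> ?V \<Longrightarrow> h \<bullet> v \<ge> 0" "h \<bullet> bloch x = 0" "v \<in> ?V"
    then show "h \<bullet> v = 0" using ri[of h] by blast
  qed (use xP P in auto)
  ultimately have "x \<in> bloch -` interior ?K" by simp
  moreover have "open (bloch -` interior ?K)"
    using continuous_on_bloch[of UNIV] by (simp add: continuous_on_open_vimage)
  moreover have "bloch -` interior ?K \<subseteq> P" unfolding P using interior_subset by blast
  ultimately have "x \<in> interior P" by (meson interiorI)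
  then show ?thesis using False unfolding convex_interior_def by simp
qed

section \<open>Sections as products of linear forms and their Chern derivative\<close>

text \<open>The dehomogenized polynomial splits over \<open>\<complex>\<close>; if its degree \<open>d\<close> is less than \<open>n\<close>, the point
  \<open>[1 : 0]\<close> is a zero of multiplicity \<open>n - d\<close>.\<close>

lemma hol_sections_factorization:
  assumes "s \<in> hol_sections n" "s \<noteq> (\<lambda>_. 0)"
  obtains \<kappa> W where "\<kappa> \<noteq> 0" "\<And>i. W i \<noteq> 0" "s = (\<lambda>Z. \<kappa> * (\<Prod>i<n. hdet Z (W i)))"
proof -
  obtain a where a: "s = (\<lambda>Z. \<Sum>k\<le>n. a k * fst Z ^ k * snd Z ^ (n - k))"
    using assms(1) unfolding hol_sections_def by blast
  define p where "p = (\<Sum>k\<le>n. monom (a k) k)"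
  have cp: "coeff p k = (if k \<le> n then a k else 0)" for k
    unfolding p_def by (simp add: coeff_sum)
  have p0: "p \<noteq> 0"
  proof
    assume "p = 0"
    then have "a k = 0" if "k \<le> n" for k using cp[of k] that by simp
    then show False using assms(2) unfolding a by simp
  qed
  define d where "d = degree p"
  have dn: "d \<le> n" unfolding d_def by (rule degree_le) (simp add: cp)
  obtain r where "smult (lead_coeff p) (\<Prod>i<degree p. [:- r i, 1:]) = p"
    by (rule complex_poly_decompose')
  then have "poly p z = poly (smult (lead_coeff p) (\<Prod>i<degree p. [:- r i, 1:])) z" for z by simp
  then have pz: "poly p z = lead_coeff p * (\<Prod>i<d. z - r i)" for z
    by (simp add: poly_prod d_def)
  define W where "W i = (if i < d then (r i, 1) else (1, 0 :: complex))" for i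
  have split: "(\<Prod>i<n. hdet Z (W i)) = (\<Prod>i<d. fst Z - snd Z * r i) * (- snd Z) ^ (n - d)" for Z
  proof -
    have "{..<n} = {..<d} \<union> {d..<n}" using dn by auto
    then have "(\<Prod>i<n. hdet Z (W i)) = (\<Prod>i<d. hdet Z (W i)) * (\<Prod>i=d..<n. hdet Z (W i))"
      by (simp add: prod.union_disjoint ivl_disj_int)
    then show ?thesis by (simp add: W_def hdet_def)
  qed
  have "s Z = lead_coeff p * (-1) ^ (n - d) * (\<Prod>i<n. hdet Z (W i))" for Z
  proof (cases "snd Z = 0")
    case True
    have "s Z = (\<Sum>k\<le>n. if k = n then a k * fst Z ^ k else 0)"
      unfolding a by (rule sum.cong) (auto simp: True)
    also have "\<dots> = a n * fst Z ^ n" by simp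
    finally have s: "s Z = a n * fst Z ^ n" .
    show ?thesis
    proof (cases "d = n")
      case True
      then have "a n = lead_coeff p" using cp[of n] by (simp add: d_def)
      then show ?thesis unfolding s split using True \<open>snd Z = 0\<close> by simp
    next
      case False
      then have "a n = 0" using cp[of n] dn coeff_eq_0[of p n] by (simp add: d_def)
      then show ?thesis unfolding s split using False dn \<open>snd Z = 0\<close> by simp
    qed
  next
    case False
    have "s Z = snd Z ^ n * poly p (fst Z / snd Z)"
      unfolding a p_def by (simp add: poly_sum poly_monom sum_distrib_left)
         (rule sum.cong, use False in \<open>auto simp: power_diff power_divide\<close>)
    also have "\<dots> = lead_coeff p * snd Z ^ (n - d) * (snd Z ^ d * (\<Prod>i<d. fst Z / snd Z - r i))"
      unfolding pz using dn by (simp add: power_add[symmetric] ac_simps)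
    also have "snd Z ^ d * (\<Prod>i<d. fst Z / snd Z - r i) = (\<Prod>i<d. snd Z * (fst Z / snd Z - r i))"
      by (simp add: prod.distrib)
    also have "\<dots> = (\<Prod>i<d. fst Z - snd Z * r i)"
      using False by (simp add: right_diff_distrib)
    also have "snd Z ^ (n - d) = (-1) ^ (n - d) * (- snd Z) ^ (n - d)"
      by (simp flip: power_mult_distrib)
    also have "lead_coeff p * \<dots> * (\<Prod>i<d. fst Z - snd Z * r i) =
        lead_coeff p * (-1) ^ (n - d) * ((\<Prod>i<d. fst Z - snd Z * r i) * (- snd Z) ^ (n - d))"
      by (simp only: ac_simps)
    finally show ?thesis unfolding split .
  qed
  moreover have "lead_coeff p * (-1) ^ (n - d) \<noteq> 0" using p0 by simp
  moreover have "W i \<noteq> 0" for i by (simp add: W_def zero_prod_def)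
  ultimately show ?thesis by (intro that[of "lead_coeff p * (-1) ^ (n - d)" W]) auto
qed

text \<open>Treating both charts as affine lines \<open>A + z E\<close> in homogeneous coordinates makes all later
  computations uniform. The last property says that the chart is an immersion.\<close>

lemma affine_lift_cases:
  assumes "\<sigma> \<in> affine_lifts"
  obtains A E where "\<sigma> = (\<lambda>z. (fst A + z * fst E, snd A + z * snd E))" "\<And>z. \<sigma> z \<noteq> 0"
    "\<And>z. hdet E (\<sigma> z) \<noteq> 0"
proof -
  consider "\<sigma> = (\<lambda>z. (1, z))" | "\<sigma> = (\<lambda>z. (z, 1))" using assms unfolding affine_lifts_def by blast
  then show ?thesis
  proof cases
    case 1 then show ?thesis by (intro that[of "(1, 0)" "(0, 1)"]) (auto simp: hdet_def zero_prod_def)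
  next
    case 2 then show ?thesis by (intro that[of "(0, 1)" "(1, 0)"]) (auto simp: hdet_def zero_prod_def)
  qed
qed

lemma affine_lift_exists:
  obtains \<sigma> z where "\<sigma> \<in> affine_lifts" "proj (\<sigma> z) = x" "\<sigma> z \<noteq> 0"
proof -
  obtain Z where Z: "Z \<noteq> 0" "x = proj Z" by (rule cp1_cases)
  show ?thesis
  proof (cases "fst Z = 0")
    case True
    then have s: "snd Z \<noteq> 0" using Z by (simp add: prod_eq_iff)
    have "proj (fst Z / snd Z, 1) = x" "(fst Z / snd Z, 1) \<noteq> (0 :: complex \<times> complex)"
      unfolding Z(2) using Z s
      by (subst proj_eq_iff) (auto simp: zero_prod_def proj_rel_def intro!: exI[of _ "snd Z"])
    then show ?thesis using that[of "\<lambda>z. (z, 1)"] by (auto simp: affine_lifts_def)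
  next
    case False
    have "proj (1, snd Z / fst Z) = x" "(1, snd Z / fst Z) \<noteq> (0 :: complex \<times> complex)"
      unfolding Z(2) using Z False
      by (subst proj_eq_iff) (auto simp: zero_prod_def proj_rel_def intro!: exI[of _ "fst Z"])
    then show ?thesis using that[of "\<lambda>z. (1, z)"] by (auto simp: affine_lifts_def)
  qed
qed

lemma wirtinger_holomorphic:
  assumes "(f has_field_derivative D) (at z)"
  shows "wirtinger f z = D"
proof -
  have "frechet_derivative f (at z) = (*) D"
    using assms unfolding has_field_derivative_def by (rule frechet_derivative_at[symmetric])
  then show ?thesis unfolding wirtinger_def by (simp add: algebra_simps flip: power2_eq_square)
qed

lemma wirtinger_of_real:
  assumes "(f has_derivative (\<lambda>h. 2 * Re (h * c))) (at z)"
  shows "wirtinger (\<lambda>w. complex_of_real (f w)) z = c"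
proof -
  have "((\<lambda>w. complex_of_real (f w)) has_derivative (\<lambda>h. complex_of_real (2 * Re (h * c)))) (at z)"
    by (rule has_derivative_of_real[OF assms])
  then have "frechet_derivative (\<lambda>w. complex_of_real (f w)) (at z) = (\<lambda>h. complex_of_real (2 * Re (h * c)))"
    by (rule frechet_derivative_at[symmetric])
  then show ?thesis unfolding wirtinger_def by (simp add: complex_eq_iff)
qed

text \<open>Up to a factor, this is the component of \<open>w\<close> tangent to the sphere at \<^term>\<open>hopf Z\<close>, written as a
  complex number; \<open>norm_tangential\<close> makes this precise.\<close>

definition tangential :: "complex \<times> complex \<Rightarrow> complex \<times> real \<Rightarrow> complex" where
  "tangential Z w = ((cnj (fst Z))\<^sup>2 * fst w - (cnj (snd Z))\<^sup>2 * cnj (fst w)) / 2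
     - cnj (fst Z) * cnj (snd Z) * of_real (snd w)"

lemma tangential_sum: "tangential Z (\<Sum>i\<in>I. f i) = (\<Sum>i\<in>I. tangential Z (f i))"
proof -
  have "linear (tangential Z)"
    by (rule linearI) (auto simp: tangential_def algebra_simps scaleR_conv_of_real add_divide_distrib diff_divide_distrib)
  then show ?thesis by (rule linear_sum)
qed

lemma tangential_scaleR: "tangential Z (c *\<^sub>R w) = of_real c * tangential Z w"
  by (simp add: tangential_def algebra_simps scaleR_conv_of_real diff_divide_distrib)

text \<open>The quotient \<open>hprod W Z / hdet Z W\<close> is the logarithmic covariant derivative of the linear form
  with zero \<open>W\<close>, up to a factor that does not depend on \<open>W\<close>; its numerator after rationalizing is
  linear in the vector of the zero.\<close>

lemma hprod_hdet_eq_tangential: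
  assumes "W \<noteq> 0"
  shows "hprod W Z * cnj (hdet Z W) = of_real ((norm W)\<^sup>2) * tangential Z (hopf W)"
proof -
  have n: "(norm W)\<^sup>2 \<noteq> 0" using assms by simp
  have "of_real ((norm W)\<^sup>2) * tangential Z (hopf W) =
     tangential Z (2 * fst W * cnj (snd W), (cmod (fst W))\<^sup>2 - (cmod (snd W))\<^sup>2)"
    unfolding hopf_def tangential_scaleR using n by (simp del: of_real_power)
  also have "\<dots> = hprod W Z * cnj (hdet Z W)"
    unfolding tangential_def hprod_def hdet_def fst_conv snd_conv of_real_diff complex_norm_square
    by (simp add: field_simps power2_eq_square)
  finally show ?thesis by simp
qed

lemma norm_tangential:
  assumes "Z \<noteq> 0"
  shows "4 * (cmod (tangential Z w))\<^sup>2 = (norm Z)^4 * ((norm w)\<^sup>2 - (w \<bullet> hopf Z)\<^sup>2)"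
proof -
  have n: "(norm Z)\<^sup>2 \<noteq> 0" using assms by simp
  define N where "N = (norm Z)\<^sup>2"
  define u where "u = w \<bullet> (2 * fst Z * cnj (snd Z), (cmod (fst Z))\<^sup>2 - (cmod (snd Z))\<^sup>2)"
  have "N * (w \<bullet> hopf Z) = u" unfolding hopf_def inner_scaleR_right N_def u_def using n by simp
  then have u: "N\<^sup>2 * (w \<bullet> hopf Z)\<^sup>2 = u\<^sup>2" by (simp flip: power_mult_distrib)
  have nw: "(norm w)\<^sup>2 = (cmod (fst w))\<^sup>2 + (snd w)\<^sup>2" by (cases w) (simp add: norm_Pair)
  obtain p q r s x y t where Z: "Z = (Complex p q, Complex r s)" and w: "w = (Complex x y, t)"
    by (metis complex.exhaust surj_pair)
  have "4 * (cmod (tangential Z w))\<^sup>2 = (cmod (2 * tangential Z w))\<^sup>2"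
    by (simp add: norm_mult power_mult_distrib)
  also have "2 * tangential Z w = (cnj (fst Z))\<^sup>2 * fst w - (cnj (snd Z))\<^sup>2 * cnj (fst w)
      - 2 * (cnj (fst Z) * cnj (snd Z) * of_real (snd w))"
    unfolding tangential_def by (simp add: right_diff_distrib)
  finally have T: "4 * (cmod (tangential Z w))\<^sup>2 = (cmod ((cnj (fst Z))\<^sup>2 * fst w
      - (cnj (snd Z))\<^sup>2 * cnj (fst w) - 2 * (cnj (fst Z) * cnj (snd Z) * of_real (snd w))))\<^sup>2" .
  have "4 * (cmod (tangential Z w))\<^sup>2 + u\<^sup>2 = N\<^sup>2 * (norm w)\<^sup>2"
    unfolding T u_def N_def norm_pair_sq nw unfolding Z w cmod_power2 inner_Pair inner_complex_def fst_conv snd_conv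
    by (simp add: power2_eq_square) algebra
  moreover have "(norm Z)^4 = N\<^sup>2" unfolding N_def by simp
  ultimately show ?thesis using u by (simp add: right_diff_distrib)
qed

text \<open>A section with a chosen list of linear factors; a multiple zero is a point that several indices share.\<close>

locale factored_section =
  fixes n :: nat and s :: "complex \<times> complex \<Rightarrow> complex" and \<kappa> :: complex
    and W :: "nat \<Rightarrow> complex \<times> complex"
  assumes kappa: "\<kappa> \<noteq> 0" and W_nz: "\<And>i. W i \<noteq> 0"
    and s_eq: "s = (\<lambda>Z. \<kappa> * (\<Prod>i<n. hdet Z (W i)))"
    and s_hol: "s \<in> hol_sections n"
begin

definition zero_point :: "nat \<Rightarrow> cp1" where "zero_point i = proj (W i)"

abbreviation v :: "nat \<Rightarrow> complex \<times> real" where "v i \<equiv> bloch (zero_point i)"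

text \<open>Minus the gradient of \<open>\<Sum>i. ln (1 - y \<bullet> v\<^sub>i)\<close> in the ambient space.\<close>

definition balance :: "complex \<times> real \<Rightarrow> complex \<times> real" where
  "balance y = (\<Sum>i<n. (1 / (1 - y \<bullet> v i)) *\<^sub>R v i)"

lemma v_eq: "v i = hopf (W i)"
  unfolding zero_point_def by (rule bloch_proj[OF W_nz])

lemma hdet_norm:
  assumes "Z \<noteq> 0"
  shows "(cmod (hdet Z (W i)))\<^sup>2 = (norm Z)\<^sup>2 * (norm (W i))\<^sup>2 / 2 * (1 - hopf Z \<bullet> v i)"
  using inner_hopf[OF assms W_nz[of i]] assms W_nz[of i] unfolding v_eq by (simp add: field_simps)

lemma hdet_zero_iff: "Z \<noteq> 0 \<Longrightarrow> hdet Z (W i) = 0 \<longleftrightarrow> proj Z = zero_point i"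
proof -
  assume Z: "Z \<noteq> 0"
  have "hdet Z (W i) = 0 \<longleftrightarrow> (cmod (hdet Z (W i)))\<^sup>2 = 0" by simp
  also have "\<dots> \<longleftrightarrow> hopf Z \<bullet> v i = 1" unfolding hdet_norm[OF Z] using Z W_nz[of i] by auto
  also have "\<dots> \<longleftrightarrow> bloch (proj Z) = v i"
    unfolding bloch_proj[OF Z, symmetric]
    using unit_inner_one[of "bloch (proj Z)" "v i"] bloch_unit by auto
  finally show ?thesis unfolding bloch_eq_iff .
qed

lemma zeroes_eq: "zeroes s = zero_point ` {..<n}"
proof -
  have "s Z = 0 \<longleftrightarrow> proj Z \<in> zero_point ` {..<n}" if "Z \<noteq> 0" for Z
    unfolding s_eq using kappa by (auto simp: hdet_zero_iff[OF that])
  then have *: "zeroes s = {proj Z |Z. Z \<noteq> 0 \<and> proj Z \<in> zero_point ` {..<n}}"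
    unfolding zeroes_def by blast
  have "zero_point i \<in> zeroes s" if "i < n" for i
    unfolding * zero_point_def using W_nz that by blast
  then have "zero_point ` {..<n} \<subseteq> zeroes s" by auto
  moreover have "zeroes s \<subseteq> zero_point ` {..<n}" unfolding * by auto
  ultimately show ?thesis by blast
qed

lemma section_zero_iff: "Z \<noteq> 0 \<Longrightarrow> s Z = 0 \<longleftrightarrow> proj Z \<in> zeroes s"
  unfolding zeroes_eq unfolding s_eq using kappa by (auto simp: hdet_zero_iff)

lemma section_normsq_eq:
  obtains C where "C > 0" "\<And>x. section_normsq n s x = C * (\<Prod>i<n. 1 - bloch x \<bullet> v i)"
proof
  let ?C = "(cmod \<kappa>)\<^sup>2 * (\<Prod>i<n. (norm (W i))\<^sup>2 / 2)"
  show "?C > 0" using kappa W_nz by (intro mult_pos_pos prod_pos) auto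
  fix x
  obtain Z where Z: "Z \<noteq> 0" "x = proj Z" by (rule cp1_cases)
  have "(cmod (s Z))\<^sup>2 = (cmod \<kappa>)\<^sup>2 * (\<Prod>i<n. (cmod (hdet Z (W i)))\<^sup>2)"
    unfolding s_eq by (simp add: norm_mult power_mult_distrib prod_norm[symmetric] prod_power_distrib)
  also have "\<dots> = ?C * (\<Prod>i<n. 1 - bloch x \<bullet> v i) * ((norm Z)\<^sup>2) ^ n"
    unfolding hdet_norm[OF Z(1)] Z(2) bloch_proj[OF Z(1)] by (simp add: prod.distrib prod_dividef)
  finally show "section_normsq n s x = ?C * (\<Prod>i<n. 1 - bloch x \<bullet> v i)"
    unfolding Z(2) section_normsq_proj[OF s_hol Z(1)] fibre_normsq_def norm_pair_sq[symmetric] using Z by simp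
qed

lemma chern_derivative_eq:
  assumes "\<sigma> = (\<lambda>z. (fst A + z * fst E, snd A + z * snd E))" "\<And>z. \<sigma> z \<noteq> 0"
  shows "chern_derivative n s \<sigma> z =
     \<kappa> * (\<Sum>i<n. hdet E (W i) * (\<Prod>j\<in>{..<n} - {i}. hdet (\<sigma> z) (W j)))
       - s (\<sigma> z) * (of_nat n * hprod E (\<sigma> z) / of_real ((norm (\<sigma> z))\<^sup>2))"
proof -
  have d: "((\<lambda>w. hdet (\<sigma> w) (W i)) has_field_derivative hdet E (W i)) (at z)" for i
    unfolding assms hdet_def by (auto intro!: derivative_eq_intros)
  have H: "((\<lambda>w. s (\<sigma> w)) has_field_derivative
      \<kappa> * (\<Sum>i<n. hdet E (W i) * (\<Prod>j\<in>{..<n} - {i}. hdet (\<sigma> z) (W j)))) (at z)"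
    unfolding s_eq by (intro DERIV_cmult has_field_derivative_prod d)
  have "norm (\<sigma> w) > 0" for w using assms(2) by simp
  then have fp: "frame_potential n \<sigma> = (\<lambda>w. of_nat n * ln ((norm (\<sigma> w))\<^sup>2))"
    unfolding frame_potential_def fibre_normsq_def norm_pair_sq[symmetric]
    by (auto simp: ln_div ln_realpow)
  have nz: "(norm (\<sigma> z))\<^sup>2 > 0" using assms(2)[of z] by simp
  have D: "((\<lambda>w. (norm (\<sigma> w))\<^sup>2) has_derivative (\<lambda>h. 2 * Re (h * hprod E (\<sigma> z)))) (at z)"
    unfolding norm_pair_sq assms(1) fst_conv snd_conv cmod_power2 hprod_def
    by (auto intro!: derivative_eq_intros simp: fun_eq_iff algebra_simps)
  have "2 * Re (h * (of_nat n * hprod E (\<sigma> z) / of_real ((norm (\<sigma> z))\<^sup>2)))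
      = of_nat n * (2 * Re (h * hprod E (\<sigma> z)) * inverse ((norm (\<sigma> z))\<^sup>2))" for h
  proof -
    have e: "h * (of_nat n * hprod E (\<sigma> z) / of_real ((norm (\<sigma> z))\<^sup>2))
        = of_real (of_nat n * inverse ((norm (\<sigma> z))\<^sup>2)) * (h * hprod E (\<sigma> z))"
      by (simp add: divide_inverse)
    have R: "Re (of_real a * b) = a * Re b" for a b by simp
    show ?thesis unfolding e R by (simp only: ac_simps)
  qed
  then have G: "((\<lambda>w. of_nat n * ln ((norm (\<sigma> w))\<^sup>2)) has_derivative
      (\<lambda>h. 2 * Re (h * (of_nat n * hprod E (\<sigma> z) / of_real ((norm (\<sigma> z))\<^sup>2))))) (at z)"
    using has_derivative_mult_right[OF DERIV_compose_FDERIV[OF DERIV_ln[OF nz] D], of "of_nat n"]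
    by (simp only:)
  show ?thesis
    unfolding chern_derivative_def fp wirtinger_holomorphic[OF H] wirtinger_of_real[OF G] ..
qed

text \<open>The component of \<open>E\<close> orthogonal to \<open>Z\<close> is a multiple of \<open>(- cnj Z\<^sub>1, cnj Z\<^sub>0)\<close>, and applying
  \<open>hdet\<close> to the latter and \<open>V\<close> gives \<open>- hprod V Z\<close>.\<close>

lemma hprod_hdet_identity:
  "hdet E V * of_real ((norm Z)\<^sup>2) - hprod E Z * hdet Z V = hdet E Z * hprod V Z"
  unfolding hprod_self[symmetric] by (simp add: hprod_def hdet_def algebra_simps)

lemma chern_derivative_balance:
  assumes "\<sigma> = (\<lambda>z. (fst A + z * fst E, snd A + z * snd E))" "\<And>z. \<sigma> z \<noteq> 0"
    and "proj (\<sigma> z) \<notin> zeroes s"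
  shows "chern_derivative n s \<sigma> z = 2 * s (\<sigma> z) * hdet E (\<sigma> z) / of_real ((norm (\<sigma> z)) ^ 4)
     * tangential (\<sigma> z) (balance (hopf (\<sigma> z)))"
proof -
  let ?Z = "\<sigma> z"
  define N where "N = complex_of_real ((norm ?Z)\<^sup>2)"
  have N: "N \<noteq> 0" unfolding N_def using assms(2)[of z] by simp
  have nz: "hdet ?Z (W i) \<noteq> 0" if "i < n" for i
    using assms(3) that unfolding hdet_zero_iff[OF assms(2)] zeroes_eq by auto
  have "\<kappa> * (\<Sum>i<n. hdet E (W i) * (\<Prod>j\<in>{..<n} - {i}. hdet ?Z (W j)))
      = (\<Sum>i<n. s ?Z * (hdet E (W i) / hdet ?Z (W i)))"
    unfolding s_eq sum_distrib_left
  proof (rule sum.cong)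
    fix i assume "i \<in> {..<n}"
    then show "\<kappa> * (hdet E (W i) * (\<Prod>j\<in>{..<n} - {i}. hdet ?Z (W j)))
      = \<kappa> * (\<Prod>i<n. hdet ?Z (W i)) * (hdet E (W i) / hdet ?Z (W i))"
      using nz[of i] by (simp add: prod.remove[of "{..<n}" i])
  qed simp
  then have "chern_derivative n s \<sigma> z =
      s ?Z * (\<Sum>i<n. hdet E (W i) / hdet ?Z (W i) - hprod E ?Z / N)"
    unfolding chern_derivative_eq[OF assms(1,2)] N_def[symmetric]
    by (simp add: sum_subtractf sum_distrib_left right_diff_distrib)
  also have "(\<Sum>i<n. hdet E (W i) / hdet ?Z (W i) - hprod E ?Z / N) =
     (\<Sum>i<n. 2 * hdet E ?Z / N\<^sup>2 * tangential ?Z ((1 / (1 - hopf ?Z \<bullet> v i)) *\<^sub>R v i))"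
  proof (rule sum.cong)
    fix i assume "i \<in> {..<n}"
    then have i: "hdet ?Z (W i) \<noteq> 0" using nz by simp
    then have d: "(cmod (hdet ?Z (W i)))\<^sup>2 \<noteq> 0" by simp
    then have q: "1 - hopf ?Z \<bullet> v i \<noteq> 0" unfolding hdet_norm[OF assms(2)] by auto
    have w: "(norm (W i))\<^sup>2 \<noteq> 0" using W_nz by simp
    have "hdet E (W i) / hdet ?Z (W i) - hprod E ?Z / N
        = (hdet E (W i) * N - hprod E ?Z * hdet ?Z (W i)) / (hdet ?Z (W i) * N)"
      using i N by (simp add: field_simps)
    also have "\<dots> = hdet E ?Z / N * (hprod (W i) ?Z / hdet ?Z (W i))"
      unfolding N_def hprod_hdet_identity by simp
    also have "hprod (W i) ?Z / hdet ?Z (W i)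
        = hprod (W i) ?Z * cnj (hdet ?Z (W i)) / of_real ((cmod (hdet ?Z (W i)))\<^sup>2)"
      unfolding complex_norm_square using i by simp
    also have "\<dots> = of_real ((norm (W i))\<^sup>2 / ((norm ?Z)\<^sup>2 * (norm (W i))\<^sup>2 / 2 * (1 - hopf ?Z \<bullet> v i)))
        * tangential ?Z (v i)"
      unfolding hprod_hdet_eq_tangential[OF W_nz] hdet_norm[OF assms(2)] v_eq[symmetric]
      by (simp only: of_real_divide times_divide_eq_left)
    also have "(norm (W i))\<^sup>2 / ((norm ?Z)\<^sup>2 * (norm (W i))\<^sup>2 / 2 * (1 - hopf ?Z \<bullet> v i))
        = 2 / (norm ?Z)\<^sup>2 * (1 / (1 - hopf ?Z \<bullet> v i))"
      using w by simp
    also have "of_real \<dots> = 2 / N * of_real (1 / (1 - hopf ?Z \<bullet> v i))"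
      unfolding N_def by (simp only: of_real_mult of_real_divide of_real_numeral)
    finally show "hdet E (W i) / hdet ?Z (W i) - hprod E ?Z / N =
       2 * hdet E ?Z / N\<^sup>2 * tangential ?Z ((1 / (1 - hopf ?Z \<bullet> v i)) *\<^sub>R v i)"
      unfolding tangential_scaleR power2_eq_square by (simp add: mult.assoc mult.left_commute)
  qed simp
  also have "\<dots> = 2 * hdet E ?Z / N\<^sup>2 * tangential ?Z (balance (hopf ?Z))"
    unfolding balance_def tangential_sum sum_distrib_left ..
  finally show ?thesis unfolding N_def by (simp flip: power_mult)
qed

text \<open>By \<open>chern_derivative_balance\<close> the Chern derivative is a nonzero multiple of the tangential part of the
  balance vector, in every chart around \<open>x\<close>.\<close>

lemma critical_iff_balance:
  assumes "x \<notin> zeroes s"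
  shows "x \<in> critical_points n s \<longleftrightarrow> balance (bloch x) = (balance (bloch x) \<bullet> bloch x) *\<^sub>R bloch x"
proof -
  let ?w = "balance (bloch x)"
  have sq: "(norm (?w - (?w \<bullet> bloch x) *\<^sub>R bloch x))\<^sup>2 = (norm ?w)\<^sup>2 - (?w \<bullet> bloch x)\<^sup>2"
    unfolding power2_norm_eq_inner
    by (simp add: inner_diff_left inner_diff_right bloch_unit inner_commute[of "bloch x"] power2_eq_square)
  have key: "chern_derivative n s \<sigma> z = 0 \<longleftrightarrow> ?w = (?w \<bullet> bloch x) *\<^sub>R bloch x"
    if sg: "\<sigma> \<in> affine_lifts" and x: "proj (\<sigma> z) = x" for \<sigma> z
  proof -
    obtain A E where AE: "\<sigma> = (\<lambda>z. (fst A + z * fst E, snd A + z * snd E))"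
      "\<And>z. \<sigma> z \<noteq> 0" "\<And>z. hdet E (\<sigma> z) \<noteq> 0" using affine_lift_cases[OF sg] by metis
    have nz: "\<sigma> z \<noteq> 0" by (rule AE)
    have h: "hopf (\<sigma> z) = bloch x" using bloch_proj[OF nz] x by simp
    have "chern_derivative n s \<sigma> z = 0 \<longleftrightarrow> tangential (\<sigma> z) ?w = 0"
      using chern_derivative_balance[OF AE(1,2), of z] assms x AE(3)[of z] nz section_zero_iff[OF nz]
      by (simp add: h)
    also have "\<dots> \<longleftrightarrow> (norm ?w)\<^sup>2 - (?w \<bullet> bloch x)\<^sup>2 = 0"
      using norm_tangential[OF nz, of ?w] nz unfolding h by auto
    also have "\<dots> \<longleftrightarrow> ?w = (?w \<bullet> bloch x) *\<^sub>R bloch x"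
      unfolding sq[symmetric] by simp
    finally show ?thesis .
  qed
  obtain \<sigma> z where "\<sigma> \<in> affine_lifts" "proj (\<sigma> z) = x" by (rule affine_lift_exists)
  then show ?thesis unfolding critical_points_def mem_Collect_eq using key by blast
qed

text \<open>At a zero the Chern derivative is the ordinary derivative of the product; only the term that
  differentiates the vanishing factor survives, and it is nonzero when the zero is simple.\<close>

lemma simple_zero_point_not_critical:
  assumes "i < n" "\<And>j. \<lbrakk>j < n; j \<noteq> i\<rbrakk> \<Longrightarrow> zero_point j \<noteq> zero_point i"
  shows "zero_point i \<notin> critical_points n s"
proof
  assume c: "zero_point i \<in> critical_points n s"
  obtain \<sigma> z where sg: "\<sigma> \<in> affine_lifts" "proj (\<sigma> z) = zero_point i" by (rule affine_lift_exists)
  obtain A E where AE: "\<sigma> = (\<lambda>z. (fst A + z * fst E, snd A + z * snd E))"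
      "\<And>z. \<sigma> z \<noteq> 0" "\<And>z. hdet E (\<sigma> z) \<noteq> 0" using affine_lift_cases[OF sg(1)] by metis
  let ?Z = "\<sigma> z"
  have z: "hdet ?Z (W j) = 0 \<longleftrightarrow> j = i" if "j < n" for j
    unfolding hdet_zero_iff[OF AE(2)] sg using assms(2)[OF that] by (cases "j = i") auto
  have "s ?Z = 0" using section_zero_iff[OF AE(2), of z] sg assms(1) by (auto simp: zeroes_eq)
  then have "chern_derivative n s \<sigma> z
      = \<kappa> * (\<Sum>k<n. hdet E (W k) * (\<Prod>j\<in>{..<n} - {k}. hdet ?Z (W j)))"
    unfolding chern_derivative_eq[OF AE(1,2)] by simp
  also have "(\<Sum>k<n. hdet E (W k) * (\<Prod>j\<in>{..<n} - {k}. hdet ?Z (W j)))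
      = (\<Sum>k<n. if k = i then hdet E (W i) * (\<Prod>j\<in>{..<n} - {i}. hdet ?Z (W j)) else 0)"
  proof (rule sum.cong)
    fix k assume "k \<in> {..<n}"
    show "hdet E (W k) * (\<Prod>j\<in>{..<n} - {k}. hdet ?Z (W j))
        = (if k = i then hdet E (W i) * (\<Prod>j\<in>{..<n} - {i}. hdet ?Z (W j)) else 0)"
    proof (cases "k = i")
      case False
      then have "(\<Prod>j\<in>{..<n} - {k}. hdet ?Z (W j)) = 0"
        using z[OF assms(1)] assms(1) by (intro prod_zero) auto
      then show ?thesis using False by simp
    qed simp
  qed simp
  also have "\<dots> = hdet E (W i) * (\<Prod>j\<in>{..<n} - {i}. hdet ?Z (W j))" using assms(1) by simp
  finally have ch: "chern_derivative n s \<sigma> z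
      = \<kappa> * (hdet E (W i) * (\<Prod>j\<in>{..<n} - {i}. hdet ?Z (W j)))" .
  have "hdet E (W i) * of_real ((norm ?Z)\<^sup>2) = hdet E ?Z * hprod (W i) ?Z"
    using hprod_hdet_identity[of E "W i" ?Z] z[OF assms(1)] by simp
  moreover have "hprod (W i) ?Z \<noteq> 0"
    using lagrange_hprod[of ?Z "W i"] z[OF assms(1)] AE(2)[of z] W_nz[of i] hprod_commute[of "W i" ?Z]
    by auto
  ultimately have "hdet E (W i) \<noteq> 0" using AE(3)[of z] by auto
  moreover have "(\<Prod>j\<in>{..<n} - {i}. hdet ?Z (W j)) \<noteq> 0" using z by simp
  ultimately have "chern_derivative n s \<sigma> z \<noteq> 0" unfolding ch using kappa by simp
  then show False using c sg unfolding critical_points_def by blast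
qed

end

section \<open>Second derivatives\<close>

text \<open>\<open>D w\<close> is the derivative at the points \<open>w\<close> near \<open>z\<close>, and \<open>H h k\<close> the derivative at \<open>z\<close> of \<open>w \<mapsto> D w h\<close>
  in the direction \<open>k\<close>. The symmetry of \<open>H\<close> is part of the definition: it is preserved by sums,
  products and compositions, so it comes for free for the functions built from norms of affine functions.\<close>

definition second_order ::
  "(complex \<Rightarrow> real) \<Rightarrow> (complex \<Rightarrow> complex \<Rightarrow> real) \<Rightarrow> (complex \<Rightarrow> complex \<Rightarrow> real) \<Rightarrow> complex \<Rightarrow> bool" where
  "second_order f D H z \<longleftrightarrow>
     (\<forall>\<^sub>F w in nhds z. (f has_derivative D w) (at w)) \<and>
     (\<forall>h. ((\<lambda>w. D w h) has_derivative H h) (at z)) \<and>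
     (\<forall>h k. H h k = H k h)"

lemma second_order_at: "second_order f D H z \<Longrightarrow> (f has_derivative D z) (at z)"
  unfolding second_order_def using eventually_nhds_x_imp_x by blast

lemma second_order_add:
  assumes "second_order f D H z" "second_order g D' H' z"
  shows "second_order (\<lambda>w. f w + g w) (\<lambda>w h. D w h + D' w h) (\<lambda>h k. H h k + H' h k) z"
  unfolding second_order_def
proof (intro conjI allI)
  show "\<forall>\<^sub>F w in nhds z. ((\<lambda>w. f w + g w) has_derivative (\<lambda>h. D w h + D' w h)) (at w)"
    using assms unfolding second_order_def
    by (elim conjE) (erule (1) eventually_elim2, rule has_derivative_add)
qed (use assms in \<open>auto simp: second_order_def intro: has_derivative_add\<close>)

lemma second_order_mult:
  assumes f: "second_order f D H z" and g: "second_order g D' H' z"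
  shows "second_order (\<lambda>w. f w * g w) (\<lambda>w h. f w * D' w h + D w h * g w)
     (\<lambda>h k. (f z * H' h k + D z k * D' z h) + (D z h * D' z k + H h k * g z)) z"
  unfolding second_order_def
proof (intro conjI allI)
  show "\<forall>\<^sub>F w in nhds z. ((\<lambda>w. f w * g w) has_derivative (\<lambda>h. f w * D' w h + D w h * g w)) (at w)"
    using assms unfolding second_order_def
    by (elim conjE) (erule (1) eventually_elim2, rule has_derivative_mult)
  show "((\<lambda>w. f w * D' w h + D w h * g w) has_derivative
     (\<lambda>k. (f z * H' h k + D z k * D' z h) + (D z h * D' z k + H h k * g z))) (at z)" for h
  proof -
    have "((\<lambda>w. D w h) has_derivative H h) (at z)" "((\<lambda>w. D' w h) has_derivative H' h) (at z)"
      using assms unfolding second_order_def by blast+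
    then show ?thesis
      by (intro has_derivative_add has_derivative_mult second_order_at[OF f] second_order_at[OF g])
  qed
  show "(f z * H' h k + D z k * D' z h) + (D z h * D' z k + H h k * g z)
    = (f z * H' k h + D z h * D' z k) + (D z k * D' z h + H k h * g z)" for h k
  proof -
    have "H h k = H k h" "H' h k = H' k h" using assms unfolding second_order_def by blast+
    then show ?thesis by simp
  qed
qed

lemma second_order_compose:
  assumes f: "second_order f D H z"
    and d: "\<forall>\<^sub>F y in nhds (f z). (\<phi> has_real_derivative \<phi>' y) (at y)"
    and dd: "(\<phi>' has_real_derivative c) (at (f z))"
  shows "second_order (\<lambda>w. \<phi> (f w)) (\<lambda>w h. D w h * \<phi>' (f w))
     (\<lambda>h k. D z h * (D z k * c) + H h k * \<phi>' (f z)) z"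
  unfolding second_order_def
proof (intro conjI allI)
  have "isCont f z" using second_order_at[OF f] by (rule has_derivative_continuous)
  then have "filterlim f (nhds (f z)) (nhds z)"
    by (simp add: isCont_def tendsto_at_iff_tendsto_nhds)
  then have "\<forall>\<^sub>F w in nhds z. (\<phi> has_real_derivative \<phi>' (f w)) (at (f w))"
    using d by (rule eventually_compose_filterlim[rotated])
  moreover have "\<forall>\<^sub>F w in nhds z. (f has_derivative D w) (at w)"
    using f unfolding second_order_def by blast
  ultimately show "\<forall>\<^sub>F w in nhds z. ((\<lambda>w. \<phi> (f w)) has_derivative (\<lambda>h. D w h * \<phi>' (f w))) (at w)"
    by eventually_elim (rule DERIV_compose_FDERIV)
  have "((\<lambda>w. \<phi>' (f w)) has_derivative (\<lambda>k. D z k * c)) (at z)"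
    by (rule DERIV_compose_FDERIV[OF dd second_order_at[OF f]])
  moreover have "((\<lambda>w. D w h) has_derivative H h) (at z)" for h
    using f unfolding second_order_def by blast
  ultimately show "((\<lambda>w. D w h * \<phi>' (f w)) has_derivative (\<lambda>k. D z h * (D z k * c) + H h k * \<phi>' (f z))) (at z)" for h
    by (intro has_derivative_mult)
  have "H h k = H k h" for h k using f unfolding second_order_def by blast
  then show "D z h * (D z k * c) + H h k * \<phi>' (f z) = D z k * (D z h * c) + H k h * \<phi>' (f z)" for h k
    by (metis mult.left_commute)
qed

definition twice_diff :: "(complex \<Rightarrow> real) \<Rightarrow> complex \<Rightarrow> bool" where
  "twice_diff f z \<longleftrightarrow> (\<exists>D H. second_order f D H z)"

lemma twice_diff_const: "twice_diff (\<lambda>_. c) z"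
  unfolding twice_diff_def second_order_def
  by (intro exI[of _ "\<lambda>_ _. 0"]) auto

lemma twice_diff_add: "twice_diff f z \<Longrightarrow> twice_diff g z \<Longrightarrow> twice_diff (\<lambda>w. f w + g w) z"
  unfolding twice_diff_def by (elim exE) (rule exI, rule exI, rule second_order_add)

lemma twice_diff_mult: "twice_diff f z \<Longrightarrow> twice_diff g z \<Longrightarrow> twice_diff (\<lambda>w. f w * g w) z"
  unfolding twice_diff_def by (elim exE) (rule exI, rule exI, rule second_order_mult)

lemma twice_diff_prod: "(\<And>i. i \<in> I \<Longrightarrow> twice_diff (f i) z) \<Longrightarrow> twice_diff (\<lambda>w. \<Prod>i\<in>I. f i w) z"
  by (induction I rule: infinite_finite_induct) (auto intro: twice_diff_const twice_diff_mult)

lemma twice_diff_compose: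
  assumes "twice_diff f z" "\<forall>\<^sub>F y in nhds (f z). (\<phi> has_real_derivative \<phi>' y) (at y)"
    and "(\<phi>' has_real_derivative c) (at (f z))"
  shows "twice_diff (\<lambda>w. \<phi> (f w)) z"
proof -
  obtain D H where f: "second_order f D H z" using assms unfolding twice_diff_def by blast
  show ?thesis unfolding twice_diff_def by (rule exI, rule exI, rule second_order_compose[OF f assms(2,3)])
qed

lemma twice_diff_ln:
  assumes "twice_diff f z" "f z > 0"
  shows "twice_diff (\<lambda>w. ln (f w)) z"
proof -
  have "\<forall>\<^sub>F y in nhds (f z). y \<in> {0<..}"
    using assms(2) by (intro eventually_nhds_in_open) auto
  then have 1: "\<forall>\<^sub>F y in nhds (f z). (ln has_real_derivative inverse y) (at y)"
    by eventually_elim (auto intro: DERIV_ln)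
  have "(inverse has_real_derivative - (inverse (f z) ^ Suc (Suc 0))) (at (f z))"
    by (rule DERIV_inverse) (use assms(2) in simp)
  then show ?thesis by (rule twice_diff_compose[OF assms(1) 1])
qed

lemma twice_diff_inverse:
  assumes "twice_diff f z" "f z \<noteq> 0"
  shows "twice_diff (\<lambda>w. inverse (f w)) z"
proof -
  have "\<forall>\<^sub>F y in nhds (f z). y \<in> - {0}"
    using assms(2) by (intro eventually_nhds_in_open) auto
  then have 1: "\<forall>\<^sub>F y in nhds (f z). (inverse has_real_derivative - (inverse y ^ Suc (Suc 0))) (at y)"
    by eventually_elim (rule DERIV_inverse, simp)
  obtain c where "((\<lambda>y. - (inverse y ^ Suc (Suc 0))) has_real_derivative c) (at (f z))"
    using DERIV_minus[OF DERIV_power[OF DERIV_inverse[OF assms(2)]]] by blast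
  then show ?thesis by (rule twice_diff_compose[OF assms(1) 1])
qed

lemma twice_diff_norm_affine: "twice_diff (\<lambda>w. (cmod (a + w * b))\<^sup>2) z"
proof -
  have "second_order (\<lambda>w. (cmod (a + w * b))\<^sup>2) (\<lambda>w h. 2 * Re (cnj (a + w * b) * (h * b)))
     (\<lambda>h k. 2 * Re (cnj (k * b) * (h * b))) z"
    unfolding second_order_def
  proof (intro conjI allI always_eventually)
    show "((\<lambda>w. (cmod (a + w * b))\<^sup>2) has_derivative (\<lambda>h. 2 * Re (cnj (a + w * b) * (h * b)))) (at w)" for w
      unfolding cmod_power2 by (auto intro!: derivative_eq_intros simp: fun_eq_iff algebra_simps)
    show "((\<lambda>w. 2 * Re (cnj (a + w * b) * (h * b))) has_derivative (\<lambda>k. 2 * Re (cnj (k * b) * (h * b)))) (at z)" for h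
      by (auto intro!: derivative_eq_intros)
    show "2 * Re (cnj (k * b) * (h * b)) = 2 * Re (cnj (h * b) * (k * b))" for h k
      by (simp add: algebra_simps)
  qed
  then show ?thesis unfolding twice_diff_def by blast
qed

lemma hessian_second_order:
  assumes "second_order f D H z"
  shows "hessian f z $ i $ j = H (coord_dir j) (coord_dir i)"
proof -
  have ev: "\<forall>\<^sub>F w in nhds z. D w (coord_dir j) = frechet_derivative f (at w) (coord_dir j)"
    using assms unfolding second_order_def
    by (elim conjE, elim eventually_mono) (simp add: frechet_derivative_at[symmetric])
  have "((\<lambda>w. D w (coord_dir j)) has_derivative H (coord_dir j)) (at z)"
    using assms unfolding second_order_def by blast
  then have "((\<lambda>w. frechet_derivative f (at w) (coord_dir j)) has_derivative H (coord_dir j)) (at z)"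
    by (rule has_derivative_transform_eventually)
       (use ev eventually_nhds_x_imp_x[OF ev] in \<open>auto simp: eventually_at_filter elim: eventually_mono\<close>)
  then show ?thesis
    unfolding hessian_def by (simp add: frechet_derivative_at[symmetric])
qed

text \<open>The second derivative test: if \<open>H h h > 0\<close>, the derivative along the line through \<open>z\<close> in direction \<open>h\<close> would be
  positive shortly after \<open>z\<close>, and \<open>f\<close> would increase.\<close>

lemma second_order_local_max:
  assumes f: "second_order f D H z" and max: "\<forall>\<^sub>F w in nhds z. f w \<le> f z"
  shows "H h h \<le> 0"
proof (rule ccontr)
  assume "\<not> H h h \<le> 0"
  then have Hp: "H h h > 0" by simp
  define l where "l t = z + of_real t * h" for t :: real
  have l0: "l 0 = z" by (simp add: l_def)
  have l: "(l has_derivative (\<lambda>t. of_real t * h)) (at t)" for t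
    unfolding l_def by (auto intro!: derivative_eq_intros)
  have fd: "\<forall>\<^sub>F w in nhds z. (f has_derivative D w) (at w)"
    and Hd: "((\<lambda>w. D w h) has_derivative H h) (at z)"
    using f unfolding second_order_def by blast+
  have "\<forall>\<^sub>F w in at z. f w \<le> f z"
    using max by (auto simp: eventually_at_filter elim: eventually_mono)
  then have "D z = (\<lambda>_. 0)"
    by (rule has_derivative_local_max[OF second_order_at[OF f]])
  then have Dz: "D z h = 0" by simp
  have "((\<lambda>t. D (l t) h) has_derivative (\<lambda>t. H h (of_real t * h))) (at 0)"
    by (rule has_derivative_compose[OF l]) (simp add: l0 Hd)
  moreover have "H h (of_real t * h) = H h h * t" for t
    using linear_scale[OF has_derivative_linear[OF Hd], of t h] by (simp add: scaleR_conv_of_real)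
  ultimately have "((\<lambda>t. D (l t) h) has_real_derivative H h h) (at 0)"
    unfolding has_field_derivative_def by simp
  then obtain d where d: "d > 0" "\<And>t. \<lbrakk>0 < t; t < d\<rbrakk> \<Longrightarrow> D (l t) h > 0"
    using DERIV_pos_inc_right[OF _ Hp] by (force simp: l0 Dz)
  have "\<forall>\<^sub>F w in nhds z. f w \<le> f z \<and> (f has_derivative D w) (at w)"
    using max fd by (rule eventually_conj)
  then obtain r where r: "r > 0" "\<And>w. dist w z < r \<Longrightarrow> f w \<le> f z \<and> (f has_derivative D w) (at w)"
    unfolding eventually_nhds_metric by blast
  define t0 where "t0 = min d (r / (norm h + 1)) / 2"
  have nh: "norm h + 1 > 0" by (simp add: add_nonneg_pos)
  have "0 < x \<Longrightarrow> 0 < y \<Longrightarrow> 0 < min x y / 2 \<and> min x y / 2 < x \<and> min x y / 2 < y" for x y :: real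
    by (auto simp: min_def)
  moreover have "r / (norm h + 1) > 0" using r nh by simp
  ultimately have t0: "t0 > 0" "t0 < d" "t0 < r / (norm h + 1)"
    unfolding t0_def using d(1) by blast+
  have near: "dist (l t) z < r" if "0 \<le> t" "t \<le> t0" for t
  proof -
    have "dist (l t) z = t * norm h" using that by (simp add: l_def dist_norm norm_mult)
    also have "\<dots> \<le> t0 * (norm h + 1)" using that t0 by (intro mult_mono) auto
    also have "\<dots> < r" using t0(3) nh by (simp add: field_simps)
    finally show ?thesis .
  qed
  have fl: "((\<lambda>t. f (l t)) has_real_derivative D (l t) h) (at t)" if "0 \<le> t" "t \<le> t0" for t
  proof -
    have Dl: "(f has_derivative D (l t)) (at (l t))" using r(2)[OF near[OF that]] by blast
    have "((\<lambda>t. f (l t)) has_derivative (\<lambda>u. D (l t) (of_real u * h))) (at t)"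
      by (rule has_derivative_compose[OF l Dl])
    moreover have "D (l t) (of_real u * h) = D (l t) h * u" for u
      using linear_scale[OF has_derivative_linear[OF Dl], of u h] by (simp add: scaleR_conv_of_real)
    ultimately show ?thesis unfolding has_field_derivative_def by simp
  qed
  have "f (l 0) < f (l t0)"
  proof (rule DERIV_pos_imp_increasing_open[OF t0(1)])
    fix t assume "0 < t" "t < t0"
    then show "\<exists>y. ((\<lambda>t. f (l t)) has_real_derivative y) (at t) \<and> 0 < y"
      using fl[of t] d(2)[of t] t0 by auto
  next
    show "continuous_on {0..t0} (\<lambda>t. f (l t))"
      by (rule DERIV_continuous_on) (use fl in \<open>auto intro: DERIV_subset\<close>)
  qed
  moreover have "f (l t0) \<le> f z" using r(2)[OF near[of t0]] t0 by simp
  ultimately show False unfolding l0 by simp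
qed

lemma second_order_sym: "second_order f D H z \<Longrightarrow> H h k = H k h"
  unfolding second_order_def by blast

lemma second_order_linear: "second_order f D H z \<Longrightarrow> linear (H h)"
  unfolding second_order_def by (blast intro: has_derivative_linear)

lemma hessian_local_max:
  assumes f: "twice_diff f z" and max: "\<forall>\<^sub>F w in nhds z. f w \<le> f z"
  shows "hessian f z $ 1 $ 2 = hessian f z $ 2 $ 1" "x \<bullet> (hessian f z *v x) \<le> 0"
proof -
  obtain D H where H: "second_order f D H z" using f unfolding twice_diff_def by blast
  note he = hessian_second_order[OF H]
  show "hessian f z $ 1 $ 2 = hessian f z $ 2 $ 1"
    unfolding he using second_order_sym[OF H] by simp
  let ?h = "(x $ 1) *\<^sub>R coord_dir 1 + (x $ 2) *\<^sub>R coord_dir 2"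
  have lin: "H ?h k = x $ 1 * H (coord_dir 1) k + x $ 2 * H (coord_dir 2) k" for k
    unfolding second_order_sym[OF H, of _ k]
    using linear_add[OF second_order_linear[OF H]] linear_scale[OF second_order_linear[OF H]] by simp
  have "H ?h ?h = x $ 1 * H (coord_dir 1) ?h + x $ 2 * H (coord_dir 2) ?h" by (rule lin)
  also have "\<dots> = x \<bullet> (hessian f z *v x)"
    unfolding second_order_sym[OF H, of _ ?h] lin
    by (simp add: inner_vec_def matrix_vector_mult_def sum_2 he second_order_sym[OF H, of "coord_dir 2" "coord_dir 1"] algebra_simps)
  finally show "x \<bullet> (hessian f z *v x) \<le> 0" using second_order_local_max[OF H max, of ?h] by simp
qed

lemma matrix_vector_mult_2:
  fixes A :: "real^2^2"
  shows "A *v x = y \<longleftrightarrow> A $ 1 $ 1 * x $ 1 + A $ 1 $ 2 * x $ 2 = y $ 1 \<and> A $ 2 $ 1 * x $ 1 + A $ 2 $ 2 * x $ 2 = y $ 2"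
  by (simp add: vec_eq_iff forall_2 matrix_vector_mult_def sum_2)

text \<open>Semidefinite and invertible means definite. The eigenvalues are the roots of
  \<open>(p - \<mu>) (r - \<mu>) = q\<^sup>2\<close>; they are distinct with one-dimensional eigenspaces unless the matrix is
  scalar, when the only eigenspace is the plane.\<close>

lemma num_neg_eigenvalues_negative_definite:
  fixes A :: "real^2^2"
  assumes sym: "A $ 1 $ 2 = A $ 2 $ 1" and le: "\<And>x. x \<bullet> (A *v x) \<le> 0" and inv: "invertible A"
  shows "num_neg_eigenvalues A = 2"
proof -
  define p q r where "p = A $ 1 $ 1" and "q = A $ 1 $ 2" and "r = A $ 2 $ 2"
  have Av: "A *v x = y \<longleftrightarrow> p * x $ 1 + q * x $ 2 = y $ 1 \<and> q * x $ 1 + r * x $ 2 = y $ 2" for x y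
    unfolding matrix_vector_mult_2 p_def q_def r_def sym ..
  have det: "p * r - q\<^sup>2 \<noteq> 0"
    using inv unfolding invertible_det_nz det_2 p_def q_def r_def sym power2_eq_square by simp
  have form: "p * a\<^sup>2 + 2 * q * a * b + r * b\<^sup>2 \<le> 0" for a b
  proof -
    have "(vector [a, b] :: real^2) \<bullet> (A *v vector [a, b]) = p * a\<^sup>2 + 2 * q * a * b + r * b\<^sup>2"
      unfolding p_def q_def r_def
      by (simp add: inner_vec_def matrix_vector_mult_def sum_2 sym power2_eq_square algebra_simps)
    then show ?thesis using le[of "vector [a, b]"] by simp
  qed
  have p: "p \<le> 0" using form[of 1 0] by simp
  have r: "r \<le> 0" using form[of 0 1] by simp
  \<comment> \<open>Completing the square: the form at \<open>(q, - p)\<close> is \<open>p\<close> times the determinant.\<close>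
  have "p * (p * r - q\<^sup>2) \<le> 0"
    using form[of q "- p"] by (simp add: power2_eq_square algebra_simps)
  moreover have "p \<noteq> 0"
  proof
    assume "p = 0"
    then have "q \<noteq> 0" using det by simp
    have "2 * q * (1 - r) * q + r * q\<^sup>2 \<le> 0" using form[of "1 - r" q] \<open>p = 0\<close> by simp
    moreover have "2 * q * (1 - r) * q + r * q\<^sup>2 = q\<^sup>2 * (2 - r)" by (simp add: power2_eq_square algebra_simps)
    moreover have "q\<^sup>2 * (2 - r) > 0" using \<open>q \<noteq> 0\<close> r by (intro mult_pos_pos) auto
    ultimately show False by linarith
  qed
  ultimately have pos: "p * r - q\<^sup>2 > 0" and p: "p < 0"
    using p det by (auto simp: mult_le_0_iff)
  have "p * r > 0" using pos zero_le_power2[of q] by linarith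
  then have r: "r < 0" using p by (simp add: zero_less_mult_iff)
  have eig: "(\<exists>x. x \<noteq> 0 \<and> A *v x = \<mu> *\<^sub>R x) \<longleftrightarrow> (p - \<mu>) * (r - \<mu>) = q\<^sup>2" for \<mu>
  proof
    assume "\<exists>x. x \<noteq> 0 \<and> A *v x = \<mu> *\<^sub>R x"
    then obtain x :: "real^2" where x: "x \<noteq> 0" "p * x $ 1 + q * x $ 2 = \<mu> * x $ 1" "q * x $ 1 + r * x $ 2 = \<mu> * x $ 2"
      unfolding Av by auto
    have "((p - \<mu>) * (r - \<mu>) - q\<^sup>2) * x $ 1 = 0" "((p - \<mu>) * (r - \<mu>) - q\<^sup>2) * x $ 2 = 0"
      using x(2,3) by algebra+
    then show "(p - \<mu>) * (r - \<mu>) = q\<^sup>2" using x(1) by (auto simp: vec_eq_iff forall_2)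
  next
    assume e: "(p - \<mu>) * (r - \<mu>) = q\<^sup>2"
    show "\<exists>x. x \<noteq> 0 \<and> A *v x = \<mu> *\<^sub>R x"
    proof (cases "q = 0 \<and> p = \<mu>")
      case True
      then show ?thesis unfolding Av
        by (intro exI[of _ "vector [1, 0]"]) (auto simp: vec_eq_iff forall_2)
    next
      case False
      then show ?thesis unfolding Av using e
        by (intro exI[of _ "vector [q, \<mu> - p]"])
           (auto simp: vec_eq_iff forall_2 power2_eq_square algebra_simps)
    qed
  qed
  have dimE: "dim {x. A *v x = \<mu> *\<^sub>R x} = 1"
    if ex: "\<exists>x. x \<noteq> 0 \<and> A *v x = \<mu> *\<^sub>R x" and ns: "\<not> (q = 0 \<and> p = r)" for \<mu>
  proof -
    let ?E = "{x. A *v x = \<mu> *\<^sub>R x}"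
    have sub: "subspace ?E"
      by (auto simp: subspace_def matrix_vector_right_distrib matrix_vector_mult_scaleR scaleR_add_right)
    have "dim ?E \<noteq> 0" using ex by (auto simp: dim_eq_0)
    moreover have "dim ?E \<noteq> 2"
    proof
      assume "dim ?E = 2"
      then have "span ?E = UNIV" using dim_eq_full[of ?E] by simp
      then have "?E = UNIV" using sub by (metis span_eq_iff)
      then have "A *v vector [1, 0] = \<mu> *\<^sub>R vector [1, 0]" "A *v vector [0, 1] = \<mu> *\<^sub>R vector [0, 1]"
        by blast+
      then show False using ns unfolding Av by simp
    qed
    moreover have "dim ?E \<le> 2" using dim_subset_UNIV[of ?E] by simp
    ultimately show ?thesis by linarith
  qed
  show ?thesis
  proof (cases "q = 0 \<and> p = r")
    case True
    have "{\<mu>. \<mu> < 0 \<and> (\<exists>x. x \<noteq> 0 \<and> A *v x = \<mu> *\<^sub>R x)} = {p}"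
      unfolding eig using True p by auto
    moreover have "{x. A *v x = p *\<^sub>R x} = UNIV" unfolding Av using True by auto
    ultimately show ?thesis unfolding num_neg_eigenvalues_def by (simp add: dim_UNIV)
  next
    case False
    define d where "d = sqrt ((p - r)\<^sup>2 + 4 * q\<^sup>2)"
    have "(p - r)\<^sup>2 > 0 \<or> q\<^sup>2 > 0" using False by auto
    then have s: "(p - r)\<^sup>2 + 4 * q\<^sup>2 > 0"
      using zero_le_power2[of q] zero_le_power2[of "p - r"] by linarith
    have d: "d > 0" "d\<^sup>2 = (p - r)\<^sup>2 + 4 * q\<^sup>2"
      unfolding d_def using s by (simp_all only: real_sqrt_gt_zero real_sqrt_pow2 less_imp_le)
    have "d\<^sup>2 < (p + r)\<^sup>2" unfolding d(2) using pos by (simp add: power2_eq_square algebra_simps)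
    then have "d\<^sup>2 < (- (p + r))\<^sup>2" by (simp only: power2_minus)
    then have "d < - (p + r)" by (rule power2_less_imp_less) (use p r in linarith)
    then have neg: "(p + r + d) / 2 < 0" "(p + r - d) / 2 < 0" using d(1) by simp_all
    have roots: "(p - \<mu>) * (r - \<mu>) = q\<^sup>2 \<longleftrightarrow> \<mu> = (p + r + d) / 2 \<or> \<mu> = (p + r - d) / 2" for \<mu>
    proof -
      have "(p - \<mu>) * (r - \<mu>) = q\<^sup>2 \<longleftrightarrow> (2 * \<mu> - (p + r))\<^sup>2 = d\<^sup>2"
      proof -
        have "(2 * \<mu> - (p + r))\<^sup>2 - d\<^sup>2 = 4 * ((p - \<mu>) * (r - \<mu>) - q\<^sup>2)"
          unfolding d(2) by (simp add: power2_eq_square algebra_simps)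
        then show ?thesis by auto
      qed
      also have "\<dots> \<longleftrightarrow> 2 * \<mu> - (p + r) = d \<or> 2 * \<mu> - (p + r) = - d" by (rule power2_eq_iff)
      finally show ?thesis by auto
    qed
    have set: "{\<mu>. \<mu> < 0 \<and> (\<exists>x. x \<noteq> 0 \<and> A *v x = \<mu> *\<^sub>R x)} = {(p + r + d) / 2, (p + r - d) / 2}"
      unfolding eig roots using neg by auto
    have "dim {x. A *v x = \<mu> *\<^sub>R x} = 1" if "\<mu> \<in> {(p + r + d) / 2, (p + r - d) / 2}" for \<mu>
      using dimE[OF _ False] that unfolding set[symmetric] by blast
    then have "num_neg_eigenvalues A = card {(p + r + d) / 2, (p + r - d) / 2}"
      unfolding num_neg_eigenvalues_def set by simp
    also have "\<dots> = 2" using d by simp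
    finally show ?thesis .
  qed
qed

text \<open>A nonnegative function vanishing at \<open>z\<close> has derivative \<open>0\<close> there, so every term of the product
  rule for second derivatives vanishes.\<close>

lemma hessian_product_of_double_zeros:
  assumes f: "twice_diff f z" "f z = 0" "\<And>w. 0 \<le> f w" and g: "twice_diff g z" "g z = 0" "\<And>w. 0 \<le> g w"
  shows "hessian (\<lambda>w. f w * g w) z = 0"
proof -
  obtain D H D' H' where F: "second_order f D H z" and G: "second_order g D' H' z"
    using f g unfolding twice_diff_def by blast
  have "D z = (\<lambda>_. 0)" by (rule has_derivative_local_min[OF second_order_at[OF F]]) (use f in simp)
  moreover have "D' z = (\<lambda>_. 0)" by (rule has_derivative_local_min[OF second_order_at[OF G]]) (use g in simp)
  ultimately show ?thesis
    unfolding vec_eq_iff hessian_second_order[OF second_order_mult[OF F G]] using f g by simp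
qed

context factored_section
begin

lemma twice_diff_norm_lift:
  assumes "\<sigma> = (\<lambda>z. (fst A + z * fst E, snd A + z * snd E))"
  shows "twice_diff (\<lambda>w. (norm (\<sigma> w))\<^sup>2) z"
  unfolding norm_pair_sq assms fst_conv snd_conv by (intro twice_diff_add twice_diff_norm_affine)

lemma twice_diff_hdet:
  assumes "\<sigma> = (\<lambda>z. (fst A + z * fst E, snd A + z * snd E))"
  shows "twice_diff (\<lambda>w. (cmod (hdet (\<sigma> w) V))\<^sup>2) z"
proof -
  have "(\<lambda>w. (cmod (hdet (\<sigma> w) V))\<^sup>2) = (\<lambda>w. (cmod (hdet A V + w * hdet E V))\<^sup>2)"
    unfolding assms by (simp add: hdet_def algebra_simps)
  then show ?thesis by (simp add: twice_diff_norm_affine)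
qed

lemma section_normsq_lift:
  assumes "\<And>z. \<sigma> z \<noteq> 0"
  shows "section_normsq n s (proj (\<sigma> w)) =
     (cmod \<kappa>)\<^sup>2 * (\<Prod>i<n. (cmod (hdet (\<sigma> w) (W i)))\<^sup>2) * (\<Prod>i<n. inverse ((norm (\<sigma> w))\<^sup>2))"
proof -
  have "(cmod (s (\<sigma> w)))\<^sup>2 = (cmod \<kappa>)\<^sup>2 * (\<Prod>i<n. (cmod (hdet (\<sigma> w) (W i)))\<^sup>2)"
    unfolding s_eq by (simp add: norm_mult power_mult_distrib prod_norm[symmetric] prod_power_distrib)
  then show ?thesis
    unfolding section_normsq_proj[OF s_hol assms] fibre_normsq_def norm_pair_sq[symmetric]
    by (simp add: divide_inverse power_inverse)
qed

lemma twice_diff_section_normsq: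
  assumes "\<sigma> \<in> affine_lifts"
  shows "twice_diff (\<lambda>w. section_normsq n s (proj (\<sigma> w))) z"
proof -
  obtain A E where AE: "\<sigma> = (\<lambda>z. (fst A + z * fst E, snd A + z * snd E))" "\<And>z. \<sigma> z \<noteq> 0"
    using affine_lift_cases[OF assms] by metis
  show ?thesis
    unfolding section_normsq_lift[of \<sigma>, OF AE(2)]
    by (intro twice_diff_mult twice_diff_const twice_diff_prod twice_diff_inverse
        twice_diff_hdet[OF AE(1)] twice_diff_norm_lift[OF AE(1)]) (use AE(2) in simp)
qed

lemma section_normsq_pos: "x \<notin> zeroes s \<Longrightarrow> section_normsq n s x > 0"
proof -
  assume x: "x \<notin> zeroes s"
  obtain Z where Z: "Z \<noteq> 0" "x = proj Z" by (rule cp1_cases)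
  then have "s Z \<noteq> 0" using section_zero_iff x by blast
  then show ?thesis
    unfolding Z(2) section_normsq_proj[OF s_hol Z(1)] fibre_normsq_def norm_pair_sq[symmetric] using Z by simp
qed

lemma index_at_global_max:
  assumes x: "x \<notin> zeroes s" and max: "\<And>y. section_normsq n s y \<le> section_normsq n s x"
    and nd: "nondegenerate_at (log_normsq n s) x"
  shows "has_index n s x 2"
  unfolding has_index_def has_hessian_index_def
proof (intro conjI ballI allI impI x)
  fix \<sigma> z assume sg: "\<sigma> \<in> affine_lifts" and pz: "proj (\<sigma> z) = x"
  let ?u = "\<lambda>w. section_normsq n s (proj (\<sigma> w))"
  have tu: "twice_diff ?u z" by (rule twice_diff_section_normsq[OF sg])
  have uz: "?u z > 0" using section_normsq_pos[OF x] pz by simp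
  have t: "twice_diff (\<lambda>w. ln (?u w)) z" by (rule twice_diff_ln[OF tu uz])
  have "isCont ?u z"
    using tu second_order_at has_derivative_continuous unfolding twice_diff_def by blast
  then have "(?u \<longlongrightarrow> ?u z) (nhds z)" unfolding isCont_def tendsto_at_iff_tendsto_nhds[of ?u z] .
  then have "\<forall>\<^sub>F w in nhds z. ?u w > 0" using uz by (rule order_tendstoD(1))
  then have "\<forall>\<^sub>F w in nhds z. ln (?u w) \<le> ln (?u z)"
    by eventually_elim (use max pz in \<open>auto intro!: ln_mono\<close>)
  note M = hessian_local_max[OF t this]
  have "invertible (hessian (\<lambda>w. ln (?u w)) z)"
    using nd sg pz unfolding nondegenerate_at_def log_normsq_def by blast
  then show "num_neg_eigenvalues (hessian (\<lambda>w. log_normsq n s (proj (\<sigma> w))) z) = 2"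
    unfolding log_normsq_def by (intro num_neg_eigenvalues_negative_definite M)
qed

text \<open>Let one of the two proportional linear forms be the first factor and let the second be part of the
  other one: both factors have a double zero.\<close>

lemma double_zero_point_degenerate:
  assumes ij: "i < n" "j < n" "i \<noteq> j" "zero_point i = zero_point j"
  shows "real_critical_point (section_normsq n s) (zero_point i)"
    and "\<not> nondegenerate_at (section_normsq n s) (zero_point i)"
proof -
  have chart: "((\<lambda>w. section_normsq n s (proj (\<sigma> w))) has_derivative (\<lambda>_. 0)) (at z) \<and>
      hessian (\<lambda>w. section_normsq n s (proj (\<sigma> w))) z = 0"
    if sg: "\<sigma> \<in> affine_lifts" and pz: "proj (\<sigma> z) = zero_point i" for \<sigma> z
  proof -
    obtain A E where AE: "\<sigma> = (\<lambda>z. (fst A + z * fst E, snd A + z * snd E))" "\<And>z. \<sigma> z \<noteq> 0"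
      using affine_lift_cases[OF sg] by metis
    let ?f = "\<lambda>w. (cmod (hdet (\<sigma> w) (W i)))\<^sup>2"
    let ?g = "\<lambda>w. (cmod \<kappa>)\<^sup>2 * (\<Prod>k\<in>{..<n} - {i}. (cmod (hdet (\<sigma> w) (W k)))\<^sup>2)
       * (\<Prod>k<n. inverse ((norm (\<sigma> w))\<^sup>2))"
    let ?u = "\<lambda>w. section_normsq n s (proj (\<sigma> w))"
    have u: "?u = (\<lambda>w. ?f w * ?g w)"
      unfolding section_normsq_lift[of \<sigma>, OF AE(2)] using ij(1) by (simp add: prod.remove[of "{..<n}" i] fun_eq_iff)
    have f: "twice_diff ?f z" "?f z = 0" "0 \<le> ?f w" for w
      using twice_diff_hdet[OF AE(1)] hdet_zero_iff[OF AE(2)] pz by auto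
    have "hdet (\<sigma> z) (W j) = 0" using hdet_zero_iff[OF AE(2)] pz ij by simp
    then have "(\<Prod>k\<in>{..<n} - {i}. (cmod (hdet (\<sigma> z) (W k)))\<^sup>2) = 0"
      using ij by (intro prod_zero) auto
    then have g: "?g z = 0" by simp
    have g2: "twice_diff ?g z"
      by (intro twice_diff_mult twice_diff_const twice_diff_prod twice_diff_inverse
        twice_diff_hdet[OF AE(1)] twice_diff_norm_lift[OF AE(1)]) (use AE(2) in simp)
    have g3: "0 \<le> ?g w" for w by (intro mult_nonneg_nonneg prod_nonneg) auto
    have "hessian ?u z = 0"
      unfolding u by (rule hessian_product_of_double_zeros) (use f g g2 g3 in blast)+
    moreover obtain D H where H: "second_order ?u D H z"
      using twice_diff_section_normsq[OF sg] unfolding twice_diff_def by blast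
    have nn: "0 \<le> ?u w" for w unfolding section_normsq_def fibre_normsq_def by simp
    have u0: "?u z = 0" using fun_cong[OF u, of z] g by simp
    have "D z = (\<lambda>_. 0)"
      by (rule has_derivative_local_min[OF second_order_at[OF H]]) (unfold u0, simp add: nn)
    then have "(?u has_derivative (\<lambda>_. 0)) (at z)" using second_order_at[OF H] by simp
    ultimately show ?thesis by blast
  qed
  show "real_critical_point (section_normsq n s) (zero_point i)"
    unfolding real_critical_point_def using chart by blast
  obtain \<sigma> z where sg: "\<sigma> \<in> affine_lifts" "proj (\<sigma> z) = zero_point i" by (rule affine_lift_exists)
  have "\<not> invertible (0 :: real^2^2)" by (simp add: invertible_det_nz det_2)
  then show "\<not> nondegenerate_at (section_normsq n s) (zero_point i)"
    unfolding nondegenerate_at_def using chart[OF sg] sg by metis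
qed

end

section \<open>Basins of attraction and balanced points\<close>

text \<open>A discrete form of a mountain pass principle. With \<open>G\<close> as a Lyapunov function every orbit enters each
  sublevel set \<open>G < \<epsilon>\<close>. For small \<open>\<epsilon>\<close> this set splits into a part near one point \<open>a\<close> of \<open>V\<close> and a
  part near the others, both forward invariant, and the points whose orbits enter one part or the other form
  a separation of \<open>S\<close>.\<close>

lemma connected_basins_of_attraction:
  fixes S :: "'a::euclidean_space set" and F :: "'a \<Rightarrow> 'a" and G :: "'a \<Rightarrow> real"
  assumes S: "compact S" "connected S" and F: "continuous_on S F" "F ` S \<subseteq> S"
    and G: "continuous_on S G" and V: "finite V" "V \<subseteq> S"
    and fix_V: "\<And>x. x \<in> V \<Longrightarrow> F x = x"
    and pos: "\<And>x. x \<in> S \<Longrightarrow> 0 \<le> G x" "\<And>x. x \<in> S \<Longrightarrow> G x = 0 \<longleftrightarrow> x \<in> V"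
    and decr: "\<And>x. x \<in> S - V \<Longrightarrow> G (F x) < G x"
  shows "\<exists>a. V \<subseteq> {a}"
proof (rule ccontr)
  assume neg: "\<nexists>a. V \<subseteq> {a}"
  then obtain a where a: "a \<in> V" by blast
  then obtain b where b: "b \<in> V" "b \<noteq> a" using neg by blast
  have "closed {a}" "closed (V - {a})" "{a} \<inter> (V - {a}) = {}"
    using V by (auto intro: finite_imp_closed)
  then obtain U1 U2 where U: "open U1" "open U2" "{a} \<subseteq> U1" "V - {a} \<subseteq> U2" "U1 \<inter> U2 = {}"
    using separation_normal by metis
  have FS: "F x \<in> S" if "x \<in> S" for x using F(2) that by blast
  have FkS: "(F ^^ k) x \<in> S" if "x \<in> S" for k x using that by (induction k) (auto simp: FS)
  have Fk: "continuous_on S (F ^^ k)" for k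
  proof (induction k)
    case (Suc k)
    have "continuous_on S (F \<circ> (F ^^ k))"
      using Suc by (rule continuous_on_compose) (rule continuous_on_subset[OF F(1)], use FkS in blast)
    then show ?case by simp
  qed (simp add: continuous_on_id id_def)
  \<comment> \<open>Points of \<open>U\<close> that stay in \<open>U\<close> for one step; outside \<open>O' U1\<close> and \<open>O' U2\<close> the function \<open>G\<close> has a positive lower bound.\<close>
  define O' where "O' U = S \<inter> F -` U \<inter> (S \<inter> U)" for U
  have opO: "openin (top_of_set S) (O' U)" if "open U" for U
    unfolding O'_def using that F(1)
    by (intro openin_Int continuous_openin_preimage_gen openin_open_Int)
  let ?R = "S - (O' U1 \<union> O' U2)"
  have "closedin (top_of_set S) ?R"
    using opO[OF U(1)] opO[OF U(2)] by (intro closedin_diff openin_Un) auto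
  then have R: "compact ?R" by (rule closedin_compact[OF S(1)])
  have VO: "V \<subseteq> O' U1 \<union> O' U2" unfolding O'_def using U V fix_V by auto
  obtain \<epsilon> where e: "\<epsilon> > 0" "\<And>x. x \<in> ?R \<Longrightarrow> \<epsilon> \<le> G x"
  proof (cases "?R = {}")
    case True
    then show ?thesis using that[of 1] by auto
  next
    case False
    obtain m where m: "m \<in> ?R" "\<And>x. x \<in> ?R \<Longrightarrow> G m \<le> G x"
      using continuous_attains_inf[OF R False continuous_on_subset[OF G]] by blast
    have "G m \<noteq> 0" using m(1) VO pos(2)[of m] by blast
    moreover have "0 \<le> G m" using m(1) by (intro pos(1)) auto
    ultimately show ?thesis using that[of "G m"] m by simp
  qed
  have dec: "G (F x) \<le> G x" if "x \<in> S" for x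
    using decr[of x] fix_V[of x] that by (cases "x \<in> V") auto
  define N where "N U = O' U \<inter> (S \<inter> G -` {..<\<epsilon>})" for U
  have opN: "openin (top_of_set S) (N U)" if "open U" for U
    unfolding N_def using opO[OF that] G
    by (intro openin_Int continuous_openin_preimage_gen) auto
  have N: "F x \<in> N U1" if "x \<in> N U1" for x
  proof -
    have "x \<in> S" "F x \<in> S" "F x \<in> U1" "G (F x) < \<epsilon>"
      using that FS[of x] dec[of x] unfolding N_def O'_def by auto
    then show ?thesis using e(2)[of "F x"] U(5) unfolding N_def O'_def by force
  qed
  have N2: "F x \<in> N U2" if "x \<in> N U2" for x
  proof -
    have "x \<in> S" "F x \<in> S" "F x \<in> U2" "G (F x) < \<epsilon>"
      using that FS[of x] dec[of x] unfolding N_def O'_def by auto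
    then show ?thesis using e(2)[of "F x"] U(5) unfolding N_def O'_def by force
  qed
  have inv1: "(F ^^ m) x \<in> N U1" if "x \<in> N U1" for m x using that by (induction m) (auto simp: N)
  have inv2: "(F ^^ m) x \<in> N U2" if "x \<in> N U2" for m x using that by (induction m) (auto simp: N2)
  define B where "B U = (\<Union>k. S \<inter> (F ^^ k) -` N U)" for U
  have opB: "openin (top_of_set S) (B U)" if "open U" for U
    unfolding B_def
  proof (intro openin_Union ballI)
    fix X assume "X \<in> range (\<lambda>k. S \<inter> (F ^^ k) -` N U)"
    then obtain k where X: "X = S \<inter> (F ^^ k) -` N U" by blast
    show "openin (top_of_set S) X"
      unfolding X by (rule continuous_openin_preimage[OF Fk _ opN[OF that]]) (use FkS in auto)
  qed
  have disj: "B U1 \<inter> B U2 = {}"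
  proof (rule ccontr)
    assume "B U1 \<inter> B U2 \<noteq> {}"
    then obtain x k m where x: "(F ^^ k) x \<in> N U1" "(F ^^ m) x \<in> N U2" unfolding B_def by blast
    have "(F ^^ (m + k)) x \<in> N U1" using inv1[OF x(1), of m] by (simp add: funpow_add)
    moreover have "(F ^^ (k + m)) x \<in> N U2" using inv2[OF x(2), of k] by (simp add: funpow_add)
    ultimately show False using U(5) unfolding N_def O'_def by (auto simp: add.commute)
  qed
  have cover: "S \<subseteq> B U1 \<union> B U2"
  proof
    fix x assume x: "x \<in> S"
    have "\<exists>k. G ((F ^^ k) x) < \<epsilon>"
    proof (rule ccontr)
      assume "\<nexists>k. G ((F ^^ k) x) < \<epsilon>"
      then have big: "\<epsilon> \<le> G ((F ^^ k) x)" for k by (meson not_le)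
      \<comment> \<open>On this compact set \<open>G\<close> drops by at least some \<open>\<delta> > 0\<close> in each step, so no orbit remains in it.\<close>
      let ?T = "S \<inter> G -` {\<epsilon>..}"
      have T: "compact ?T"
        using continuous_closedin_preimage[OF G, of "{\<epsilon>..}"] closedin_compact[OF S(1)] by auto
      have xT: "(F ^^ k) x \<in> ?T" for k using big FkS[OF x] by auto
      then have T0: "?T \<noteq> {}" by blast
      have "continuous_on S (\<lambda>y. G y - G (F y))"
        using G continuous_on_compose2[OF G F] by (intro continuous_on_diff)
      then have "continuous_on ?T (\<lambda>y. G y - G (F y))" by (rule continuous_on_subset) auto
      then obtain m where m: "m \<in> ?T" "\<And>y. y \<in> ?T \<Longrightarrow> G m - G (F m) \<le> G y - G (F y)"
        using continuous_attains_inf[OF T T0] by blast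
      define \<delta> where "\<delta> = G m - G (F m)"
      have "m \<notin> V" using m(1) e(1) pos(2)[of m] by auto
      then have d: "\<delta> > 0" using decr[of m] m(1) unfolding \<delta>_def by auto
      have "G ((F ^^ k) x) \<le> G x - k * \<delta>" for k
      proof (induction k)
        case (Suc k)
        have "\<delta> \<le> G ((F ^^ k) x) - G (F ((F ^^ k) x))" unfolding \<delta>_def by (rule m(2)[OF xT])
        then show ?case using Suc by (simp add: algebra_simps)
      qed simp
      moreover obtain k :: nat where "G x < k * \<delta>"
        using reals_Archimedean3[OF d] by blast
      ultimately have "G ((F ^^ k) x) < 0" by (smt (verit))
      then show False using big[of k] e(1) by linarith
    qed
    then obtain k where k: "G ((F ^^ k) x) < \<epsilon>" by blast
    have "(F ^^ k) x \<in> N U1 \<union> N U2"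
      using k e(2)[of "(F ^^ k) x"] FkS[OF x, of k] unfolding N_def by force
    then show "x \<in> B U1 \<union> B U2" unfolding B_def using x by blast
  qed
  have "a \<in> N U1" using a U fix_V V pos(2)[of a] e(1) unfolding N_def O'_def by auto
  then have "a \<in> B U1" unfolding B_def using a V by (auto intro!: exI[of _ 0])
  moreover have "b \<in> N U2" using b U fix_V V pos(2)[of b] e(1) unfolding N_def O'_def by auto
  then have "b \<in> B U2" unfolding B_def using b V by (auto intro!: exI[of _ 0])
  ultimately show False
    using S(2) opB[OF U(1)] opB[OF U(2)] disj cover unfolding connected_openin by blast
qed

text \<open>Multiplying by \<open>G x\<close> clears the denominators of the balance vector, which gives the extension \<open>M\<close>
  across \<open>V\<close>. The pairing with \<open>c\<close> shows that \<open>M\<close> has no zeroes. The decrease of \<open>G\<close> along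
  \<open>F = M / |M|\<close> is the concavity of the logarithm in the form \<open>r \<le> exp (r - 1)\<close>.\<close>

lemma exists_balanced_point:
  fixes V :: "'a::euclidean_space set"
  assumes V: "finite V" "V \<subseteq> sphere 0 1" and dim: "2 \<le> DIM('a)"
    and c: "\<And>v. v \<in> V \<Longrightarrow> v \<bullet> c > 0" and two: "\<nexists>a. V \<subseteq> {a}"
  obtains x r where "norm x = 1" "x \<notin> V" "r > 0" "(\<Sum>v\<in>V. (1 / (1 - x \<bullet> v)) *\<^sub>R v) = r *\<^sub>R x"
proof -
  let ?S = "sphere (0::'a) 1"
  define G where "G x = (\<Prod>v\<in>V. 1 - x \<bullet> v)" for x
  define M where "M x = (\<Sum>v\<in>V. (\<Prod>u\<in>V - {v}. 1 - x \<bullet> u) *\<^sub>R v)" for x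
  define F where "F x = (1 / norm (M x)) *\<^sub>R M x" for x
  have nV: "norm v = 1" if "v \<in> V" for v using V that by auto
  have ge: "1 - x \<bullet> v \<ge> 0" if "x \<in> ?S" "v \<in> V" for x v
    using norm_cauchy_schwarz[of x v] nV[OF that(2)] that(1) by simp
  have eq: "1 - x \<bullet> v = 0 \<longleftrightarrow> x = v" if "x \<in> ?S" "v \<in> V" for x v
    using unit_inner_one[of x v] nV[OF that(2)] that(1) by (auto simp: norm_eq_1)
  have gt: "1 - x \<bullet> v > 0" if "x \<in> ?S" "v \<in> V" "x \<noteq> v" for x v
    using ge[OF that(1,2)] eq[OF that(1,2)] that(3) by linarith
  have M_V: "M x = (\<Prod>u\<in>V - {x}. 1 - x \<bullet> u) *\<^sub>R x" if "x \<in> V" for x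
  proof -
    have "M x = (\<Sum>v\<in>V. if v = x then (\<Prod>u\<in>V - {x}. 1 - x \<bullet> u) *\<^sub>R x else 0)"
      unfolding M_def
    proof (rule sum.cong)
      fix v assume "v \<in> V"
      show "(\<Prod>u\<in>V - {v}. 1 - x \<bullet> u) *\<^sub>R v = (if v = x then (\<Prod>u\<in>V - {x}. 1 - x \<bullet> u) *\<^sub>R x else 0)"
      proof (cases "v = x")
        case False
        then have "(\<Prod>u\<in>V - {v}. 1 - x \<bullet> u) = 0"
          using that nV[OF that] V by (intro prod_zero) (auto simp: norm_eq_1)
        then show ?thesis using False by simp
      qed simp
    qed simp
    then show ?thesis using V that by simp
  qed
  have M_not_V: "M x = G x *\<^sub>R (\<Sum>v\<in>V. (1 / (1 - x \<bullet> v)) *\<^sub>R v)" if "x \<in> ?S" "x \<notin> V" for x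
    unfolding M_def scaleR_sum_right G_def
  proof (rule sum.cong)
    fix v assume v: "v \<in> V"
    then have "1 - x \<bullet> v \<noteq> 0" using gt[of x v] that by force
    then show "(\<Prod>u\<in>V - {v}. 1 - x \<bullet> u) *\<^sub>R v
        = (\<Prod>u\<in>V. 1 - x \<bullet> u) *\<^sub>R (1 / (1 - x \<bullet> v)) *\<^sub>R v"
      using v V by (simp add: prod.remove[of V v])
  qed simp
  have Mc: "M x \<bullet> c > 0" if x: "x \<in> ?S" for x
  proof (cases "x \<in> V")
    case True
    have "(\<Prod>u\<in>V - {x}. 1 - x \<bullet> u) > 0" using gt[OF x] by (intro prod_pos) auto
    then show ?thesis unfolding M_V[OF True] using c[OF True] by simp
  next
    case False
    have "G x > 0" unfolding G_def using gt[OF x] False by (intro prod_pos) auto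
    moreover have "(\<Sum>v\<in>V. (1 / (1 - x \<bullet> v)) *\<^sub>R v) \<bullet> c > 0"
      unfolding inner_sum_left
    proof (rule sum_pos[OF V(1)])
      show "V \<noteq> {}" using two by blast
      fix v assume v: "v \<in> V"
      then have "x \<noteq> v" using False by blast
      then show "((1 / (1 - x \<bullet> v)) *\<^sub>R v) \<bullet> c > 0" using gt[OF x v] c[OF v] by simp
    qed
    ultimately show ?thesis unfolding M_not_V[OF x False] by simp
  qed
  have M0: "M x \<noteq> 0" if "x \<in> ?S" for x using Mc[OF that] by auto
  have Fx: "F x = x" if "x \<in> V" for x
  proof -
    have "x \<in> ?S" using that V by blast
    then have "(\<Prod>u\<in>V - {x}. 1 - x \<bullet> u) > 0" using gt[of x] by (intro prod_pos) auto
    then show ?thesis unfolding F_def M_V[OF that] using nV[OF that] by simp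
  qed
  have "\<exists>x \<in> ?S - V. F x = x"
  proof (rule ccontr)
    assume nofix: "\<not> (\<exists>x \<in> ?S - V. F x = x)"
    have "\<exists>a. V \<subseteq> {a}"
    proof (rule connected_basins_of_attraction[of ?S F G V])
      show "connected ?S" using dim by (rule connected_sphere)
      show "continuous_on ?S F" unfolding F_def M_def
        by (intro continuous_intros) (use M0 in \<open>auto simp: M_def\<close>)
      show "continuous_on ?S G" unfolding G_def by (intro continuous_intros)
      show "F ` ?S \<subseteq> ?S" unfolding F_def using M0 by auto
      fix x assume x: "x \<in> ?S"
      show "0 \<le> G x" unfolding G_def using ge[OF x] by (intro prod_nonneg) auto
      show "G x = 0 \<longleftrightarrow> x \<in> V" unfolding G_def using V eq[OF x] by auto
    next
      fix x assume xSV: "x \<in> ?S - V"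
      then have x: "x \<in> ?S" and xV: "x \<notin> V" by auto
      let ?w = "\<Sum>v\<in>V. (1 / (1 - x \<bullet> v)) *\<^sub>R v" and ?y = "F x"
      have pos: "1 - x \<bullet> v > 0" if "v \<in> V" for v using gt[OF x that] xV that by blast
      have Gx: "G x > 0" unfolding G_def using pos by (intro prod_pos) auto
      have y: "?y \<in> ?S" unfolding F_def using M0[OF x] by simp
      have w0: "?w \<noteq> 0" using M0[OF x] unfolding M_not_V[OF x xV] by auto
      have yw: "?w = norm ?w *\<^sub>R ?y"
        unfolding F_def M_not_V[OF x xV] using Gx w0 by simp
      have "x \<bullet> ?y \<noteq> 1" using unit_inner_one[of x ?y] x y nofix xSV by auto
      moreover have "x \<bullet> ?y \<le> 1" using norm_cauchy_schwarz[of x ?y] x y by simp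
      ultimately have "x \<bullet> ?y < 1" by simp
      then have "norm ?w * (x \<bullet> ?y) < norm ?w * 1" using w0 by (intro mult_strict_left_mono) auto
      moreover have "x \<bullet> ?w = norm ?w * (x \<bullet> ?y)" by (subst yw) (rule inner_scaleR_right)
      moreover have "?y \<bullet> ?w = norm ?w" using y by (subst yw) (simp add: norm_eq_1)
      ultimately have neg: "(x - ?y) \<bullet> ?w < 0" unfolding inner_diff_left by linarith
      \<comment> \<open>The factors by which the product changes; their excess over \<open>1\<close> sums to \<open>(x - y) \<bullet> w < 0\<close>.\<close>
      let ?r = "\<lambda>v. (1 - ?y \<bullet> v) / (1 - x \<bullet> v)"
      have "G ?y = G x * (\<Prod>v\<in>V. ?r v)"
        unfolding G_def prod.distrib[symmetric] by (rule prod.cong) (use pos in force)+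
      also have "(\<Prod>v\<in>V. ?r v) \<le> (\<Prod>v\<in>V. exp (?r v - 1))"
      proof (rule prod_mono)
        fix v assume v: "v \<in> V"
        have "0 \<le> ?r v" using ge[OF y v] pos[OF v] by (intro divide_nonneg_pos)
        moreover have "?r v \<le> exp (?r v - 1)" using exp_ge_add_one_self[of "?r v - 1"] by simp
        ultimately show "0 \<le> ?r v \<and> ?r v \<le> exp (?r v - 1)" by blast
      qed
      also have "(\<Prod>v\<in>V. exp (?r v - 1)) = exp (\<Sum>v\<in>V. ?r v - 1)"
        using V by (simp add: exp_sum)
      also have "(\<Sum>v\<in>V. ?r v - 1) = (x - ?y) \<bullet> ?w"
        unfolding inner_sum_right
      proof (rule sum.cong)
        fix v assume v: "v \<in> V"
        show "?r v - 1 = (x - ?y) \<bullet> ((1 / (1 - x \<bullet> v)) *\<^sub>R v)"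
          using pos[OF v] by (simp add: inner_diff_left field_simps)
      qed simp
      also have "exp ((x - ?y) \<bullet> ?w) < 1" using neg by simp
      finally show "G ?y < G x" using Gx by simp
    qed (use V Fx in auto)
    then show False using two by blast
  qed
  then obtain x where x: "x \<in> ?S" "x \<notin> V" "F x = x" by blast
  let ?w = "\<Sum>v\<in>V. (1 / (1 - x \<bullet> v)) *\<^sub>R v"
  have Gx: "G x > 0" unfolding G_def using gt[OF x(1)] x(2) by (intro prod_pos) auto
  have "?w = (1 / G x) *\<^sub>R M x" unfolding M_not_V[OF x(1,2)] using Gx by simp
  also have "M x = norm (M x) *\<^sub>R F x" unfolding F_def using M0[OF x(1)] by simp
  finally have "?w = (1 / G x * norm (M x)) *\<^sub>R x" unfolding x(3) by simp
  moreover have "1 / G x * norm (M x) > 0" using Gx M0[OF x(1)] by simp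
  ultimately show ?thesis using that x by auto
qed

section \<open>Critical points of a section with zeroes in a hemisphere\<close>

locale hemispherical_section = factored_section +
  fixes c :: cp1
  assumes n_pos: "0 < n" and hemisphere: "\<And>i. i < n \<Longrightarrow> v i \<bullet> bloch c > 0"
begin

definition hull_of_zeroes :: "cp1 set" where
  "hull_of_zeroes = geodesically_convex hull (zeroes s)"

lemma zeroes_hemisphere: "z \<in> zeroes s \<Longrightarrow> bloch z \<bullet> bloch c > 0"
  unfolding zeroes_eq using hemisphere by auto

lemma hull_of_zeroes_eq: "hull_of_zeroes = {x. bloch x \<in> convex_cone hull (v ` {..<n})}"
  unfolding hull_of_zeroes_def using geodesically_convex_hull_eq_cone[of "zeroes s" "bloch c"] zeroes_hemisphere
  by (simp add: zeroes_eq image_image)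

lemma hull_of_zeroes_hemisphere: "x \<in> hull_of_zeroes \<Longrightarrow> bloch x \<bullet> bloch c > 0"
  unfolding hull_of_zeroes_eq mem_Collect_eq
  by (rule convex_cone_hull_halfspace[OF _ _ bloch_nonzero]) (use hemisphere in auto)

lemma zeroes_subset_hull: "zeroes s \<subseteq> hull_of_zeroes"
  unfolding hull_of_zeroes_def by (rule hull_subset)

lemma factor_pos:
  assumes "x \<notin> zeroes s" "i < n"
  shows "1 - bloch x \<bullet> v i > 0"
proof -
  have "x \<noteq> zero_point i" using assms unfolding zeroes_eq by auto
  then have "bloch x \<bullet> v i \<noteq> 1"
    using unit_inner_one[of "bloch x" "v i"] by (auto simp: bloch_eq_iff)
  moreover have "bloch x \<bullet> v i \<le> 1" using norm_cauchy_schwarz[of "bloch x" "v i"] by simp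
  ultimately show ?thesis by linarith
qed

lemma balance_in_cone:
  assumes "x \<notin> zeroes s"
  shows "balance (bloch x) \<in> convex_cone hull (v ` {..<n})"
proof -
  let ?K = "convex_cone hull (v ` {..<n})"
  have K: "convex_cone ?K" by (rule convex_cone_convex_cone_hull)
  have t: "(1 / (1 - bloch x \<bullet> v i)) *\<^sub>R v i \<in> ?K" if "i < n" for i
    using factor_pos[OF assms that] that by (intro convex_cone_scaleR[OF K] hull_inc) auto
  have "(\<Sum>i\<in>I. (1 / (1 - bloch x \<bullet> v i)) *\<^sub>R v i) \<in> ?K" if "finite I" "I \<subseteq> {..<n}" for I
    using that
    by (induction I rule: finite_induct) (auto simp: convex_cone_contains_0[OF K] intro!: convex_cone_add[OF K] t)
  then show ?thesis unfolding balance_def by blast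
qed

lemma balance_inner_sum: "h \<bullet> balance y = (\<Sum>i<n. (h \<bullet> v i) / (1 - y \<bullet> v i))"
  unfolding balance_def inner_sum_right by simp

lemma balance_hemisphere:
  assumes "x \<notin> zeroes s"
  shows "balance (bloch x) \<bullet> bloch c > 0"
  unfolding inner_commute[of "balance (bloch x)"] balance_inner_sum
  using factor_pos[OF assms] hemisphere n_pos
  by (intro sum_pos) (auto simp: inner_commute[of "bloch c"])

text \<open>A sum of nonnegative terms with positive coefficients vanishes only if all terms do.\<close>

lemma balance_relative_interior:
  assumes "x \<notin> zeroes s" "\<And>i. i < n \<Longrightarrow> h \<bullet> v i \<ge> 0" "h \<bullet> balance (bloch x) = 0" "i < n"
  shows "h \<bullet> v i = 0"
proof -
  have pos: "1 - bloch x \<bullet> v j > 0" if "j < n" for j by (rule factor_pos[OF assms(1) that])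
  have "\<forall>j\<in>{..<n}. (h \<bullet> v j) / (1 - bloch x \<bullet> v j) = 0"
    using assms(3) unfolding balance_inner_sum
    by (subst (asm) sum_nonneg_eq_0_iff) (use assms(2) pos in \<open>auto intro!: divide_nonneg_pos\<close>)
  then show ?thesis using pos[of i] assms(4) by auto
qed

text \<open>The sign of the multiplier is determined by the side of the bounding plane of the hemisphere on which \<open>x\<close> lies.\<close>

lemma critical_multiplier:
  assumes "x \<in> critical_points n s" "x \<notin> zeroes s"
  obtains \<mu> where "balance (bloch x) = \<mu> *\<^sub>R bloch x" "\<mu> * (bloch x \<bullet> bloch c) > 0"
proof -
  have e: "balance (bloch x) = (balance (bloch x) \<bullet> bloch x) *\<^sub>R bloch x"
    using assms critical_iff_balance by blast
  have "(balance (bloch x) \<bullet> bloch x) * (bloch x \<bullet> bloch c) > 0"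
    using balance_hemisphere[OF assms(2)] by (subst (asm) e) simp
  then show ?thesis using that e by blast
qed

text \<open>Stated with a second point \<open>y\<close>, since it is used both for \<open>y = x\<close> and for \<open>y\<close> opposite to \<open>x\<close>.\<close>

lemma positive_multiplier:
  assumes "x \<notin> zeroes s" "balance (bloch x) = \<mu> *\<^sub>R bloch y" "\<mu> > 0"
  shows "y \<in> hull_of_zeroes"
    and "(\<nexists>p. hull_of_zeroes = {p}) \<Longrightarrow> y \<in> convex_interior hull_of_zeroes"
proof -
  have "(1 / \<mu>) *\<^sub>R balance (bloch x) \<in> convex_cone hull (v ` {..<n})"
    using assms(3) by (intro convex_cone_scaleR[OF convex_cone_convex_cone_hull] balance_in_cone assms(1)) simp
  then show y: "y \<in> hull_of_zeroes" unfolding hull_of_zeroes_eq assms(2) using assms(3) by simp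
  assume "\<nexists>p. hull_of_zeroes = {p}"
  then show "y \<in> convex_interior hull_of_zeroes"
    unfolding hull_of_zeroes_def
  proof (rule convex_interior_hull[rotated 3])
    show "finite (zeroes s)" "zeroes s \<noteq> {}" unfolding zeroes_eq using n_pos by auto
    show "y \<in> geodesically_convex hull (zeroes s)" using y unfolding hull_of_zeroes_def .
    show "bloch z \<bullet> bloch c > 0" if "z \<in> zeroes s" for z using zeroes_hemisphere[OF that] .
    fix h z assume h: "\<And>z. z \<in> zeroes s \<Longrightarrow> h \<bullet> bloch z \<ge> 0" "h \<bullet> bloch y = 0" "z \<in> zeroes s"
    have "h \<bullet> balance (bloch x) = 0" unfolding assms(2) using h(2) by simp
    moreover have "h \<bullet> v i \<ge> 0" if "i < n" for i using h(1)[of "zero_point i"] that unfolding zeroes_eq by simp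
    moreover obtain i where "i < n" "z = zero_point i" using h(3) unfolding zeroes_eq by blast
    ultimately show "h \<bullet> bloch z = 0" using balance_relative_interior[OF assms(1)] by blast
  qed
qed

lemma critical_in_opposite_hull:
  assumes "x \<in> critical_points n s" "x \<in> opposite ` hull_of_zeroes"
  shows "x \<notin> zeroes s"
    and "(\<nexists>p. opposite ` hull_of_zeroes = {p}) \<Longrightarrow> x \<in> convex_interior (opposite ` hull_of_zeroes)"
proof -
  have ox: "opposite x \<in> hull_of_zeroes" using assms(2) by (simp add: opposite_image_iff)
  have neg: "bloch x \<bullet> bloch c < 0"
    using hull_of_zeroes_hemisphere[OF ox] by (simp add: bloch_opposite)
  then show nz: "x \<notin> zeroes s" using zeroes_hemisphere[of x] by force
  obtain l where l: "balance (bloch x) = l *\<^sub>R bloch x" "l * (bloch x \<bullet> bloch c) > 0"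
    by (rule critical_multiplier[OF assms(1) nz])
  have "balance (bloch x) = (- l) *\<^sub>R bloch (opposite x)" "- l > 0"
    using l neg by (auto simp: bloch_opposite zero_less_mult_iff)
  note i = positive_multiplier(2)[OF nz this]
  assume "\<nexists>p. opposite ` hull_of_zeroes = {p}"
  then have "\<nexists>p. hull_of_zeroes = {p}" by (metis image_empty image_insert)
  then have "opposite (opposite x) \<in> convex_interior (opposite ` hull_of_zeroes)"
    by (intro convex_interior_opposite i)
  then show "x \<in> convex_interior (opposite ` hull_of_zeroes)" by simp
qed

lemma critical_points_subset:
  "critical_points n s \<subseteq> hull_of_zeroes \<union> opposite ` hull_of_zeroes"
proof
  fix x assume x: "x \<in> critical_points n s"
  show "x \<in> hull_of_zeroes \<union> opposite ` hull_of_zeroes"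
  proof (cases "x \<in> zeroes s")
    case True
    then show ?thesis using zeroes_subset_hull by blast
  next
    case False
    obtain l where l: "balance (bloch x) = l *\<^sub>R bloch x" "l * (bloch x \<bullet> bloch c) > 0"
      by (rule critical_multiplier[OF x False])
    consider "l > 0" | "l < 0" using l(2) by (auto simp: zero_less_mult_iff)
    then show ?thesis
    proof cases
      case 1
      then show ?thesis using positive_multiplier(1)[OF False l(1)] by blast
    next
      case 2
      have "balance (bloch x) = (- l) *\<^sub>R bloch (opposite x)" using l by (simp add: bloch_opposite)
      then have "opposite x \<in> hull_of_zeroes" by (rule positive_multiplier(1)[OF False]) (use 2 in simp)
      then show ?thesis by (simp add: opposite_image_iff)
    qed
  qed
qed

text \<open>The maximum is critical because \<open>|s|\<^sup>2\<close> is maximal at \<open>x\<close> along every great circle through \<open>x\<close>. It is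
  not in the hemisphere, since reflection in the bounding plane would increase every factor.\<close>

lemma global_max:
  obtains x where "x \<notin> zeroes s" "x \<in> critical_points n s" "bloch x \<bullet> bloch c \<le> 0"
    "\<And>y. section_normsq n s y \<le> section_normsq n s x"
proof -
  define g where "g y = (\<Prod>i<n. 1 - y \<bullet> v i)" for y
  have "continuous_on (sphere 0 1) g" unfolding g_def by (intro continuous_intros)
  moreover have "bloch c \<in> sphere 0 1" by simp
  then have "sphere (0 :: complex \<times> real) 1 \<noteq> {}" by blast
  ultimately obtain y where y: "y \<in> sphere 0 1" "\<And>u. u \<in> sphere 0 1 \<Longrightarrow> g u \<le> g y"
    using continuous_attains_sup[OF compact_sphere] by blast
  obtain x where x: "bloch x = y" using bloch_surj[of y] y(1) by auto
  obtain C where C: "C > 0" "\<And>z. section_normsq n s z = C * g (bloch z)"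
    using section_normsq_eq unfolding g_def by blast
  have max: "section_normsq n s z \<le> section_normsq n s x" for z
    unfolding C(2) x using C(1) y(2)[of "bloch z"] by simp
  \<comment> \<open>The centre of the opposite hemisphere is not a zero, so the maximum is positive.\<close>
  have "g (- bloch c) > 0"
    unfolding g_def using hemisphere
    by (intro prod_pos) (simp add: inner_commute[of "bloch c"] add_pos_pos)
  then have gy: "g y > 0" using y(2)[of "- bloch c"] by simp
  have nz: "x \<notin> zeroes s"
  proof
    assume "x \<in> zeroes s"
    then obtain i where "i < n" "x = zero_point i" unfolding zeroes_eq by blast
    then have "1 - y \<bullet> v i = 0" by (simp add: bloch_unit flip: x)
    then have "g y = 0" unfolding g_def using \<open>i < n\<close> by (intro prod_zero) auto
    then show False using gy by simp
  qed
  note pos = factor_pos[OF nz, unfolded x]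
  have yy: "y \<bullet> y = 1" using y(1) by (simp add: norm_eq_1)
  have tang: "e \<bullet> balance y = 0" if e: "norm e = 1" "y \<bullet> e = 0" for e
  proof -
    let ?l = "\<lambda>t. cos t *\<^sub>R y + sin t *\<^sub>R e"
    have ee: "e \<bullet> e = 1" "e \<bullet> y = 0" using e by (auto simp: norm_eq_1 inner_commute)
    have "norm (?l t) = 1" for t
      unfolding norm_eq_1 using sin_cos_squared_add3[of t]
      by (simp add: inner_add_left inner_add_right yy ee e)
    then have m: "g (?l t) \<le> g (?l 0)" for t using y(2)[of "?l t"] by simp
    have d1: "((\<lambda>t. 1 - ?l t \<bullet> v i) has_real_derivative - (e \<bullet> v i)) (at 0)" for i
      unfolding inner_add_left inner_scaleR_left by (auto intro!: derivative_eq_intros)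
    have "((\<lambda>t. g (?l t)) has_real_derivative
        (\<Sum>i<n. - (e \<bullet> v i) * (\<Prod>j\<in>{..<n} - {i}. 1 - ?l 0 \<bullet> v j))) (at 0)"
      unfolding g_def by (rule has_field_derivative_prod) (rule d1)
    then have "(\<Sum>i<n. - (e \<bullet> v i) * (\<Prod>j\<in>{..<n} - {i}. 1 - ?l 0 \<bullet> v j)) = 0"
      by (rule DERIV_local_max[of _ _ _ 1]) (use m in auto)
    moreover have "(\<Sum>i<n. - (e \<bullet> v i) * (\<Prod>j\<in>{..<n} - {i}. 1 - ?l 0 \<bullet> v j)) = - g y * (e \<bullet> balance y)"
      unfolding balance_inner_sum sum_distrib_left
    proof (rule sum.cong)
      fix i assume i: "i \<in> {..<n}"
      have "g y = (1 - y \<bullet> v i) * (\<Prod>j\<in>{..<n} - {i}. 1 - y \<bullet> v j)"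
        unfolding g_def using i by (intro prod.remove) auto
      then show "- (e \<bullet> v i) * (\<Prod>j\<in>{..<n} - {i}. 1 - ?l 0 \<bullet> v j) = - g y * ((e \<bullet> v i) / (1 - y \<bullet> v i))"
        using pos[of i] i by simp
    qed simp
    ultimately show ?thesis using gy by simp
  qed
  have crit: "x \<in> critical_points n s"
    unfolding critical_iff_balance[OF nz] x
  proof (rule ccontr)
    let ?d = "balance y - (balance y \<bullet> y) *\<^sub>R y"
    assume "balance y \<noteq> (balance y \<bullet> y) *\<^sub>R y"
    then have d: "?d \<noteq> 0" by simp
    have dy: "y \<bullet> ?d = 0" by (simp add: inner_diff_right yy inner_commute)
    have "((1 / norm ?d) *\<^sub>R ?d) \<bullet> balance y = 0"
      by (rule tang) (use d dy in auto)
    then have db: "?d \<bullet> balance y = 0" using d by simp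
    have "?d \<bullet> ?d = ?d \<bullet> balance y - (balance y \<bullet> y) * (?d \<bullet> y)" by (simp only: inner_diff_right inner_scaleR_right)
    also have "\<dots> = 0" using db dy by (simp add: inner_commute[of ?d y])
    finally show False using d by simp
  qed
  have "bloch x \<bullet> bloch c \<le> 0"
  proof (rule ccontr)
    assume "\<not> bloch x \<bullet> bloch c \<le> 0"
    then have a: "y \<bullet> bloch c > 0" unfolding x by simp
    \<comment> \<open>The mirror image of \<open>y\<close> in the plane orthogonal to \<^term>\<open>bloch c\<close>.\<close>
    let ?y = "y - (2 * (y \<bullet> bloch c)) *\<^sub>R bloch c"
    have "?y \<bullet> ?y = 1"
      by (simp add: inner_diff_left inner_diff_right yy bloch_unit inner_commute[of "bloch c"] algebra_simps)
    then have "?y \<in> sphere 0 1" by (simp add: norm_eq_1)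
    then have "g ?y \<le> g y" by (rule y(2))
    moreover have "g y < g ?y"
      unfolding g_def
    proof (rule prod_mono_strict[of 0])
      show "0 \<in> {..<n}" using n_pos by simp
      have lt: "1 - y \<bullet> v i < 1 - ?y \<bullet> v i" if "i < n" for i
        using a hemisphere[OF that] by (simp add: inner_diff_left inner_commute[of "bloch c"])
      show "1 - y \<bullet> v 0 < 1 - ?y \<bullet> v 0" using lt n_pos by simp
      show "0 \<le> 1 - y \<bullet> v i \<and> 1 - y \<bullet> v i \<le> 1 - ?y \<bullet> v i" if "i \<in> {..<n}" for i
        using lt[of i] pos[of i] that by simp
      show "0 < 1 - ?y \<bullet> v i" if "i \<in> {..<n}" for i using lt[of i] pos[of i] that by simp
    qed auto
    ultimately show False by simp
  qed
  then show ?thesis using that nz crit max by blast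
qed

lemma max_in_opposite_hull:
  obtains x where "x \<notin> zeroes s" "x \<in> critical_points n s" "x \<in> opposite ` hull_of_zeroes"
    "\<And>y. section_normsq n s y \<le> section_normsq n s x"
proof -
  obtain x where x: "x \<notin> zeroes s" "x \<in> critical_points n s" "bloch x \<bullet> bloch c \<le> 0"
    "\<And>y. section_normsq n s y \<le> section_normsq n s x" by (rule global_max) (rule that)
  have "x \<notin> hull_of_zeroes" using hull_of_zeroes_hemisphere[of x] x(3) by force
  then have "x \<in> opposite ` hull_of_zeroes" using critical_points_subset x(2) by blast
  then show ?thesis using that x by blast
qed

lemma simple_zeroes_critical_in_interior:
  assumes inj: "inj_on zero_point {..<n}" and n2: "2 \<le> n"
  shows "critical_points n s \<inter> hull_of_zeroes \<noteq> {}"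
    and "critical_points n s \<inter> hull_of_zeroes \<subseteq> convex_interior hull_of_zeroes"
proof -
  have r01: "zero_point 0 \<noteq> zero_point 1" using inj_onD[OF inj, of 0 1] n2 by auto
  have "zero_point 0 \<in> hull_of_zeroes" "zero_point 1 \<in> hull_of_zeroes"
    using zeroes_subset_hull n2 unfolding zeroes_eq by auto
  then have np: "\<nexists>p. hull_of_zeroes = {p}" using r01 by auto
  have nc: "x \<notin> zeroes s" if "x \<in> critical_points n s" for x
    using that simple_zero_point_not_critical inj unfolding zeroes_eq inj_on_def by blast
  show "critical_points n s \<inter> hull_of_zeroes \<subseteq> convex_interior hull_of_zeroes"
  proof
    fix x assume x: "x \<in> critical_points n s \<inter> hull_of_zeroes"
    then have nz: "x \<notin> zeroes s" using nc by blast
    obtain l where l: "balance (bloch x) = l *\<^sub>R bloch x" "l * (bloch x \<bullet> bloch c) > 0"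
      using critical_multiplier x nz by blast
    have "bloch x \<bullet> bloch c > 0" using x hull_of_zeroes_hemisphere by blast
    then have "l > 0" using l(2) by (simp add: zero_less_mult_iff)
    then show "x \<in> convex_interior hull_of_zeroes" using positive_multiplier(2)[OF nz l(1)] np by blast
  qed
  let ?V = "v ` {..<n}"
  have injv: "inj_on v {..<n}" using inj unfolding inj_on_def bloch_eq_iff .
  obtain y r where y: "norm y = 1" "y \<notin> ?V" "r > 0" "(\<Sum>u\<in>?V. (1 / (1 - y \<bullet> u)) *\<^sub>R u) = r *\<^sub>R y"
  proof (rule exists_balanced_point[of ?V "bloch c"])
    show "\<nexists>a. ?V \<subseteq> {a}"
    proof
      assume "\<exists>a. ?V \<subseteq> {a}"
      then obtain a where "v 0 = a" "v 1 = a" using n2 by (auto simp: image_subset_iff)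
      then show False using r01 bloch_eq_iff by metis
    qed
  qed (use hemisphere in auto)
  obtain x where x: "bloch x = y" using bloch_surj[OF y(1)] by blast
  have nz: "x \<notin> zeroes s" using y(2) x unfolding zeroes_eq by auto
  have b: "balance (bloch x) = r *\<^sub>R bloch x"
    using y(4) unfolding x balance_def by (simp add: sum.reindex[OF injv])
  then have "x \<in> critical_points n s"
    unfolding critical_iff_balance[OF nz] by (simp add: bloch_unit)
  moreover have "x \<in> hull_of_zeroes" by (rule positive_multiplier(1)[OF nz b y(3)])
  ultimately show "critical_points n s \<inter> hull_of_zeroes \<noteq> {}" by blast
qed

end

section \<open>The theorem\<close>

theorem theorem1p3:
  fixes n :: nat
    and s :: "complex \<times> complex \<Rightarrow> complex"
    and P P_inf C :: "cp1 set"
  assumes "n \<ge> 2"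
    and "s \<in> hol_sections n"
    and "s \<noteq> (\<lambda>_. 0)"
    and "\<exists>c. zeroes s \<subseteq> open_hemisphere c"
    and "P = geodesically_convex hull (zeroes s)"
    and "P_inf = opposite ` P"
    and "C = critical_points n s"
  shows "C = (C \<inter> P) \<union> (C \<inter> P_inf)
    \<and> C \<inter> P_inf \<noteq> {}
    \<and> ((\<nexists>p. P = {p}) \<longrightarrow> C \<inter> P_inf \<subseteq> convex_interior P_inf)
    \<and> (\<exists>x \<in> C \<inter> P_inf. nondegenerate_at (log_normsq n s) x \<longrightarrow> has_index n s x 2)
    \<and> ((\<forall>x. real_critical_point (section_normsq n s) x \<longrightarrow>
              nondegenerate_at (section_normsq n s) x)
         \<longrightarrow> C \<inter> P \<noteq> {} \<and> C \<inter> P \<subseteq> convex_interior P)"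
proof -
  obtain \<kappa> W where W: "\<kappa> \<noteq> 0" "\<And>i. W i \<noteq> 0" "s = (\<lambda>Z. \<kappa> * (\<Prod>i<n. hdet Z (W i)))"
    by (rule hol_sections_factorization[OF assms(2,3)]) (rule that)
  interpret factored_section n s \<kappa> W by unfold_locales (use W assms(2) in auto)
  obtain c where c: "zeroes s \<subseteq> open_hemisphere c" using assms(4) by blast
  interpret hemispherical_section n s \<kappa> W c
    by unfold_locales (use c assms(1) in \<open>auto simp: zeroes_eq open_hemisphere_iff\<close>)
  have P: "P = hull_of_zeroes" using assms(5) unfolding hull_of_zeroes_def .
  have Pi: "P_inf = opposite ` hull_of_zeroes" using assms(6) P by simp
  have Pp: "\<nexists>p. P_inf = {p}" if "\<nexists>p. P = {p}"
  proof
    assume "\<exists>p. P_inf = {p}"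
    then obtain p where "opposite ` opposite ` P = {opposite p}" using assms(6) by auto
    then show False using that by (simp add: image_image)
  qed
  obtain m where m: "m \<notin> zeroes s" "m \<in> critical_points n s" "m \<in> opposite ` hull_of_zeroes"
    "\<And>y. section_normsq n s y \<le> section_normsq n s m" by (rule max_in_opposite_hull) (rule that)
  show ?thesis
  proof (intro conjI impI)
    show "C = (C \<inter> P) \<union> (C \<inter> P_inf)"
      using critical_points_subset unfolding assms(7) P Pi by blast
    show "C \<inter> P_inf \<noteq> {}" using m unfolding assms(7) Pi by blast
    show "C \<inter> P_inf \<subseteq> convex_interior P_inf" if "\<nexists>p. P = {p}"
      using critical_in_opposite_hull(2) Pp[OF that] unfolding assms(7) Pi by blast
    show "\<exists>x \<in> C \<inter> P_inf. nondegenerate_at (log_normsq n s) x \<longrightarrow> has_index n s x 2"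
      using m index_at_global_max[OF m(1,4)] unfolding assms(7) Pi by blast
    assume nd: "\<forall>x. real_critical_point (section_normsq n s) x \<longrightarrow> nondegenerate_at (section_normsq n s) x"
    have inj: "inj_on zero_point {..<n}"
    proof (rule inj_onI, rule ccontr)
      fix i j assume "i \<in> {..<n}" "j \<in> {..<n}" "zero_point i = zero_point j" "i \<noteq> j"
      then show False using double_zero_point_degenerate[of i j] nd by auto
    qed
    show "C \<inter> P \<noteq> {}" "C \<inter> P \<subseteq> convex_interior P"
      using simple_zeroes_critical_in_interior[OF inj assms(1)] unfolding assms(7) P by blast+
  qed
qed

end
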